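(* Let $\Omega$ be a countable set of nonzero complex numbers with $\#\Omega\ge5$ and $a:\Omega\to\mathbb{C}\setminus\{0\}$ a function such that $\sum_{\omega\in\Omega}|a(\omega)|$ converges. Write $\Pi=(\Omega,a)$ and $f_\Pi(t):=\sum_{\omega\in\Omega}a(\omega)e^{-it\omega}$ $(t \in \mathbb{R})$. Assume that $\Omega\subset\mathbb{R}$ and that $\Omega$ is linearly independent over $\mathbb{Q}$. Then there exists a function $M_\Pi:\mathbb{C}\to\mathbb{R}_{\ge0}$ for which $$\lim_{T\to\infty}\frac1T\int_0^T\Phi(f_\Pi(t))\,dt=\int_{\mathbb{C}}M_\Pi(w)\Phi(w)\,|dw|$$ holds for every test function $\Phi:\mathbb{C}\to\mathbb{C}$ which is locally Riemann integrable. The function $M_\Pi$ is explicitly constructible, continuous, nonnegative, compactly supported, and $\int_{\mathbb{C}}M_\Pi(w)\,|dw|=1$. More precisely, $$\operatorname{supp}M_\Pi\subseteq\Bigl\{w\in\mathbb{C}: |w|\le\sum_{\omega\in\Omega}|a(\omega)|\Bigr\},$$ and equality holds in this inclusion if $$\max_{\omega\in\Omega}|a(\omega)|<\frac12\sum_{\omega\in\Omega}|a(\omega)|.$$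
   Context: Here $|dw|=du\,dv/(2\pi)$ for $w=u+iv$. "Locally Riemann integrable" means Riemann integrable on every bounded rectangle. The phrase "explicitly constructible" is descriptive only. $\operatorname{supp}$ denotes the (closed) support.
   Formalization: The limit formula is stated for those locally Riemann integrable Φ for which the integrals of Φ(f_Π(t)) over [0,T] exist for all T>0; without this the left-hand side can be undefined (Φ the indicator of a non-measurable piece of the curve). *)

theory Defs
  imports "HOL-Analysis.Analysis"
begin

text \<open>
  Riemann integrability on a box, as opposed to the Henstock--Kurzweil integrability
  \<open>integrable_on\<close> of the library: the gauge is the constant \<open>\<delta>\<close>, i.e. the Riemann sums
  converge as the mesh of the tagged division tends to zero.
\<close>

definition riemann_integrable_on ::
  "('a::euclidean_space \<Rightarrow> 'b::real_normed_vector) \<Rightarrow> 'a set \<Rightarrow> bool"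
  (infixr \<open>riemann'_integrable'_on\<close> 46) where
  "f riemann_integrable_on S \<longleftrightarrow>
     (\<exists>I. \<forall>\<epsilon>>0. \<exists>\<delta>>0. \<forall>p. p tagged_division_of S \<and> (\<lambda>x. ball x \<delta>) fine p \<longrightarrow>
        norm ((\<Sum>(x, K)\<in>p. measure lborel K *\<^sub>R f x) - I) < \<epsilon>)"

definition locally_riemann_integrable :: "(complex \<Rightarrow> complex) \<Rightarrow> bool" where
  "locally_riemann_integrable \<Phi> \<longleftrightarrow> (\<forall>u v. \<Phi> riemann_integrable_on cbox u v)"

text \<open>The integral with respect to \<open>|dw| = du dv / (2 \<pi>)\<close> for \<open>w = u + i v\<close>.\<close>

definition plane_integral ::
  "(complex \<Rightarrow> 'b::{banach, second_countable_topology}) \<Rightarrow> 'b" where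
  "plane_integral g = (LINT w|lebesgue. g w) /\<^sub>R (2 * pi)"

definition supp :: "('a::topological_space \<Rightarrow> 'b::zero) \<Rightarrow> 'a set" where
  "supp f = closure {x. f x \<noteq> 0}"

definition lin_indep_over_rat :: "complex set \<Rightarrow> bool" where
  "lin_indep_over_rat S \<longleftrightarrow> module.independent (\<lambda>(q::rat) z. of_rat q * z) S"

text \<open>The function \<open>f\<^sub>\<Pi>\<close> for \<open>\<Pi> = (\<Omega>, a)\<close>.\<close>

definition f_Pi :: "complex set \<Rightarrow> (complex \<Rightarrow> complex) \<Rightarrow> real \<Rightarrow> complex" where
  "f_Pi \<Omega> a t = (\<Sum>\<^sub>\<infinity>\<omega>\<in>\<Omega>. a \<omega> * exp (- (\<i> * complex_of_real t * \<omega>)))"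

end

theory Submission
  imports Defs "HOL-Probability.Probability" "HOL-Computational_Algebra.Polynomial"
begin

text \<open>
  Write \<open>J s\<close> for the mean of \<open>cis (s * cos x)\<close> over a period. By the linear independence of the
  frequencies, the time average of \<open>cis (z \<bullet> f t)\<close> is the product of the numbers
  \<open>J (norm z * norm (a \<omega>))\<close> (Weyl equidistribution, proved through trigonometric polynomials).
  Integration by parts gives \<open>J s = O(s powr (- 1 / 2))\<close>, so five frequencies make this product
  integrable over the plane, and its inverse Fourier transform is the density sought. Riemann
  integrable test functions are squeezed between Lipschitz ones. The support is the full disc
  because every point of the open disc is a finite linkage with arms of length \<open>norm (a \<omega>)\<close> up to
  a small tail, and the times at which \<open>f t\<close> is close to that linkage have positive density.
\<close>

section \<open>Gaussian kernels on the plane\<close>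

text \<open>Five is the threshold because a power of \<open>1 + norm z\<close> is integrable over
  the plane only for exponents below -2: four factors of order -1/2 land exactly on the borderline,
  five give -5/2. Integrability of the characteristic function then yields a continuous density at
  once.

  A Riemann integrable test function may take arbitrary bounded values on a set of zero content, for
  instance along a smooth arc traced by \<open>f\<close>. So \<open>\<Phi> (f t)\<close> can fail to
  be integrable in \<open>t\<close>, and existence of the time integrals is carried as a hypothesis.
  Under it, a Lipschitz majorant gives an upper bound for the averages, and the same argument for
  \<open>- h\<close> gives the lower bound.

  For the support, a single time at which \<open>f t\<close> is close to a given point proves
  nothing about a density. A positive proportion of times is required, hence a quantitative kernel
  argument whose lower bound is polynomial in \<open>n\<close> and whose error is exponential in
  \<open>n\<close>.\<close>

lemma lborel_complex_eq_distr:
  "(lborel :: complex measure) = distr (lborel \<Otimes>\<^sub>M lborel) borel (\<lambda>(x, y). Complex x y)"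
proof (rule lborel_eqI)
  have [measurable]: "(\<lambda>(x, y). Complex x y) \<in> borel_measurable borel"
    by (intro borel_measurable_continuous_onI) (auto simp: case_prod_beta Complex_eq intro!: continuous_intros)
  show "sets (distr (lborel \<Otimes>\<^sub>M lborel) borel (\<lambda>(x, y). Complex x y)) = sets borel" by simp
  fix l u :: complex
  assume le: "\<And>b. b \<in> Basis \<Longrightarrow> l \<bullet> b \<le> u \<bullet> b"
  then have le': "Re l \<le> Re u" "Im l \<le> Im u"
    using le[of 1] le[of \<i>] by (auto simp: Basis_complex_def inner_complex_def)
  have "emeasure (distr (lborel \<Otimes>\<^sub>M lborel) borel (\<lambda>(x, y). Complex x y)) (box l u)
      = emeasure (lborel \<Otimes>\<^sub>M lborel) ((\<lambda>(x, y). Complex x y) -` box l u)"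
    by (subst emeasure_distr) (auto simp: lborel_prod)
  also have "(\<lambda>(x, y). Complex x y) -` box l u = box (Re l) (Re u) \<times> box (Im l) (Im u)"
    by (auto simp: in_box_complex_iff)
  also have "emeasure (lborel \<Otimes>\<^sub>M lborel) \<dots> = ennreal (Re u - Re l) * ennreal (Im u - Im l)"
    using le' by (simp add: lborel.emeasure_pair_measure_Times)
  also have "\<dots> = ennreal (\<Prod>b\<in>Basis. (u - l) \<bullet> b)"
    using le' by (simp add: Basis_complex_def inner_complex_def ennreal_mult)
  finally show "emeasure (distr (lborel \<Otimes>\<^sub>M lborel) borel (\<lambda>(x, y). Complex x y)) (box l u)
      = ennreal (\<Prod>b\<in>Basis. (u - l) \<bullet> b)" by simp
qed

text \<open>Fubini after identifying the plane with a product of lines. All explicit integrals over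
  the plane reduce to this: the Gaussian ones, and the majorant for powers of
  \<open>1 + norm z\<close>.\<close>

lemma has_bochner_integral_lborel_complex_prod:
  fixes f g :: "real \<Rightarrow> 'a::{real_normed_field, banach, second_countable_topology}"
  assumes "has_bochner_integral lborel f I" "has_bochner_integral lborel g J"
  shows "has_bochner_integral lborel (\<lambda>z. f (Re z) * g (Im z)) (I * J)"
proof -
  interpret lborel_pair: pair_sigma_finite "lborel :: real measure" "lborel :: real measure" ..
  have [measurable]: "(\<lambda>(x, y). Complex x y) \<in> borel_measurable borel"
    by (intro borel_measurable_continuous_onI) (auto simp: case_prod_beta Complex_eq intro!: continuous_intros)
  have fg: "integrable lborel f" "integrable lborel g" "integral\<^sup>L lborel f = I" "integral\<^sup>L lborel g = J"
    using assms by (auto simp: has_bochner_integral_iff)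
  have C: "(\<lambda>p. Complex (fst p) (snd p)) \<in> borel_measurable borel"
    by (intro borel_measurable_continuous_onI)
       (auto simp: Complex_eq intro!: continuous_intros)
  have [measurable]: "f \<in> borel_measurable borel" "g \<in> borel_measurable borel"
    using fg by auto
  have *: "integrable (lborel \<Otimes>\<^sub>M lborel) (\<lambda>(x, y). f x * g y)"
  proof (rule lborel_pair.Fubini_integrable)
    show "(\<lambda>(x, y). f x * g y) \<in> borel_measurable (lborel \<Otimes>\<^sub>M lborel)" by measurable
    show "integrable lborel (\<lambda>x. LINT y|lborel. norm (case (x, y) of (x, y) \<Rightarrow> f x * g y))"
      using fg by (auto simp: norm_mult)
    show "AE x in lborel. integrable lborel (\<lambda>y. case (x, y) of (x, y) \<Rightarrow> f x * g y)"
      using fg by auto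
  qed
  then have "integral\<^sup>L (lborel \<Otimes>\<^sub>M lborel) (\<lambda>(x, y). f x * g y) = I * J"
    using fg lborel_pair.integral_fst'[OF *] by simp
  moreover have "(\<lambda>z. f (Re z) * g (Im z)) \<in> borel_measurable borel" by measurable
  ultimately show ?thesis using *
    unfolding has_bochner_integral_iff
    by (subst (1 2) lborel_complex_eq_distr)
       (simp add: lborel_prod integrable_distr_eq integral_distr case_prod_beta' C)
qed

text \<open>The characteristic function of the standard normal law at \<open>x / s\<close>, after
  the substitution \<open>u\<close> to \<open>s * u\<close>; the factor \<open>sqrt (2 * pi)\<close>
  removes the normalisation of the density.\<close>

lemma gaussian_fourier_real:
  fixes s x :: real
  assumes s: "s > 0"
  shows "has_bochner_integral lborel (\<lambda>u. complex_of_real (exp (- (s\<^sup>2 * u\<^sup>2) / 2)) * cis (u * x))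
           (sqrt (2 * pi) / s * exp (- x\<^sup>2 / (2 * s\<^sup>2)))"
proof -
  have *: "has_bochner_integral lborel
     (\<lambda>u. std_normal_density u *\<^sub>R iexp ((x / s) * u)) (exp (- ((x/s)\<^sup>2) / 2))"
  proof -
    have "integrable lborel (\<lambda>u. std_normal_density u *\<^sub>R iexp ((x / s) * u))"
      by (rule Bochner_Integration.integrable_bound[OF integrable_std_normal_moment[of 0]]) auto
    moreover have "(LINT u|lborel. std_normal_density u *\<^sub>R iexp ((x / s) * u)) = exp (- ((x/s)\<^sup>2) / 2)"
      using fun_cong[OF char_std_normal_distribution, of "x / s"] unfolding char_def
      by (subst (asm) integral_density) (auto simp: normal_density_nonneg)
    ultimately show ?thesis by (simp add: has_bochner_integral_iff)
  qed
  have "has_bochner_integral lborel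
     (\<lambda>u. std_normal_density (0 + s * u) *\<^sub>R iexp ((x / s) * (0 + s * u))) (complex_of_real (exp (- ((x/s)\<^sup>2) / 2)) /\<^sub>R \<bar>s\<bar>)"
    using s by (intro lborel_has_bochner_integral_real_affine_iff[THEN iffD1, OF _ *]) auto
  then have "has_bochner_integral lborel
     (\<lambda>u. sqrt (2 * pi) *\<^sub>R (std_normal_density (s * u) *\<^sub>R iexp ((x / s) * (s * u)))) (sqrt (2 * pi) *\<^sub>R (complex_of_real (exp (- ((x/s)\<^sup>2) / 2)) /\<^sub>R \<bar>s\<bar>))"
    by (intro has_bochner_integral_scaleR_right) auto
  moreover have "sqrt (2 * pi) *\<^sub>R (std_normal_density (s * u) *\<^sub>R iexp ((x / s) * (s * u))) = 
     complex_of_real (exp (- (s\<^sup>2 * u\<^sup>2) / 2)) * cis (u * x)" for u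
    using s by (simp add: std_normal_density_def scaleR_conv_of_real cis_conv_exp power_mult_distrib mult_ac
      flip: of_real_mult)
  moreover have "sqrt (2 * pi) *\<^sub>R (complex_of_real (exp (- ((x/s)\<^sup>2) / 2)) /\<^sub>R \<bar>s\<bar>) = 
     (sqrt (2 * pi) / s * exp (- x\<^sup>2 / (2 * s\<^sup>2)))" 
    using s by (simp add: scaleR_conv_of_real power_divide field_simps)
  ultimately show ?thesis by simp
qed

lemma gaussian_fourier:
  fixes s :: real and w :: complex
  assumes s: "s > 0"
  shows "has_bochner_integral lborel (\<lambda>z. complex_of_real (exp (- (s\<^sup>2 * (norm z)\<^sup>2) / 2)) * cis (z \<bullet> w))
           (2 * pi / s\<^sup>2 * exp (- (norm w)\<^sup>2 / (2 * s\<^sup>2)))"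
proof -
  have "has_bochner_integral lborel (\<lambda>z. (complex_of_real (exp (- (s\<^sup>2 * (Re z)\<^sup>2) / 2)) * cis (Re z * Re w)) *
     (complex_of_real (exp (- (s\<^sup>2 * (Im z)\<^sup>2) / 2)) * cis (Im z * Im w)))
     (of_real (sqrt (2 * pi) / s * exp (- (Re w)\<^sup>2 / (2 * s\<^sup>2))) * of_real (sqrt (2 * pi) / s * exp (- (Im w)\<^sup>2 / (2 * s\<^sup>2))))"
    by (intro has_bochner_integral_lborel_complex_prod gaussian_fourier_real s)
  moreover have "complex_of_real (exp (- (s\<^sup>2 * (Re z)\<^sup>2) / 2)) * cis (Re z * Re w) *
     (complex_of_real (exp (- (s\<^sup>2 * (Im z)\<^sup>2) / 2)) * cis (Im z * Im w)) =
     complex_of_real (exp (- (s\<^sup>2 * (norm z)\<^sup>2) / 2)) * cis (z \<bullet> w)" for z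
  proof -
    have "exp (- (s\<^sup>2 * (Re z)\<^sup>2) / 2) * exp (- (s\<^sup>2 * (Im z)\<^sup>2) / 2) = exp (- (s\<^sup>2 * (norm z)\<^sup>2) / 2)"
      by (simp add: cmod_power2 algebra_simps add_divide_distrib flip: exp_add)
    moreover have "cis (Re z * Re w) * cis (Im z * Im w) = cis (z \<bullet> w)"
      by (simp add: cis_mult inner_complex_def)
    ultimately show ?thesis
      by (simp add: mult_ac flip: of_real_mult)
  qed
  moreover have "sqrt (2 * pi) / s * exp (- (Re w)\<^sup>2 / (2 * s\<^sup>2)) * (sqrt (2 * pi) / s * exp (- (Im w)\<^sup>2 / (2 * s\<^sup>2)))
     = 2 * pi / s\<^sup>2 * exp (- (norm w)\<^sup>2 / (2 * s\<^sup>2))"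
  proof -
    have "exp (- (Re w)\<^sup>2 / (2 * s\<^sup>2)) * exp (- (Im w)\<^sup>2 / (2 * s\<^sup>2)) = exp (- (norm w)\<^sup>2 / (2 * s\<^sup>2))"
      by (simp add: cmod_power2 diff_divide_distrib flip: exp_add)
    then show ?thesis by (simp add: power2_eq_square field_simps)
  qed
  ultimately show ?thesis by (simp only: flip: of_real_mult)
qed

text \<open>The centred isotropic normal density with variance \<open>s\<^sup>2\<close> in each
  coordinate. At \<open>s = 0\<close> division by zero makes it the constant 0, so it is continuous
  for every \<open>s\<close>.\<close>

definition gauss_kernel :: "real \<Rightarrow> complex \<Rightarrow> real" where
  "gauss_kernel s w = exp (- (norm w)\<^sup>2 / (2 * s\<^sup>2)) / (2 * pi * s\<^sup>2)"

lemma gauss_kernel_nonneg: "0 \<le> gauss_kernel s w"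
  by (simp add: gauss_kernel_def)

lemma gauss_kernel_le: "gauss_kernel s w \<le> 1 / (2 * pi * s\<^sup>2)"
  by (auto simp: gauss_kernel_def intro!: divide_right_mono)

lemma gauss_kernel_minus_commute: "gauss_kernel s (x - y) = gauss_kernel s (y - x)"
  by (simp add: gauss_kernel_def norm_minus_commute)

lemma continuous_on_gauss_kernel: "continuous_on A (gauss_kernel s)"
  unfolding gauss_kernel_def by (cases "s = 0") (auto intro!: continuous_intros)

lemma borel_measurable_gauss_kernel [measurable]: "gauss_kernel s \<in> borel_measurable borel"
  by (intro borel_measurable_continuous_onI continuous_on_gauss_kernel)

lemma has_bochner_integral_gaussian:
  fixes s :: real
  assumes s: "s > 0"
  shows "has_bochner_integral lborel (\<lambda>z::complex. exp (- (s\<^sup>2 * (norm z)\<^sup>2) / 2)) (2 * pi / s\<^sup>2)"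
proof -
  have "has_bochner_integral lborel (\<lambda>z::complex. complex_of_real (exp (- (s\<^sup>2 * (norm z)\<^sup>2) / 2))) (of_real (2 * pi / s\<^sup>2))"
    using gaussian_fourier[OF s, of 0] by simp
  from has_bochner_integral_Re[OF this] show ?thesis by simp
qed

lemma has_bochner_integral_gauss_kernel:
  assumes s: "s > 0"
  shows "has_bochner_integral lborel (gauss_kernel s) 1"
proof -
  have "has_bochner_integral lborel (\<lambda>z::complex. exp (- ((1/s)\<^sup>2 * (norm z)\<^sup>2) / 2) / (2 * pi * s\<^sup>2)) 
     ((2 * pi / (1/s)\<^sup>2) / (2 * pi * s\<^sup>2))"
    using s by (intro has_bochner_integral_divide_zero has_bochner_integral_gaussian) auto
  then show ?thesis using s by (simp add: gauss_kernel_def[abs_def] power_divide field_simps)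
qed

text \<open>The factor \<open>norm w\<close> is absorbed by giving up half of the exponent, which
  doubles the variance. As the wider kernel has mass 1, the first moment is at most
  \<open>2 * s\<close>.\<close>

lemma gauss_kernel_first_moment_le:
  assumes s: "s > 0"
  shows "norm w * gauss_kernel s w \<le> 2 * s * gauss_kernel (sqrt 2 * s) w"
proof -
  define v where "v = norm w / s"
  have v: "norm w = v * s" "v \<ge> 0" using s by (auto simp: v_def)
  \<comment> \<open>This is \<open>(v / 2 - 1)\<^sup>2 \<ge> 0\<close>; the right side is the
    beginning of the exponential series of \<open>v\<^sup>2 / 4\<close>.\<close>
  have "v \<le> 1 + v\<^sup>2 / 4"
    using zero_le_power2[of "v / 2 - 1"] by (simp add: power2_eq_square algebra_simps)
  also have "\<dots> \<le> exp (v\<^sup>2 / 4)" by (rule exp_ge_add_one_self)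
  finally have "v * exp (- v\<^sup>2 / 2) \<le> exp (v\<^sup>2 / 4) * exp (- v\<^sup>2 / 2)" by (intro mult_right_mono) auto
  also have "\<dots> = exp (- v\<^sup>2 / 4)" by (simp flip: exp_add)
  finally have *: "v * exp (- v\<^sup>2 / 2) \<le> exp (- v\<^sup>2 / 4)" .
  have "norm w * gauss_kernel s w = (v * exp (- v\<^sup>2 / 2)) / (2 * pi * s)"
    using s by (simp add: gauss_kernel_def v power_mult_distrib power2_eq_square field_simps)
  also have "\<dots> \<le> exp (- v\<^sup>2 / 4) / (2 * pi * s)" using * s by (intro divide_right_mono) auto
  also have "\<dots> = 2 * s * gauss_kernel (sqrt 2 * s) w"
    using s by (simp add: gauss_kernel_def v power_mult_distrib power2_eq_square field_simps)
  finally show ?thesis .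
qed

section \<open>Fourier inversion in the plane\<close>

text \<open>Interchange of limits: for every tolerance it is enough to have one convergent
  approximant that is eventually close to \<open>f\<close> and whose limit is close to
  \<open>l\<close>.\<close>

lemma tendsto_approx:
  fixes f :: "'a \<Rightarrow> 'b::real_normed_vector"
  assumes "\<And>e. e > 0 \<Longrightarrow> \<exists>g m. (g \<longlongrightarrow> m) F \<and> (\<forall>\<^sub>F x in F. norm (f x - g x) \<le> e) \<and> norm (m - l) \<le> e"
  shows "(f \<longlongrightarrow> l) F"
proof (rule tendstoI)
  fix e :: real assume "e > 0"
  then obtain g m where g: "(g \<longlongrightarrow> m) F" "\<forall>\<^sub>F x in F. norm (f x - g x) \<le> e / 4" "norm (m - l) \<le> e / 4"
    using assms[of "e / 4"] by auto
  from tendstoD[OF g(1), of "e / 4"] \<open>e > 0\<close> have "\<forall>\<^sub>F x in F. dist (g x) m < e / 4" by auto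
  with g(2) show "\<forall>\<^sub>F x in F. dist (f x) l < e"
  proof eventually_elim
    case (elim x)
    have "norm (f x - l) \<le> norm (f x - g x) + norm (g x - m) + norm (m - l)"
      using norm_triangle_ineq[of "f x - g x" "g x - m"] norm_triangle_ineq[of "f x - m" "m - l"] by simp
    then show ?case using elim g(3) \<open>e > 0\<close> by (simp add: dist_norm)
  qed
qed

text \<open>Fourier inversion in dimension two, \<open>4 * pi\<^sup>2\<close> being
  \<open>(2 * pi)\<^sup>2\<close>; a density with respect to \<open>du dv\<close>. Taking
  \<open>Re\<close> makes it real by type, before the integral is known to be real.\<close>

definition fourier_density :: "(complex \<Rightarrow> complex) \<Rightarrow> complex \<Rightarrow> real" where
  "fourier_density \<psi> w = Re (LINT z|lborel. \<psi> z * cis (- (z \<bullet> w))) / (4 * pi\<^sup>2)"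

lemma fourier_density_le:
  assumes "integrable lborel \<psi>"
  shows "\<bar>fourier_density \<psi> w\<bar> \<le> (LINT z|lborel. norm (\<psi> z)) / (4 * pi\<^sup>2)"
proof -
  have "\<bar>Re (LINT z|lborel. \<psi> z * cis (- (z \<bullet> w)))\<bar> \<le> norm (LINT z|lborel. \<psi> z * cis (- (z \<bullet> w)))"
    by (rule abs_Re_le_cmod)
  also have "\<dots> \<le> (LINT z|lborel. norm (\<psi> z * cis (- (z \<bullet> w))))" by (rule integral_norm_bound)
  finally show ?thesis by (auto simp: fourier_density_def norm_mult intro!: divide_right_mono)
qed

lemma integrable_mult_cis:
  assumes "integrable lborel \<psi>"
  shows "integrable lborel (\<lambda>z. \<psi> z * cis (- (z \<bullet> w)))"
proof -
  have [measurable]: "cis \<in> borel_measurable borel"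
    by (intro borel_measurable_continuous_onI continuous_intros)
  from assms have [measurable]: "\<psi> \<in> borel_measurable borel" by auto
  show ?thesis by (rule Bochner_Integration.integrable_bound[OF assms]) (auto simp: norm_mult)
qed

lemma fourier_density_diff:
  assumes "integrable lborel \<psi>" "integrable lborel \<kappa>"
  shows "fourier_density \<psi> w - fourier_density \<kappa> w = fourier_density (\<lambda>z. \<psi> z - \<kappa> z) w"
  using assms by (simp add: fourier_density_def integrable_mult_cis left_diff_distrib diff_divide_distrib)

lemma continuous_on_fourier_density:
  assumes \<psi>: "integrable lborel \<psi>"
  shows "continuous_on UNIV (fourier_density \<psi>)"
proof -
  have [measurable]: "cis \<in> borel_measurable borel"
    by (intro borel_measurable_continuous_onI continuous_intros)
  from \<psi> have [measurable]: "\<psi> \<in> borel_measurable borel" by auto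
  have "(\<lambda>n. LINT z|lborel. \<psi> z * cis (- (z \<bullet> X n))) \<longlonglongrightarrow> (LINT z|lborel. \<psi> z * cis (- (z \<bullet> w)))"
    if "X \<longlonglongrightarrow> w" for X and w :: complex
  proof (rule integral_dominated_convergence)
    show "integrable lborel (\<lambda>z. norm (\<psi> z))" using \<psi> by auto
    show "AE z in lborel. (\<lambda>n. \<psi> z * cis (- (z \<bullet> X n))) \<longlonglongrightarrow> \<psi> z * cis (- (z \<bullet> w))"
      using that unfolding cis_conv_exp by (intro AE_I2 tendsto_intros)
  qed (auto simp: norm_mult)
  then have "(\<lambda>n. fourier_density \<psi> (X n)) \<longlonglongrightarrow> fourier_density \<psi> w" if "X \<longlonglongrightarrow> w" for X w
    unfolding fourier_density_def using that by (intro tendsto_intros) auto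
  then show ?thesis by (auto simp: continuous_on_sequentially o_def)
qed

text \<open>Exhibiting the kernel as a superposition of characters is what lets Fubini bring in
  characteristic functions.\<close>

lemma gauss_kernel_eq_fourier:
  assumes "s > 0"
  shows "complex_of_real (gauss_kernel s w) =
    (LINT z|lborel. complex_of_real (exp (- (s\<^sup>2 * (norm z)\<^sup>2) / 2)) * cis (z \<bullet> w)) / (4 * pi\<^sup>2)"
  using gaussian_fourier[OF assms, of w] assms
  by (simp add: has_bochner_integral_iff gauss_kernel_def power2_eq_square field_simps)

text \<open>Damping the characteristic function by a Gaussian amounts to convolving the measure with a
  Gaussian density, so inversion holds after damping; integrability of \<open>\<psi>\<close> removes the damping.\<close>

locale planar_char_limit =
  fixes N :: "real \<Rightarrow> complex measure" and \<psi> :: "complex \<Rightarrow> complex"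
  assumes prob: "\<And>T. prob_space (N T)"
    and sets_N [measurable_cong]: "\<And>T. sets (N T) = sets borel"
    and char_tendsto: "\<And>z. ((\<lambda>T. LINT w|N T. cis (z \<bullet> w)) \<longlongrightarrow> \<psi> z) at_top"
    and int_\<psi>: "integrable lborel \<psi>"
begin

lemma cis_measurable [measurable]: "cis \<in> borel_measurable borel"
  by (intro borel_measurable_continuous_onI continuous_intros)

lemma \<psi>_measurable [measurable]: "\<psi> \<in> borel_measurable borel"
  using int_\<psi> by auto

lemma integrable_N:
  fixes f :: "complex \<Rightarrow> 'b::{banach, second_countable_topology}"
  assumes [measurable]: "f \<in> borel_measurable borel" and "\<And>x. norm (f x) \<le> B"
  shows "integrable (N T) f"
proof -
  interpret prob_space "N T" by (rule prob)
  show ?thesis using assms(2) by (intro integrable_const_bound[of _ B]) auto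
qed

definition damped :: "real \<Rightarrow> complex \<Rightarrow> complex" where
  "damped s z = complex_of_real (exp (- (s\<^sup>2 * (norm z)\<^sup>2) / 2)) * \<psi> z"

lemma integrable_damped: "integrable lborel (damped s)"
  unfolding damped_def
  by (rule Bochner_Integration.integrable_bound[OF int_\<psi>]) (auto simp: norm_mult mult_left_le_one_le)

text \<open>Fubini turns the smoothed mass at \<open>w\<close> into a Gaussian-weighted integral of
  the characteristic function of \<open>N T\<close>. Characteristic functions are bounded by 1, so
  the Gaussian itself dominates as \<open>T\<close> grows.\<close>

lemma gauss_kernel_tendsto:
  assumes s: "s > 0"
  shows "((\<lambda>T. LINT x|N T. gauss_kernel s (x - w)) \<longlongrightarrow> fourier_density (damped s) w) at_top"
proof -
  define G where "G z = complex_of_real (exp (- (s\<^sup>2 * (norm z)\<^sup>2) / 2))" for z :: complex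
  have G: "integrable lborel (\<lambda>z. norm (G z))"
    using has_bochner_integral_gaussian[OF s] by (simp add: G_def has_bochner_integral_iff)
  have [measurable]: "G \<in> borel_measurable borel" unfolding G_def[abs_def] by measurable
  have char_le: "norm (LINT x|N T. cis (z \<bullet> x)) \<le> 1" for T z
  proof -
    interpret prob_space "N T" by (rule prob)
    have "norm (LINT x|N T. cis (z \<bullet> x)) \<le> (LINT x|N T. norm (cis (z \<bullet> x)))" by (rule integral_norm_bound)
    then show ?thesis by (simp add: prob_space)
  qed
  have eq: "complex_of_real (LINT x|N T. gauss_kernel s (x - w)) = 
    (LINT z|lborel. G z * cis (- (z \<bullet> w)) * (LINT x|N T. cis (z \<bullet> x))) / (4 * pi\<^sup>2)" for T
  proof -
    interpret prob_space "N T" by (rule prob)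
    interpret P: pair_sigma_finite "N T" "lborel :: complex measure" ..
    have int: "integrable (N T \<Otimes>\<^sub>M lborel) (\<lambda>(x, z). G z * cis (z \<bullet> (x - w)))"
    proof (rule P.Fubini_integrable)
      show "(\<lambda>(x, z). G z * cis (z \<bullet> (x - w))) \<in> borel_measurable (N T \<Otimes>\<^sub>M lborel)" by measurable
      show "integrable (N T) (\<lambda>x. LINT z|lborel. norm (case (x, z) of (x, z) \<Rightarrow> G z * cis (z \<bullet> (x - w))))"
        by (simp add: norm_mult)
      have "integrable lborel (\<lambda>z. G z * cis (z \<bullet> (x - w)))" for x
        by (rule Bochner_Integration.integrable_bound[OF G]) (auto simp: norm_mult)
      then show "AE x in N T. integrable lborel (\<lambda>z. case (x, z) of (x, z) \<Rightarrow> G z * cis (z \<bullet> (x - w)))"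
        by simp
    qed
    have "complex_of_real (LINT x|N T. gauss_kernel s (x - w)) = 
      (LINT x|N T. (LINT z|lborel. G z * cis (z \<bullet> (x - w)))) / (4 * pi\<^sup>2)"
      by (simp add: gauss_kernel_eq_fourier[OF s] G_def flip: integral_complex_of_real)
    also have "(LINT x|N T. (LINT z|lborel. G z * cis (z \<bullet> (x - w)))) =
      (LINT z|lborel. (LINT x|N T. G z * cis (z \<bullet> (x - w))))"
      by (rule P.Fubini_integral[symmetric, OF int])
    also have "\<dots> = (LINT z|lborel. (LINT x|N T. G z * cis (- (z \<bullet> w)) * cis (z \<bullet> x)))"
      by (simp add: mult.assoc cis_mult inner_diff_right add.commute)
    also have "\<dots> = (LINT z|lborel. G z * cis (- (z \<bullet> w)) * (LINT x|N T. cis (z \<bullet> x)))"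
      by simp
    finally show ?thesis .
  qed
  have "((\<lambda>T. LINT z|lborel. G z * cis (- (z \<bullet> w)) * (LINT x|N T. cis (z \<bullet> x))) \<longlongrightarrow>
     (LINT z|lborel. G z * cis (- (z \<bullet> w)) * \<psi> z)) at_top"
  proof (rule integral_dominated_convergence_at_top[OF _ _ G])
    show "(\<lambda>z. G z * cis (- (z \<bullet> w)) * (LINT x|N T. cis (z \<bullet> x))) \<in> borel_measurable lborel" for T
    proof -
      interpret prob_space "N T" by (rule prob)
      have "(\<lambda>z. LINT x|N T. cis (z \<bullet> x)) \<in> borel_measurable borel" by measurable
      then show ?thesis by measurable
    qed
    show "AE z in lborel. ((\<lambda>T. G z * cis (- (z \<bullet> w)) * (LINT x|N T. cis (z \<bullet> x))) \<longlongrightarrow> G z * cis (- (z \<bullet> w)) * \<psi> z) at_top"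
      by (intro AE_I2 tendsto_intros char_tendsto)
    show "\<forall>\<^sub>F T in at_top. AE z in lborel. norm (G z * cis (- (z \<bullet> w)) * (LINT x|N T. cis (z \<bullet> x))) \<le> norm (G z)"
      using char_le by (auto intro!: always_eventually simp: norm_mult mult_left_le)
  qed measurable
  then have "((\<lambda>T. Re (complex_of_real (LINT x|N T. gauss_kernel s (x - w)))) \<longlongrightarrow>
     Re ((LINT z|lborel. G z * cis (- (z \<bullet> w)) * \<psi> z) / (4 * pi\<^sup>2))) at_top"
    unfolding eq by (intro tendsto_intros) auto
  moreover have "Re ((LINT z|lborel. G z * cis (- (z \<bullet> w)) * \<psi> z) / (4 * pi\<^sup>2)) = fourier_density (damped s) w"
  proof -
    have "4 * (complex_of_real pi)\<^sup>2 = complex_of_real (4 * pi\<^sup>2)" by simp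
    then show ?thesis
      unfolding fourier_density_def damped_def G_def by (simp only: Re_divide_of_real mult.commute mult.left_commute)
  qed
  ultimately show ?thesis by simp
qed

text \<open>Two inverse transforms differ everywhere by at most the L1 distance of the transformed
  functions, whence uniformity in \<open>w\<close>. Damping does not increase
  \<open>norm (\<psi> z)\<close>, so \<open>2 * norm (\<psi> z)\<close> is a majorant.\<close>

lemma damped_density_uniform:
  "\<exists>\<delta>. \<delta> \<longlonglongrightarrow> 0 \<and> (\<forall>n w. \<bar>fourier_density (damped (inverse (real (Suc n)))) w - fourier_density \<psi> w\<bar> \<le> \<delta> n)"
proof (intro exI conjI allI)
  let ?s = "\<lambda>n. inverse (real (Suc n))"
  let ?\<delta> = "\<lambda>n. (LINT z|lborel. norm (damped (?s n) z - \<psi> z)) / (4 * pi\<^sup>2)"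
  show "\<bar>fourier_density (damped (?s n)) w - fourier_density \<psi> w\<bar> \<le> ?\<delta> n" for n w
    unfolding fourier_density_diff[OF integrable_damped int_\<psi>]
    by (intro fourier_density_le Bochner_Integration.integrable_diff integrable_damped int_\<psi>)
  have "(\<lambda>n. LINT z|lborel. norm (damped (?s n) z - \<psi> z)) \<longlonglongrightarrow> (LINT z::complex|lborel. 0)"
  proof (rule integral_dominated_convergence)
    show "integrable lborel (\<lambda>z. 2 * norm (\<psi> z))" using int_\<psi> by auto
    show "(\<lambda>z. norm (damped (?s n) z - \<psi> z)) \<in> borel_measurable lborel" for n
      unfolding damped_def by measurable
    have "norm (damped t z - \<psi> z) \<le> 2 * norm (\<psi> z)" for t z
    proof -
      have "norm (damped t z) \<le> norm (\<psi> z)"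
        by (simp add: damped_def norm_mult mult_left_le_one_le)
      then show ?thesis using norm_triangle_ineq4[of "damped t z" "\<psi> z"] by simp
    qed
    then show "AE z in lborel. norm (norm (damped (?s n) z - \<psi> z)) \<le> 2 * norm (\<psi> z)" for n by auto
    have "(\<lambda>n. damped (?s n) z) \<longlonglongrightarrow> complex_of_real (exp (- (0\<^sup>2 * (norm z)\<^sup>2) / 2)) * \<psi> z" for z
      unfolding damped_def by (intro tendsto_intros LIMSEQ_inverse_real_of_nat) auto
    then have "(\<lambda>n. norm (damped (?s n) z - \<psi> z)) \<longlonglongrightarrow> norm (complex_of_real (exp (- (0\<^sup>2 * (norm z)\<^sup>2) / 2)) * \<psi> z - \<psi> z)" for z
      by (intro tendsto_intros)
    then show "AE z in lborel. (\<lambda>n. norm (damped (?s n) z - \<psi> z)) \<longlonglongrightarrow> 0" by simp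
  qed auto
  then show "?\<delta> \<longlonglongrightarrow> 0" by (auto intro!: tendsto_divide_zero)
qed

lemma damped_density_tendsto:
  "(\<lambda>n. fourier_density (damped (inverse (real (Suc n)))) w) \<longlonglongrightarrow> fourier_density \<psi> w"
proof -
  obtain \<delta> where d: "\<delta> \<longlonglongrightarrow> 0" 
    "\<And>n w. \<bar>fourier_density (damped (inverse (real (Suc n)))) w - fourier_density \<psi> w\<bar> \<le> \<delta> n"
    using damped_density_uniform by auto
  show ?thesis
    by (rule Lim_transform_bound[OF _ d(1), THEN LIM_zero_cancel]) 
       (auto intro!: always_eventually order_trans[OF d(2) abs_ge_self] simp del: of_nat_Suc)
qed

text \<open>Positivity survives both limits: first \<open>T\<close> to infinity at fixed width, then
  the width to 0.\<close>

lemma density_nonneg: "0 \<le> fourier_density \<psi> w"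
proof (rule LIMSEQ_le_const[OF damped_density_tendsto], intro exI allI impI)
  fix n :: nat
  show "0 \<le> fourier_density (damped (inverse (real (Suc n)))) w"
    by (rule tendsto_lowerbound[OF gauss_kernel_tendsto])
       (auto intro!: always_eventually integral_nonneg_AE simp: gauss_kernel_nonneg)
qed

text \<open>At distance at least \<open>d\<close> from all the mass, the kernel of width
  \<open>s\<close> is at most \<open>b s\<close>, and \<open>b s\<close> tends to 0 with
  \<open>s\<close> because the exponential beats the factor \<open>1 / s\<^sup>2\<close>.\<close>

lemma density_outside_support:
  assumes R: "\<And>T. AE w in N T. norm w \<le> R" and w: "norm w > R"
  shows "fourier_density \<psi> w = 0"
proof -
  define d where "d = norm w - R"
  have d: "d > 0" using w by (simp add: d_def)
  define b where "b s = exp (- d\<^sup>2 / (2 * s\<^sup>2)) / (2 * pi * s\<^sup>2)" for s :: real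
  have "fourier_density (damped s) w \<le> b s" if s: "s > 0" for s
  proof (rule tendsto_upperbound[OF gauss_kernel_tendsto[OF s]])
    show "\<forall>\<^sub>F T in at_top. (LINT x|N T. gauss_kernel s (x - w)) \<le> b s"
    proof (intro always_eventually allI)
      fix T
      interpret prob_space "N T" by (rule prob)
      have "(LINT x|N T. gauss_kernel s (x - w)) \<le> (LINT x|N T. b s)"
      proof (rule integral_mono_AE)
        show "integrable (N T) (\<lambda>x. gauss_kernel s (x - w))"
          by (rule integrable_N[where B = "1 / (2 * pi * s\<^sup>2)"]) (auto simp: gauss_kernel_nonneg gauss_kernel_le)
        show "AE x in N T. gauss_kernel s (x - w) \<le> b s"
          using R[of T]
        proof eventually_elim
          case (elim x)
          then have "d \<le> norm (x - w)"
            using norm_triangle_ineq2[of w x] by (simp add: d_def norm_minus_commute)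
          then have "d\<^sup>2 \<le> (norm (x - w))\<^sup>2" using d by (intro power_mono) auto
          then show ?case using s by (auto simp: gauss_kernel_def b_def intro!: divide_right_mono)
        qed
      qed auto
      then show "(LINT x|N T. gauss_kernel s (x - w)) \<le> b s" by (simp add: prob_space)
    qed
  qed auto
  then have le: "fourier_density (damped (inverse (real (Suc n)))) w \<le> b (inverse (real (Suc n)))" for n by auto
  have "(\<lambda>n. b (inverse (real (Suc n)))) \<longlonglongrightarrow> 0"
  proof -
    \<comment> \<open>With \<open>x = d\<^sup>2 / 2 * (real (Suc n))\<^sup>2\<close>, the value of
      \<open>b\<close> at \<open>1 / Suc n\<close> is \<open>x / exp x / (pi * d\<^sup>2)\<close>,
      so the standard limit of \<open>x / exp x\<close> applies.\<close>
    have "filterlim (\<lambda>n. d\<^sup>2 / 2 * (real (Suc n))\<^sup>2) at_top sequentially"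
      using d by (intro filterlim_tendsto_pos_mult_at_top[OF tendsto_const] filterlim_pow_at_top
        filterlim_compose[OF filterlim_real_sequentially filterlim_Suc]) auto
    from filterlim_compose[OF tendsto_power_div_exp_0[of 1] this]
    have "(\<lambda>n. d\<^sup>2 / 2 * (real (Suc n))\<^sup>2 / exp (d\<^sup>2 / 2 * (real (Suc n))\<^sup>2)) \<longlonglongrightarrow> 0"
      by (simp del: of_nat_Suc)
    then have "(\<lambda>n. d\<^sup>2 / 2 * (real (Suc n))\<^sup>2 / exp (d\<^sup>2 / 2 * (real (Suc n))\<^sup>2) / (pi * d\<^sup>2)) \<longlonglongrightarrow> 0"
      by (rule tendsto_divide_zero)
    also have "(\<lambda>n. d\<^sup>2 / 2 * (real (Suc n))\<^sup>2 / exp (d\<^sup>2 / 2 * (real (Suc n))\<^sup>2) / (pi * d\<^sup>2)) = (\<lambda>n. b (inverse (real (Suc n))))"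
    proof
      fix n
      define m where "m = real (Suc n)"
      have "m > 0" by (simp add: m_def)
      then show "d\<^sup>2 / 2 * (real (Suc n))\<^sup>2 / exp (d\<^sup>2 / 2 * (real (Suc n))\<^sup>2) / (pi * d\<^sup>2) = b (inverse (real (Suc n)))"
        unfolding m_def [symmetric] using d by (simp add: b_def exp_minus field_simps)
    qed
    finally show ?thesis .
  qed
  from LIMSEQ_le[OF damped_density_tendsto this] le have "fourier_density \<psi> w \<le> 0" by auto
  with density_nonneg[of w] show ?thesis by simp
qed

text \<open>Replace \<open>\<phi>\<close> by its Gaussian smoothing, for which convergence follows
  from \<open>gauss_kernel_tendsto\<close>, and let the width tend to 0. The Lipschitz constant
  makes the smoothing error independent of \<open>T\<close>; bounded support makes
  \<open>\<phi>\<close> integrable, as the exchange of integrals requires.\<close>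

lemma integral_tendsto_density:
  fixes \<phi> :: "complex \<Rightarrow> real"
  assumes lip: "L-lipschitz_on UNIV \<phi>" and supp: "\<And>w. norm w > R \<Longrightarrow> \<phi> w = 0"
  shows "((\<lambda>T. LINT w|N T. \<phi> w) \<longlongrightarrow> (LINT w|lborel. \<phi> w * fourier_density \<psi> w)) at_top"
proof -
  have cont: "continuous_on UNIV \<phi>" using lip by (rule lipschitz_on_continuous_on)
  then have [measurable]: "\<phi> \<in> borel_measurable borel" by (rule borel_measurable_continuous_onI)
  have L: "L \<ge> 0" using lip by (rule lipschitz_on_nonneg)
  obtain B where B: "\<And>w. \<bar>\<phi> w\<bar> \<le> B"
  proof -
    have "compact (\<phi> ` cball 0 R)" by (intro compact_continuous_image continuous_on_subset[OF cont]) auto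
    then obtain B where "\<forall>w\<in>cball 0 R. \<bar>\<phi> w\<bar> \<le> B" 
      by (auto dest!: compact_imp_bounded simp: bounded_iff)
    then have "\<bar>\<phi> w\<bar> \<le> max B 0" for w using supp[of w] by (cases "norm w \<le> R") (auto intro: le_max_iff_disj[THEN iffD2])
    then show ?thesis using that by blast
  qed
  have int\<phi>: "integrable lborel \<phi>"
  proof (rule Bochner_Integration.integrable_bound)
    show "integrable lborel (\<lambda>w. B * indicator (cball (0::complex) R) w)"
      using emeasure_bounded_finite[of "cball (0::complex) R"] by auto
    show "AE w in lborel. norm (\<phi> w) \<le> norm (B * indicator (cball 0 R) w)"
      using order_trans[OF B abs_ge_self] supp by (intro AE_I2) (auto simp: indicator_def not_le) 
  qed auto
  have dens_meas [measurable]: "fourier_density \<kappa> \<in> borel_measurable borel" if "integrable lborel \<kappa>" for \<kappa>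
    using continuous_on_fourier_density[OF that] by (rule borel_measurable_continuous_onI)
  have int_dens: "integrable lborel (\<lambda>w. \<phi> w * fourier_density \<kappa> w)" if \<kappa>: "integrable lborel \<kappa>" for \<kappa>
  proof (rule Bochner_Integration.integrable_bound)
    show "integrable lborel (\<lambda>w. \<phi> w * ((LINT z|lborel. norm (\<kappa> z)) / (4 * pi\<^sup>2)))"
      using int\<phi> by auto
    show "AE w in lborel. norm (\<phi> w * fourier_density \<kappa> w) \<le> norm (\<phi> w * ((LINT z|lborel. norm (\<kappa> z)) / (4 * pi\<^sup>2)))"
      using order_trans[OF fourier_density_le[OF \<kappa>] abs_ge_self] by (auto simp: abs_mult intro!: mult_left_mono simp del: times_divide_eq_right)
    show "(\<lambda>w. \<phi> w * fourier_density \<kappa> w) \<in> borel_measurable lborel" using dens_meas[OF \<kappa>] by measurable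
  qed
  \<comment> \<open>The convolution of \<open>\<phi>\<close> with the Gaussian of width
    \<open>s\<close>. The first moment bound keeps it within \<open>2 * L * s\<close> of
    \<open>\<phi>\<close> at every point.\<close>
  define \<Phi> where "\<Phi> s x = (LINT y|lborel. \<phi> y * gauss_kernel s (x - y))" for s x
  have gk_shift: "has_bochner_integral lborel (\<lambda>y. gauss_kernel s (x - y)) 1" if "s > 0" for s x
  proof -
    have "has_bochner_integral (distr lborel borel ((+) (- x))) (gauss_kernel s) 1"
      using has_bochner_integral_gauss_kernel[OF that] by (simp add: lborel_distr_plus)
    then show ?thesis
      by (simp add: has_bochner_integral_iff integrable_distr_eq integral_distr gauss_kernel_minus_commute[of s x])
  qed
  have \<Phi>_close: "\<bar>\<phi> x - \<Phi> s x\<bar> \<le> 2 * L * s" if s: "s > 0" for s x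
  proof -
    note gk = gk_shift[OF s, of x] gk_shift[of "sqrt 2 * s" x]
    have int1: "integrable lborel (\<lambda>y. \<phi> x * gauss_kernel s (x - y))"
      using gk by (simp add: has_bochner_integral_iff)
    have int2: "integrable lborel (\<lambda>y. \<phi> y * gauss_kernel s (x - y))"
      by (rule Bochner_Integration.integrable_bound[where f = "\<lambda>y. B * gauss_kernel s (x - y)"])
         (use gk B in \<open>auto simp: has_bochner_integral_iff abs_mult gauss_kernel_nonneg intro!: mult_right_mono order_trans[OF B abs_ge_self]\<close>)
    have "\<phi> x - \<Phi> s x = (LINT y|lborel. \<phi> x * gauss_kernel s (x - y)) - \<Phi> s x"
      using gk by (simp add: has_bochner_integral_iff)
    also have "\<dots> = (LINT y|lborel. (\<phi> x - \<phi> y) * gauss_kernel s (x - y))"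
      unfolding \<Phi>_def by (subst Bochner_Integration.integral_diff[symmetric, OF int1 int2]) (simp add: left_diff_distrib)
    also have "\<bar>\<dots>\<bar> \<le> (LINT y|lborel. L * (2 * s * gauss_kernel (sqrt 2 * s) (x - y)))"
    proof (rule integral_abs_bound[THEN order_trans], rule integral_mono)
      show "integrable lborel (\<lambda>y. \<bar>(\<phi> x - \<phi> y) * gauss_kernel s (x - y)\<bar>)"
        using Bochner_Integration.integrable_diff[OF int1 int2] by (auto simp: left_diff_distrib intro!: integrable_abs)
      show "integrable lborel (\<lambda>y. L * (2 * s * gauss_kernel (sqrt 2 * s) (x - y)))"
        using gk s by (auto simp: has_bochner_integral_iff)
      fix y
      have "\<bar>\<phi> x - \<phi> y\<bar> \<le> L * norm (x - y)"
        using lipschitz_onD[OF lip, of x y] by (simp add: dist_norm)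
      then have "\<bar>(\<phi> x - \<phi> y) * gauss_kernel s (x - y)\<bar> \<le> L * norm (x - y) * gauss_kernel s (x - y)"
        by (auto simp: abs_mult gauss_kernel_nonneg intro!: mult_right_mono)
      also have "\<dots> \<le> L * (2 * s * gauss_kernel (sqrt 2 * s) (x - y))"
        using gauss_kernel_first_moment_le[OF s, of "x - y"] L by (auto simp: mult.assoc intro!: mult_left_mono)
      finally show "\<bar>(\<phi> x - \<phi> y) * gauss_kernel s (x - y)\<bar> \<le> L * (2 * s * gauss_kernel (sqrt 2 * s) (x - y))" .
    qed
    also have "\<dots> = 2 * L * s" using gk s by (simp add: has_bochner_integral_iff)
    finally show ?thesis .
  qed
  have \<Phi>_meas [measurable]: "\<Phi> s \<in> borel_measurable borel" for s
    unfolding \<Phi>_def[abs_def] by measurable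
  have \<Phi>_tendsto: "((\<lambda>T. LINT x|N T. \<Phi> s x) \<longlongrightarrow> (LINT y|lborel. \<phi> y * fourier_density (damped s) y)) at_top"
    if s: "s > 0" for s
  proof -
    \<comment> \<open>The maximum of the kernel: multiplied by \<open>\<phi>\<close> it gives a
      majorant independent of \<open>T\<close>, used for Fubini and again for the limit.\<close>
    define C where "C = 1 / (2 * pi * s\<^sup>2)"
    have C: "gauss_kernel s x \<le> C" for x using gauss_kernel_le by (simp add: C_def)
    have gint: "integrable (N T) (\<lambda>x. gauss_kernel s (x - y))" for T y
      by (rule integrable_N[where B = C]) (auto simp: gauss_kernel_nonneg C)
    have g_le: "(LINT x|N T. gauss_kernel s (x - y)) \<le> C" and g_nn: "0 \<le> (LINT x|N T. gauss_kernel s (x - y))" for T y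
    proof -
      interpret prob_space "N T" by (rule prob)
      have "(LINT x|N T. gauss_kernel s (x - y)) \<le> (LINT x|N T. C)"
        using gint C by (intro integral_mono) auto
      then show "(LINT x|N T. gauss_kernel s (x - y)) \<le> C" by (simp add: prob_space)
      show "0 \<le> (LINT x|N T. gauss_kernel s (x - y))" by (intro integral_nonneg_AE) (auto simp: gauss_kernel_nonneg)
    qed
    have eq: "(LINT x|N T. \<Phi> s x) = (LINT y|lborel. \<phi> y * (LINT x|N T. gauss_kernel s (x - y)))" for T
    proof -
      interpret prob_space "N T" by (rule prob)
      interpret P: pair_sigma_finite "N T" "lborel :: complex measure" ..
      have "integrable (N T \<Otimes>\<^sub>M lborel) (\<lambda>(x, y). \<phi> y * gauss_kernel s (x - y))"
      proof (rule Bochner_Integration.integrable_bound)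
        show "integrable (N T \<Otimes>\<^sub>M lborel) (\<lambda>(x, y). C * \<phi> y)"
          by (rule P.Fubini_integrable) (use int\<phi> in auto)
        show "(\<lambda>(x, y). \<phi> y * gauss_kernel s (x - y)) \<in> borel_measurable (N T \<Otimes>\<^sub>M lborel)" by measurable
        have "\<bar>\<phi> y * gauss_kernel s (x - y)\<bar> \<le> \<bar>C * \<phi> y\<bar>" for x y
        proof -
          have "\<bar>gauss_kernel s (x - y)\<bar> \<le> \<bar>C\<bar>" using C[of "x - y"] gauss_kernel_nonneg[of s "x - y"] by linarith
          then show ?thesis by (simp add: abs_mult mult.commute[of _ "\<bar>\<phi> y\<bar>"] mult_left_mono)
        qed
        then show "AE p in N T \<Otimes>\<^sub>M lborel. norm (case p of (x, y) \<Rightarrow> \<phi> y * gauss_kernel s (x - y)) \<le> norm (case p of (x, y) \<Rightarrow> C * \<phi> y)"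
          by auto
      qed
      from P.Fubini_integral[OF this] show ?thesis unfolding \<Phi>_def by simp
    qed
    show ?thesis unfolding eq
    proof (rule integral_dominated_convergence_at_top)
      show "integrable lborel (\<lambda>y. C * \<bar>\<phi> y\<bar>)" using int\<phi> by auto
      show "(\<lambda>y. \<phi> y * fourier_density (damped s) y) \<in> borel_measurable lborel"
        using int_dens[OF integrable_damped[of s]] by auto
      show "(\<lambda>y. \<phi> y * (LINT x|N T. gauss_kernel s (x - y))) \<in> borel_measurable lborel" for T
      proof -
        interpret prob_space "N T" by (rule prob)
        have "(\<lambda>y. LINT x|N T. gauss_kernel s (x - y)) \<in> borel_measurable borel" by measurable
        then show ?thesis by measurable
      qed
      show "AE y in lborel. ((\<lambda>T. \<phi> y * (LINT x|N T. gauss_kernel s (x - y))) \<longlongrightarrow> \<phi> y * fourier_density (damped s) y) at_top"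
        by (intro AE_I2 tendsto_intros gauss_kernel_tendsto s)
      show "\<forall>\<^sub>F T in at_top. AE y in lborel. norm (\<phi> y * (LINT x|N T. gauss_kernel s (x - y))) \<le> C * \<bar>\<phi> y\<bar>"
        using g_le g_nn by (auto intro!: always_eventually mult_left_mono simp: abs_mult mult.commute[of C])
    qed
  qed
  obtain \<delta> where \<delta>: "\<delta> \<longlonglongrightarrow> 0" 
    "\<And>n w. \<bar>fourier_density (damped (inverse (real (Suc n)))) w - fourier_density \<psi> w\<bar> \<le> \<delta> n"
    using damped_density_uniform by auto
  show ?thesis
  proof (rule tendsto_approx)
    fix e :: real assume e: "e > 0"
    let ?s = "\<lambda>n. inverse (real (Suc n))"
    have "(\<lambda>n. 2 * L * ?s n) \<longlonglongrightarrow> 2 * L * 0" by (intro tendsto_intros LIMSEQ_inverse_real_of_nat)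
    then have "\<forall>\<^sub>F n in sequentially. 2 * L * ?s n < e" using e by (auto dest: order_tendstoD)
    moreover have "(\<lambda>n. \<delta> n * (LINT w|lborel. \<bar>\<phi> w\<bar>)) \<longlonglongrightarrow> 0 * (LINT w|lborel. \<bar>\<phi> w\<bar>)" by (intro tendsto_intros \<delta>)
    then have "\<forall>\<^sub>F n in sequentially. \<delta> n * (LINT w|lborel. \<bar>\<phi> w\<bar>) < e" using e by (auto dest: order_tendstoD)
    ultimately have "\<forall>\<^sub>F n in sequentially. 2 * L * ?s n < e \<and> \<delta> n * (LINT w|lborel. \<bar>\<phi> w\<bar>) < e" by (rule eventually_conj)
    then obtain n where n: "2 * L * ?s n < e" "\<delta> n * (LINT w|lborel. \<bar>\<phi> w\<bar>) < e" 
      by (auto simp: eventually_sequentially)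
    show "\<exists>g m. (g \<longlongrightarrow> m) at_top \<and> (\<forall>\<^sub>F T in at_top. norm ((LINT w|N T. \<phi> w) - g T) \<le> e)
         \<and> norm (m - (LINT w|lborel. \<phi> w * fourier_density \<psi> w)) \<le> e"
    proof (intro exI conjI)
      show "((\<lambda>T. LINT x|N T. \<Phi> (?s n) x) \<longlongrightarrow> (LINT y|lborel. \<phi> y * fourier_density (damped (?s n)) y)) at_top"
        by (rule \<Phi>_tendsto) auto
      have \<Phi>_close': "\<bar>\<phi> x - \<Phi> (?s n) x\<bar> \<le> e" for x
        using \<Phi>_close[of "?s n" x] n(1) by auto
      show "\<forall>\<^sub>F T in at_top. norm ((LINT w|N T. \<phi> w) - (LINT x|N T. \<Phi> (?s n) x)) \<le> e"
      proof (intro always_eventually allI)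
        fix T
        interpret prob_space "N T" by (rule prob)
        have i1: "integrable (N T) \<phi>" by (rule integrable_N[where B = B]) (auto simp: B)
        have i2: "integrable (N T) (\<Phi> (?s n))"
        proof (rule integrable_N[where B = "B + e"])
          show "norm (\<Phi> (?s n) x) \<le> B + e" for x
            using \<Phi>_close'[of x] B[of x] by auto
        qed measurable
        have "(LINT w|N T. \<phi> w) - (LINT x|N T. \<Phi> (?s n) x) = (LINT x|N T. \<phi> x - \<Phi> (?s n) x)"
          using i1 i2 by simp
        also have "norm \<dots> \<le> (LINT x|N T. norm (\<phi> x - \<Phi> (?s n) x))" by (rule integral_norm_bound)
        also have "\<dots> \<le> (LINT x|N T. e)" using i1 i2 \<Phi>_close' by (intro integral_mono) auto
        finally show "norm ((LINT w|N T. \<phi> w) - (LINT x|N T. \<Phi> (?s n) x)) \<le> e" by (simp add: prob_space)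
      qed
      have "(LINT y|lborel. \<phi> y * fourier_density (damped (?s n)) y) - (LINT w|lborel. \<phi> w * fourier_density \<psi> w)
        = (LINT y|lborel. \<phi> y * (fourier_density (damped (?s n)) y - fourier_density \<psi> y))"
        using int_dens[OF integrable_damped] int_dens[OF int_\<psi>] by (simp add: right_diff_distrib)
      also have "norm \<dots> \<le> (LINT y|lborel. \<delta> n * \<bar>\<phi> y\<bar>)"
      proof (rule integral_norm_bound[THEN order_trans], rule integral_mono)
        show "integrable lborel (\<lambda>y. norm (\<phi> y * (fourier_density (damped (?s n)) y - fourier_density \<psi> y)))"
          using Bochner_Integration.integrable_diff[OF int_dens[OF integrable_damped[of "?s n"]] int_dens[OF int_\<psi>]]
          by (intro integrable_norm) (simp add: right_diff_distrib)
      qed (use int\<phi> \<delta>(2) in \<open>auto simp: abs_mult mult.commute[of "\<delta> n"] intro!: mult_left_mono\<close>)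
      also have "\<dots> \<le> e" using n(2) by simp
      finally show "norm ((LINT y|lborel. \<phi> y * fourier_density (damped (?s n)) y) - (LINT w|lborel. \<phi> w * fourier_density \<psi> w)) \<le> e" .
    qed
  qed
qed

end

section \<open>Decay of an oscillatory integral\<close>

text \<open>Integration by parts against \<open>1 / \<phi>'\<close>: the boundary terms contribute
  \<open>2 / m\<close>. Since \<open>\<phi>'\<close> is monotone, the remaining integral is bounded
  by the total variation of \<open>1 / \<phi>'\<close>, again at most \<open>2 / m\<close>.\<close>

lemma van_der_corput_first:
  fixes \<phi> \<phi>' \<phi>'' :: "real \<Rightarrow> real"
  assumes ab: "a \<le> b" and m: "m > 0"
    and d1: "\<And>x. x \<in> {a..b} \<Longrightarrow> (\<phi> has_real_derivative \<phi>' x) (at x within {a..b})"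
    and d2: "\<And>x. x \<in> {a..b} \<Longrightarrow> (\<phi>' has_real_derivative \<phi>'' x) (at x within {a..b})"
    and cont: "continuous_on {a..b} \<phi>''"
    and mono: "\<And>x. x \<in> {a..b} \<Longrightarrow> \<phi>'' x \<le> 0"
    and lower: "\<And>x. x \<in> {a..b} \<Longrightarrow> m \<le> \<bar>\<phi>' x\<bar>"
  shows "norm (integral {a..b} (\<lambda>x. cis (\<phi> x))) \<le> 4 / m"
proof -
  have nz: "\<phi>' x \<noteq> 0" if "x \<in> {a..b}" for x using lower[OF that] m by auto
  have c\<phi>: "continuous_on {a..b} \<phi>" "continuous_on {a..b} \<phi>'"
    by (rule DERIV_continuous_on[OF d1], assumption) (rule DERIV_continuous_on[OF d2])
  \<comment> \<open>\<open>h\<close> is the derivative of \<open>- 1 / \<phi>'\<close>, and the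
    derivative of \<open>F\<close> is \<open>cis (\<phi> x)\<close> plus an error of modulus
    \<open>\<bar>h x\<bar>\<close>.\<close>
  define h where "h x = \<phi>'' x / (\<phi>' x)\<^sup>2" for x
  define F where "F x = cis (\<phi> x) / (\<i> * of_real (\<phi>' x))" for x
  have ch: "continuous_on {a..b} h"
    unfolding h_def using nz by (intro continuous_intros c\<phi> cont) auto
  have ccis: "continuous_on {a..b} (\<lambda>x. cis (\<phi> x))" by (intro continuous_intros c\<phi>)
  have cgh: "continuous_on {a..b} (\<lambda>x. cis (\<phi> x) * (\<i> * of_real (h x)))"
    by (intro continuous_intros ccis ch)
  have FTC1: "((\<lambda>x. cis (\<phi> x) + cis (\<phi> x) * (\<i> * of_real (h x))) has_integral (F b - F a)) {a..b}"
  proof (rule fundamental_theorem_of_calculus[OF ab])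
    fix x assume x: "x \<in> {a..b}"
    have "((\<lambda>x. exp (\<i> * of_real (\<phi> x)) / (\<i> * of_real (\<phi>' x))) has_vector_derivative 
        (exp (\<i> * of_real (\<phi> x)) * (\<i> * of_real (\<phi>' x)) * (\<i> * of_real (\<phi>' x)) - exp (\<i> * of_real (\<phi> x)) * (\<i> * of_real (\<phi>'' x)))
          / (\<i> * of_real (\<phi>' x))\<^sup>2) (at x within {a..b})"
    proof -
      note d1' = d1[OF x, THEN has_vector_derivative_of_real]
      note d2' = d2[OF x, THEN has_vector_derivative_of_real]
      have e: "((\<lambda>x. exp (\<i> * of_real (\<phi> x))) has_vector_derivative (\<i> * of_real (\<phi>' x)) * exp (\<i> * of_real (\<phi> x))) (at x within {a..b})"
        using field_vector_diff_chain_within[OF has_vector_derivative_mult_right[OF d1'] has_field_derivative_at_within[OF DERIV_exp]]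
        by (simp add: o_def)
      have q: "((\<lambda>x. inverse (\<i> * of_real (\<phi>' x))) has_vector_derivative (\<i> * of_real (\<phi>'' x)) * (- inverse ((\<i> * of_real (\<phi>' x))\<^sup>2))) (at x within {a..b})"
        using field_vector_diff_chain_within[OF has_vector_derivative_mult_right[OF d2', of \<i>] has_field_derivative_at_within[OF DERIV_inverse]] nz[OF x]
        by (simp add: o_def numeral_2_eq_2)
      show ?thesis
      proof -
        have "E * (Q * - inverse (P\<^sup>2)) + P * E * inverse P = (E * P * P - E * Q) / P\<^sup>2" if "P \<noteq> 0" for E P Q :: complex
          using that by (simp add: field_simps power2_eq_square)
        from this[of "\<i> * of_real (\<phi>' x)"] show ?thesis
          using has_vector_derivative_mult[OF e q] nz[OF x] by (simp only: divide_inverse) simp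
      qed
    qed
    also have "(exp (\<i> * of_real (\<phi> x)) * (\<i> * of_real (\<phi>' x)) * (\<i> * of_real (\<phi>' x)) - exp (\<i> * of_real (\<phi> x)) * (\<i> * of_real (\<phi>'' x)))
          / (\<i> * of_real (\<phi>' x))\<^sup>2 = cis (\<phi> x) + cis (\<phi> x) * (\<i> * of_real (h x))"
      using nz[OF x] by (simp add: h_def cis_conv_exp power2_eq_square field_simps)
    finally show "(F has_vector_derivative cis (\<phi> x) + cis (\<phi> x) * (\<i> * of_real (h x))) (at x within {a..b})"
      by (simp add: F_def[abs_def] cis_conv_exp)
  qed
  have FTC2: "(h has_integral (- (1 / \<phi>' b) - (- (1 / \<phi>' a)))) {a..b}"
  proof (rule fundamental_theorem_of_calculus[OF ab])
    fix x assume x: "x \<in> {a..b}"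
    have "((\<lambda>x. - (1 / \<phi>' x)) has_real_derivative h x) (at x within {a..b})"
      using nz[OF x] by (auto intro!: derivative_eq_intros d2[OF x] simp: h_def power2_eq_square)
    then show "((\<lambda>x. - (1 / \<phi>' x)) has_vector_derivative h x) (at x within {a..b})"
      by (simp add: has_real_derivative_iff_has_vector_derivative)
  qed
  have inv: "\<bar>1 / \<phi>' x\<bar> \<le> 1 / m" if "x \<in> {a..b}" for x
    using lower[OF that] m by (auto simp: field_simps)
  have nF: "norm (F x) \<le> 1 / m" if "x \<in> {a..b}" for x
    using inv[OF that] by (simp add: F_def norm_divide norm_mult)
  \<comment> \<open>The hypothesis \<open>\<phi>'' \<le> 0\<close> fixes the sign of
    \<open>h\<close>, so integrating the modulus loses nothing and leaves a difference of two
    boundary values.\<close>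
  have "norm (integral {a..b} (\<lambda>x. cis (\<phi> x) * (\<i> * of_real (h x)))) \<le> integral {a..b} (\<lambda>x. - h x)"
  proof (rule integral_norm_bound_integral)
    show "norm (cis (\<phi> x) * (\<i> * of_real (h x))) \<le> - h x" if "x \<in> {a..b}" for x
      using mono[OF that] by (auto simp: norm_mult norm_divide norm_power h_def)
    show "(\<lambda>x. cis (\<phi> x) * (\<i> * of_real (h x))) integrable_on {a..b}"
      using cgh by (rule integrable_continuous_real)
    show "(\<lambda>x. - h x) integrable_on {a..b}"
      by (intro integrable_continuous_real continuous_intros ch)
  qed
  also have "\<dots> = 1 / \<phi>' b - 1 / \<phi>' a"
    using FTC2 by (simp add: integral_unique)
  also have "\<dots> \<le> 2 / m" using abs_le_D2[OF inv[of a]] abs_le_D1[OF inv[of b]] ab by simp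
  finally have *: "norm (integral {a..b} (\<lambda>x. cis (\<phi> x) * (\<i> * of_real (h x)))) \<le> 2 / m" .
  have "integral {a..b} (\<lambda>x. cis (\<phi> x)) + integral {a..b} (\<lambda>x. cis (\<phi> x) * (\<i> * of_real (h x))) = F b - F a"
    using integral_unique[OF FTC1]
    by (subst (asm) Henstock_Kurzweil_Integration.integral_add) (auto intro!: integrable_continuous_real ccis cgh)
  then have "norm (integral {a..b} (\<lambda>x. cis (\<phi> x))) = norm (F b - F a - integral {a..b} (\<lambda>x. cis (\<phi> x) * (\<i> * of_real (h x))))"
    by (intro arg_cong[of _ _ norm]) (simp only: eq_diff_eq)
  also have "\<dots> \<le> norm (F b) + norm (F a) + norm (integral {a..b} (\<lambda>x. cis (\<phi> x) * (\<i> * of_real (h x))))"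
    by (rule order_trans[OF norm_triangle_ineq4 add_right_mono[OF norm_triangle_ineq4]])
  also have "\<dots> \<le> 1 / m + 1 / m + 2 / m"
    using * nF[of a] nF[of b] ab by (intro add_mono) auto
  finally show ?thesis by simp
qed

text \<open>On \<open>[0, 1]\<close> the derivative is at least \<open>cos (pi / 3)\<close>, that is
  1/2, because \<open>pi > 3\<close>.\<close>

lemma sin_ge_half:
  assumes "0 \<le> x" "x \<le> 1"
  shows "x / 2 \<le> sin (x::real)"
proof (cases "x = 0")
  case False
  then have "x > 0" using assms by simp
  then obtain y where y: "0 < y" "y < x" "sin x - sin 0 = (x - 0) * cos y"
    using MVT2[of 0 x sin cos] by auto
  have "cos (pi / 3) \<le> cos y" using y assms pi_gt3 by (intro cos_monotone_0_pi_le) auto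
  then have "x * (1 / 2) \<le> x * cos y" using assms by (intro mult_left_mono) (auto simp: cos_60)
  then show ?thesis using y by simp
qed auto

lemma norm_integral_cis_le:
  assumes "a \<le> b" "continuous_on {a..b} g"
  shows "norm (integral {a..b} (\<lambda>x. cis (g x))) \<le> b - a"
  using integral_bound[of a b "\<lambda>x. cis (g x)" 1] assms by (auto intro!: continuous_intros)

text \<open>On a quarter period the phase has a second derivative of constant sign and one
  stationary point, at an endpoint. A neighbourhood of that point is estimated by its length, the
  rest by \<open>van_der_corput_first\<close>.\<close>

lemma cis_cos_quarter_bound:
  assumes s: "s \<ge> 1"
  shows "norm (integral {0..pi/2} (\<lambda>x. cis (s * cos x))) \<le> 9 / sqrt s" 
    and "norm (integral {0..pi/2} (\<lambda>x. cis (s * sin x))) \<le> 9 / sqrt s"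
proof -
  \<comment> \<open>The length that balances both parts: the neighbourhood costs \<open>d\<close>,
    and outside it the phase derivative is at least \<open>s * sin d \<ge> s * d / 2\<close>, which
    costs \<open>8 / (s * d) = 8 * d\<close>.\<close>
  define d where "d = 1 / sqrt s"
  have d: "0 < d" "d \<le> 1" and s_eq: "s = 1 / d\<^sup>2" using s by (auto simp: d_def power_divide)
  have dpi: "d < pi / 2" using d pi_gt3 by linarith
  have sd: "d / 2 \<le> sin d" using sin_ge_half[of d] d by auto
  have lam: "4 / (s * sin d) \<le> 8 / (s * d)" "s * sin d > 0"
    using sd d s by (auto simp: field_simps)
  have eq: "8 / (s * d) = 8 * d" using d by (simp add: s_eq power2_eq_square)
  have "integral {0..pi/2} (\<lambda>x. cis (s * cos x)) = integral {0..d} (\<lambda>x. cis (s * cos x)) + integral {d..pi/2} (\<lambda>x. cis (s * cos x))"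
    using d dpi by (intro Henstock_Kurzweil_Integration.integral_combine[symmetric] integrable_continuous_real continuous_intros) auto
  also have "norm \<dots> \<le> d + 4 / (s * sin d)"
  proof (rule norm_triangle_mono)
    show "norm (integral {0..d} (\<lambda>x. cis (s * cos x))) \<le> d"
      using norm_integral_cis_le[of 0 d "\<lambda>x. s * cos x"] d by (force intro!: continuous_intros)
    show "norm (integral {d..pi/2} (\<lambda>x. cis (s * cos x))) \<le> 4 / (s * sin d)"
    proof (rule van_der_corput_first[where \<phi>' = "\<lambda>x. - (s * sin x)" and \<phi>'' = "\<lambda>x. - (s * cos x)"])
      fix x assume x: "x \<in> {d..pi/2}"
      show "- (s * cos x) \<le> 0" using x d s by (auto intro!: mult_nonneg_nonneg cos_ge_zero)
      have "sin d \<le> sin x" using x d by (intro sin_monotone_2pi_le) auto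
      then have "s * sin d \<le> s * sin x" using s by simp
      then show "s * sin d \<le> \<bar>- (s * sin x)\<bar>" by simp
    qed (use dpi lam in \<open>auto intro!: derivative_eq_intros continuous_intros\<close>)
  qed
  also have "\<dots> \<le> d + 8 * d" using lam eq by simp
  finally show "norm (integral {0..pi/2} (\<lambda>x. cis (s * cos x))) \<le> 9 / sqrt s" by (simp add: d_def)
  have "integral {0..pi/2} (\<lambda>x. cis (s * sin x)) = integral {0..pi/2-d} (\<lambda>x. cis (s * sin x)) + integral {pi/2-d..pi/2} (\<lambda>x. cis (s * sin x))"
    using d dpi by (intro Henstock_Kurzweil_Integration.integral_combine[symmetric] integrable_continuous_real continuous_intros) auto
  also have "norm \<dots> \<le> 4 / (s * sin d) + d"
  proof (rule norm_triangle_mono)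
    show "norm (integral {pi/2-d..pi/2} (\<lambda>x. cis (s * sin x))) \<le> d"
      using norm_integral_cis_le[of "pi/2-d" "pi/2" "\<lambda>x. s * sin x"] d by (force intro!: continuous_intros)
    show "norm (integral {0..pi/2-d} (\<lambda>x. cis (s * sin x))) \<le> 4 / (s * sin d)"
    proof (rule van_der_corput_first[where \<phi>' = "\<lambda>x. s * cos x" and \<phi>'' = "\<lambda>x. - (s * sin x)"])
      fix x assume x: "x \<in> {0..pi/2-d}"
      show "- (s * sin x) \<le> 0" using x d s by (auto intro!: mult_nonneg_nonneg sin_ge_zero)
      have "cos (pi/2 - d) \<le> cos x" using x d dpi by (intro cos_monotone_0_pi_le) auto
      then have "s * sin d \<le> s * cos x" using s by (simp add: cos_diff)
      then show "s * sin d \<le> \<bar>s * cos x\<bar>" by simp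
    qed (use dpi lam in \<open>auto intro!: derivative_eq_intros continuous_intros\<close>)
  qed
  also have "\<dots> \<le> 8 * d + d" using lam eq by simp
  finally show "norm (integral {0..pi/2} (\<lambda>x. cis (s * sin x))) \<le> 9 / sqrt s" by (simp add: d_def)
qed

lemma norm_integral_cis_uminus:
  "norm (integral A (\<lambda>x. cis (- g x))) = norm (integral A (\<lambda>x. cis (g x)))"
proof -
  have "integral A (\<lambda>x. cis (- g x)) = cnj (integral A (\<lambda>x. cis (g x)))"
    by (simp add: integral_cnj cis_cnj)
  then show ?thesis by simp
qed

definition circle_mean :: "(real \<Rightarrow> complex) \<Rightarrow> complex" where
  "circle_mean g = integral {0..2*pi} g / (2 * pi)"

lemma circle_mean_cis_cos_le_1: "norm (circle_mean (\<lambda>x. cis (s * cos x))) \<le> 1"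
proof -
  have "norm (integral {0..2*pi} (\<lambda>x. cis (s * cos x))) \<le> 2 * pi - 0"
    by (intro norm_integral_cis_le continuous_intros) auto
  then show ?thesis by (simp add: circle_mean_def norm_divide)
qed

text \<open>The mean is the Bessel function of order 0 at \<open>s\<close>. The four quarters are
  translates of the two integrals bounded above, up to complex conjugation. The form
  \<open>1 + s\<close> keeps the bound valid down to \<open>s = 0\<close>.\<close>

lemma circle_mean_cis_cos_decay:
  assumes s: "s \<ge> 0"
  shows "norm (circle_mean (\<lambda>x. cis (s * cos x))) \<le> 9 / sqrt (1 + s)"
proof (cases "s \<ge> 1")
  \<comment> \<open>For \<open>s < 1\<close> the bound exceeds 1 and is trivial.\<close>
  case False
  then have "sqrt (1 + s) \<le> sqrt 4" using s by (intro real_sqrt_le_mono) auto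
  then have "1 \<le> 9 / sqrt (1 + s)" using s by (auto simp: field_simps)
  then show ?thesis using circle_mean_cis_cos_le_1[of s] by linarith
next
  case True
  let ?f = "\<lambda>x. cis (s * cos x)"
  have int: "?f integrable_on {a..b}" for a b by (intro integrable_continuous_real continuous_intros)
  have shift: "integral {c..c + pi/2} ?f = integral {0..pi/2} (\<lambda>x. cis (s * cos (x + c)))" for c
  proof -
    have "continuous_on {0 + c..pi/2 + c} ?f" by (intro continuous_intros)
    from integral_shift[OF this] show ?thesis by (simp add: o_def add.commute)
  qed
  have s3: "cos (x + 3 * pi / 2) = sin x" for x
    using cos_periodic[of "x - pi / 2"] by (simp add: cos_diff algebra_simps)
  note b = cis_cos_quarter_bound[OF True]
  have "norm (integral {0..pi/2} ?f) \<le> 9 / sqrt s" by (rule b)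
  moreover have "norm (integral {pi/2..pi} ?f) \<le> 9 / sqrt s"
    using shift[of "pi/2"] b(2) norm_integral_cis_uminus[of "{0..pi/2}" "\<lambda>x. s * sin x"]
    by (simp add: cos_add)
  moreover have "norm (integral {pi..3*pi/2} ?f) \<le> 9 / sqrt s"
    using shift[of "pi"] b(1) norm_integral_cis_uminus[of "{0..pi/2}" "\<lambda>x. s * cos x"]
    by (simp add: cos_add)
  moreover have "norm (integral {3*pi/2..2*pi} ?f) \<le> 9 / sqrt s"
    using shift[of "3*pi/2"] b(2) by (simp add: s3)
  moreover have "integral {0..2*pi} ?f = integral {0..pi/2} ?f + integral {pi/2..pi} ?f + integral {pi..3*pi/2} ?f + integral {3*pi/2..2*pi} ?f"
  proof -
    have "integral {0..pi/2} ?f + integral {pi/2..pi} ?f = integral {0..pi} ?f"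
      by (intro Henstock_Kurzweil_Integration.integral_combine int) auto
    moreover have "integral {0..pi} ?f + integral {pi..3*pi/2} ?f = integral {0..3*pi/2} ?f"
      by (intro Henstock_Kurzweil_Integration.integral_combine int) auto
    moreover have "integral {0..3*pi/2} ?f + integral {3*pi/2..2*pi} ?f = integral {0..2*pi} ?f"
      by (intro Henstock_Kurzweil_Integration.integral_combine int) auto
    ultimately show ?thesis by simp
  qed
  ultimately have "norm (integral {0..2*pi} ?f) \<le> 9 / sqrt s + 9 / sqrt s + 9 / sqrt s + 9 / sqrt s"
    by (metis norm_triangle_mono)
  also have "\<dots> = 36 / sqrt s" by simp
  finally have "norm (circle_mean ?f) \<le> 36 / sqrt s / (2 * pi)"
    using divide_right_mono[of _ "36 / sqrt s" "2 * pi"] by (simp add: circle_mean_def norm_divide)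
  also have "\<dots> \<le> 36 / sqrt s / 6"
    using pi_gt3 True by (intro divide_left_mono) auto
  also have "\<dots> = 6 / sqrt s" by simp
  also have "\<dots> \<le> 9 / sqrt (1 + s)"
  proof -
    \<comment> \<open>After squaring this is \<open>36 * (1 + s) \<le> 81 * s\<close>, true for
      \<open>s \<ge> 1\<close>; the 6 is 36, from four quarters, divided by
      \<open>2 * pi > 6\<close>.\<close>
    have "6 * sqrt (1 + s) \<le> 9 * sqrt s"
    proof (rule power2_le_imp_le)
      show "(6 * sqrt (1 + s))\<^sup>2 \<le> (9 * sqrt s)\<^sup>2" using True by (simp add: power_mult_distrib)
    qed (use True in auto)
    then show ?thesis using True by (simp add: divide_simps mult.commute)
  qed
  finally show ?thesis .
qed

lemma integrable_powr_abs:
  assumes p: "p > 1"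
  shows "integrable lborel (\<lambda>x::real. (1 + \<bar>x\<bar>) powr (-p))"
proof -
  have half: "integrable lborel (\<lambda>x::real. (1 + \<bar>x\<bar>) powr (-p) * indicator {0..} x)"
  proof (rule integrableI_nonneg)
    have "(\<integral>\<^sup>+x. ennreal ((1 + \<bar>x\<bar>) powr (-p) * indicator {0..} x) \<partial>lborel) = 
      (\<integral>\<^sup>+x. ennreal ((1 + \<bar>x\<bar>) powr (-p)) * indicator {0..} x \<partial>lborel)"
      by (intro nn_integral_cong) (auto simp: indicator_def)
    also have "\<dots> = ennreal (0 - (1 + 0) powr (1 - p) / (1 - p))"
    proof (rule nn_integral_FTC_atLeast)
      show "((\<lambda>x. (1 + x) powr (1 - p) / (1 - p)) has_real_derivative (1 + \<bar>x\<bar>) powr (-p)) (at x)" if "0 \<le> x" for x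
        using that p by (auto intro!: derivative_eq_intros)
      have "((\<lambda>x::real. (1 + x) powr (1 - p)) \<longlongrightarrow> 0) at_top"
        using p by (intro tendsto_neg_powr filterlim_tendsto_add_at_top[OF tendsto_const filterlim_ident]) auto
      then show "((\<lambda>x. (1 + x) powr (1 - p) / (1 - p)) \<longlongrightarrow> 0) at_top" 
        by (rule tendsto_divide_zero)
    qed (auto simp: )
    finally show "(\<integral>\<^sup>+x. ennreal ((1 + \<bar>x\<bar>) powr (-p) * indicator {0..} x) \<partial>lborel) < \<infinity>" by simp
  qed (auto simp: indicator_def)
  have "integrable lborel (\<lambda>x::real. (1 + \<bar>0 + (-1) * x\<bar>) powr (-p) * indicator {0..} (0 + (-1) * x))"
    by (rule lborel_integrable_real_affine[OF half]) simp
  \<comment> \<open>Both half-lines contain 0, where the sum counts twice; domination is used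
    instead of equality.\<close>
  from Bochner_Integration.integrable_add[OF half this] show ?thesis
    by (rule Bochner_Integration.integrable_bound) (auto simp: indicator_def)
qed

text \<open>Polar coordinates are avoided: \<open>norm z\<close> bounds both coordinates, so half of
  the exponent is given to each, and \<open>p / 2 > 1\<close> is integrable on the line.\<close>

lemma integrable_powr_norm_complex:
  assumes p: "p > 2"
  shows "integrable lborel (\<lambda>z::complex. (1 + norm z) powr (-p))"
proof -
  have "integrable lborel (\<lambda>x::real. (1 + \<bar>x\<bar>) powr (- (p / 2)))"
    using p by (intro integrable_powr_abs) auto
  then have I: "has_bochner_integral lborel (\<lambda>x::real. (1 + \<bar>x\<bar>) powr (- (p / 2))) (LINT x|lborel. (1 + \<bar>x\<bar>) powr (- (p / 2)))"
    by (rule has_bochner_integral_integrable)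
  have "integrable lborel (\<lambda>z::complex. (1 + \<bar>Re z\<bar>) powr (- (p / 2)) * (1 + \<bar>Im z\<bar>) powr (- (p / 2)))"
    using has_bochner_integral_lborel_complex_prod[OF I I] by (auto simp: has_bochner_integral_iff)
  then show ?thesis
  proof (rule Bochner_Integration.integrable_bound)
    have "(1 + norm z) powr (-p) \<le> (1 + \<bar>Re z\<bar>) powr (- (p / 2)) * (1 + \<bar>Im z\<bar>) powr (- (p / 2))" for z
    proof -
      have "(1 + norm z) powr (-p) = (1 + norm z) powr (- (p / 2)) * (1 + norm z) powr (- (p / 2))"
        by (simp flip: powr_add)
      also have "\<dots> \<le> (1 + \<bar>Re z\<bar>) powr (- (p / 2)) * (1 + \<bar>Im z\<bar>) powr (- (p / 2))"
        using p abs_Re_le_cmod[of z] abs_Im_le_cmod[of z] by (intro mult_mono powr_mono2') auto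
      finally show ?thesis .
    qed
    then show "AE z in lborel. norm ((1 + norm z) powr (-p)) \<le> norm ((1 + \<bar>Re z\<bar>) powr (- (p / 2)) * (1 + \<bar>Im z\<bar>) powr (- (p / 2)))"
      by auto
  qed measurable
qed

section \<open>Mean values and independent frequencies\<close>

definition has_mean :: "(real \<Rightarrow> complex) \<Rightarrow> complex \<Rightarrow> bool" where
  "has_mean g m \<longleftrightarrow> ((\<lambda>T. integral {0..T} g /\<^sub>R T) \<longlongrightarrow> m) at_top"

lemma has_mean_cis: "has_mean (\<lambda>t. cis (l * t)) (if l = 0 then 1 else 0)"
proof (cases "l = 0")
  case True
  have "\<forall>\<^sub>F T in at_top. integral {0..T} (\<lambda>t. cis (l * t)) /\<^sub>R T = 1"
    using eventually_gt_at_top[of 0] by eventually_elim (simp add: True scaleR_conv_of_real)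
  then show ?thesis unfolding has_mean_def using True by (simp add: tendsto_eventually)
next
  case False
  have "((\<lambda>T. 2 / \<bar>l\<bar> * inverse T) \<longlongrightarrow> 2 / \<bar>l\<bar> * 0) at_top"
    by (intro tendsto_intros tendsto_inverse_0_at_top filterlim_ident)
  then have lim: "((\<lambda>T. 2 / \<bar>l\<bar> * inverse T) \<longlongrightarrow> 0) at_top" by simp
  have "\<forall>\<^sub>F T in at_top. norm (integral {0..T} (\<lambda>t. cis (l * t)) /\<^sub>R T) \<le> 2 / \<bar>l\<bar> * inverse T"
    using eventually_gt_at_top[of 0]
  proof eventually_elim
    case (elim T)
    have "((\<lambda>t. cis (l * t)) has_integral (cis (l * T) / (\<i> * l) - cis (l * 0) / (\<i> * l))) {0..T}"
    proof (rule fundamental_theorem_of_calculus)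
      fix x
      have "((\<lambda>t. exp (\<i> * of_real l * of_real t) / (\<i> * l)) has_vector_derivative exp (\<i> * of_real l * of_real x)) (at x within {0..T})"
        using False by (auto intro!: derivative_eq_intros has_vector_derivative_real_field)
      then show "((\<lambda>t. cis (l * t) / (\<i> * l)) has_vector_derivative cis (l * x)) (at x within {0..T})"
        by (simp add: cis_conv_exp mult.assoc)
    qed (use elim in auto)
    then have "norm (integral {0..T} (\<lambda>t. cis (l * t))) = norm (cis (l * T) - 1) / \<bar>l\<bar>"
      by (simp add: integral_unique norm_divide norm_mult flip: diff_divide_distrib)
    also have "norm (cis (l * T) - 1) \<le> 2"
      using norm_triangle_ineq4[of "cis (l * T)" 1] by simp
    finally have "norm (integral {0..T} (\<lambda>t. cis (l * t))) \<le> 2 / \<bar>l\<bar>" using False by (simp add: divide_right_mono)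
    then show ?case using elim by (simp add: divide_right_mono divide_inverse mult.commute[of "inverse T"] mult_right_mono)
  qed
  from Lim_null_comparison[OF this lim]
  have "((\<lambda>T. integral {0..T} (\<lambda>t. cis (l * t)) /\<^sub>R T) \<longlongrightarrow> 0) at_top" .
  then show ?thesis unfolding has_mean_def using False by simp
qed

lemma has_mean_cmult: "has_mean g m \<Longrightarrow> has_mean (\<lambda>t. c * g t) (c * m)"
  unfolding has_mean_def by (drule tendsto_mult_left[where c = c]) (simp add: mult_scaleR_right)

lemma has_mean_sum:
  assumes "\<And>i. i \<in> I \<Longrightarrow> has_mean (g i) (m i)" "\<And>i. i \<in> I \<Longrightarrow> continuous_on UNIV (g i)"
  shows "has_mean (\<lambda>t. \<Sum>i\<in>I. g i t) (\<Sum>i\<in>I. m i)"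
proof (cases "finite I")
  case True
  have "integral {0..T} (\<lambda>t. \<Sum>i\<in>I. g i t) = (\<Sum>i\<in>I. integral {0..T} (g i))" for T
    by (intro integral_sum True integrable_continuous_real) (rule continuous_on_subset[OF assms(2) subset_UNIV])
  moreover have "((\<lambda>T. \<Sum>i\<in>I. integral {0..T} (g i) /\<^sub>R T) \<longlongrightarrow> (\<Sum>i\<in>I. m i)) at_top"
    using assms(1) by (intro tendsto_sum) (auto simp: has_mean_def)
  ultimately show ?thesis by (simp add: has_mean_def scaleR_sum_right)
qed (simp add: has_mean_def)

lemma norm_mean_diff_le:
  fixes g h :: "real \<Rightarrow> complex"
  assumes "continuous_on UNIV g" "continuous_on UNIV h" "\<And>t. norm (g t - h t) \<le> e" "T > 0"
  shows "norm (integral {0..T} g /\<^sub>R T - integral {0..T} h /\<^sub>R T) \<le> e"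
proof -
  have i: "g integrable_on {0..T}" "h integrable_on {0..T}"
    using assms by (auto intro!: integrable_continuous_real intro: continuous_on_subset[OF _ subset_UNIV])
  have "norm (integral {0..T} (\<lambda>t. g t - h t)) \<le> e * (T - 0)"
    using assms by (intro integral_bound continuous_intros) (auto intro: continuous_on_subset[OF _ subset_UNIV])
  then have "norm (integral {0..T} (\<lambda>t. g t - h t)) / T \<le> e"
    using assms(4) by (simp add: field_simps)
  then show ?thesis using assms(4) i
    by (simp add: Henstock_Kurzweil_Integration.integral_diff norm_divide divide_inverse mult.commute flip: scaleR_diff_right)
qed

lemma has_mean_uniform_limit:
  assumes u: "uniform_limit UNIV G g sequentially" and c: "\<And>n. continuous_on UNIV (G n)"
    and m: "\<And>n. has_mean (G n) (M n)" and lim: "M \<longlonglongrightarrow> m"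
  shows "has_mean g m"
  unfolding has_mean_def
proof (rule tendsto_approx)
  fix e :: real assume e: "e > 0"
  have cg: "continuous_on UNIV g" using uniform_limit_theorem[OF _ u] c by simp
  have "\<forall>\<^sub>F n in sequentially. \<forall>t\<in>UNIV. dist (G n t) (g t) < e" by (rule uniform_limitD[OF u e])
  moreover have "\<forall>\<^sub>F n in sequentially. dist (M n) m < e" by (rule tendstoD[OF lim e])
  ultimately have "\<forall>\<^sub>F n in sequentially. (\<forall>t\<in>UNIV. dist (G n t) (g t) < e) \<and> dist (M n) m < e" by (rule eventually_conj)
  then obtain n where n: "\<And>t. dist (G n t) (g t) < e" "dist (M n) m < e" by (auto simp: eventually_sequentially)
  have "\<forall>\<^sub>F T in at_top. norm (integral {0..T} g /\<^sub>R T - integral {0..T} (G n) /\<^sub>R T) \<le> e"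
    using eventually_gt_at_top[of 0]
    by eventually_elim (rule norm_mean_diff_le, use n c cg in \<open>auto simp: dist_norm norm_minus_commute intro: less_imp_le\<close>)
  then show "\<exists>h k. (h \<longlongrightarrow> k) at_top \<and> (\<forall>\<^sub>F T in at_top. norm (integral {0..T} g /\<^sub>R T - h T) \<le> e) \<and> norm (k - m) \<le> e"
    using m[of n] n(2) unfolding has_mean_def dist_norm by (intro exI[of _ "\<lambda>T. integral {0..T} (G n) /\<^sub>R T"] exI[of _ "M n"]) auto
qed

lemma norm_has_mean_diff_le:
  assumes "has_mean g m" "has_mean h k" "continuous_on UNIV g" "continuous_on UNIV h" "\<And>t. norm (g t - h t) \<le> e"
  shows "norm (m - k) \<le> e"
proof (rule tendsto_upperbound)
  show "((\<lambda>T. norm (integral {0..T} g /\<^sub>R T - integral {0..T} h /\<^sub>R T)) \<longlongrightarrow> norm (m - k)) at_top"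
    using assms unfolding has_mean_def by (intro tendsto_intros) auto
  show "\<forall>\<^sub>F T in at_top. norm (integral {0..T} g /\<^sub>R T - integral {0..T} h /\<^sub>R T) \<le> e"
    using eventually_gt_at_top[of 0] by eventually_elim (rule norm_mean_diff_le, use assms in auto)
qed auto

text \<open>Taking the mean is a contraction for the sup norm, so uniform convergence forces the
  means to be Cauchy. This is how the infinite product of Bessel factors gets a limit without being
  estimated directly.\<close>

lemma has_mean_uniform_limit_exists:
  assumes u: "uniform_limit UNIV G g sequentially" and c: "\<And>n. continuous_on UNIV (G n)"
    and m: "\<And>n. has_mean (G n) (M n)"
  shows "\<exists>m. M \<longlonglongrightarrow> m \<and> has_mean g m"
proof -
  have "Cauchy M"
  proof (rule metric_CauchyI)
    fix e :: real assume "e > 0"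
    then have "\<forall>\<^sub>F n in sequentially. \<forall>t\<in>UNIV. dist (G n t) (g t) < e / 3"
      by (intro uniform_limitD[OF u]) auto
    then obtain n0 where n0: "\<And>n t. n \<ge> n0 \<Longrightarrow> dist (G n t) (g t) < e / 3"
      by (auto simp: eventually_sequentially)
    have "dist (M n) (M k) < e" if "n \<ge> n0" "k \<ge> n0" for n k
    proof -
      have "norm (M n - M k) \<le> 2 * e / 3"
      proof (rule norm_has_mean_diff_le[OF m m c c])
        fix t
        have "dist (G n t) (G k t) \<le> dist (G n t) (g t) + dist (G k t) (g t)" by (rule dist_triangle2)
        then show "norm (G n t - G k t) \<le> 2 * e / 3"
          using n0[OF that(1), of t] n0[OF that(2), of t] by (simp add: dist_norm)
      qed
      then show ?thesis using \<open>e > 0\<close> by (simp add: dist_norm)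
    qed
    then show "\<exists>n0. \<forall>n\<ge>n0. \<forall>k\<ge>n0. dist (M n) (M k) < e" by blast
  qed
  then obtain m where "M \<longlonglongrightarrow> m" by (auto simp: Cauchy_convergent_iff convergent_def)
  with has_mean_uniform_limit[OF u c assms(3)] show ?thesis by blast
qed

text \<open>A Laurent polynomial in \<open>cis x\<close>, multiplied by \<open>cis x ^ N\<close> to
  become an ordinary polynomial, so that powers and products come from polynomial algebra. The
  second argument is its constant term, the coefficient at the shifted index
  \<open>N\<close>.\<close>

definition trig_poly :: "(real \<Rightarrow> complex) \<Rightarrow> complex \<Rightarrow> bool" where
  "trig_poly g m \<longleftrightarrow> (\<exists>N p. (\<forall>x. g x = cis (- (real N * x)) * poly p (cis x)) \<and> m = coeff p N)"

lemma trig_polyE: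
  assumes "trig_poly g m"
  obtains N p where "\<And>x. g x = (\<Sum>k\<le>degree p. coeff p k * cis (of_int (int k - int N) * x))" "m = coeff p N"
proof -
  obtain N p where *: "\<And>x. g x = cis (- (real N * x)) * poly p (cis x)" "m = coeff p N"
    using assms by (auto simp: trig_poly_def)
  have "g x = (\<Sum>k\<le>degree p. coeff p k * cis (of_int (int k - int N) * x))" for x
  proof -
    have "cis (- (real N * x)) * cis x ^ k = cis (of_int (int k - int N) * x)" for k
      by (simp add: Complex.DeMoivre cis_mult left_diff_distrib)
    then show ?thesis unfolding *(1) poly_altdef sum_distrib_left
      by (intro sum.cong) (auto simp: mult.left_commute)
  qed
  with * show ?thesis by (intro that)
qed

lemma trig_poly_continuous: "trig_poly g m \<Longrightarrow> continuous_on A g"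
  by (erule trig_polyE) (simp add: continuous_intros)

lemma trig_poly_circle_mean:
  assumes "trig_poly g m"
  shows "circle_mean g = m"
proof -
  obtain N p where g: "\<And>x. g x = (\<Sum>k\<le>degree p. coeff p k * cis (of_int (int k - int N) * x))" "m = coeff p N"
    using assms by (rule trig_polyE) blast
  have *: "integral {0..2*pi} (\<lambda>x. cis (of_int j * x)) = (if j = 0 then 2 * pi else 0)" for j :: int
  proof (cases "j = 0")
    case False
    have "((\<lambda>t. cis (of_int j * t)) has_integral (cis (of_int j * (2*pi)) / (\<i> * of_int j) - cis (of_int j * 0) / (\<i> * of_int j))) {0..2*pi}"
    proof (rule fundamental_theorem_of_calculus)
      fix x
      have "((\<lambda>t. exp (\<i> * of_int j * of_real t) / (\<i> * of_int j)) has_vector_derivative exp (\<i> * of_int j * of_real x)) (at x within {0..2*pi})"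
        using False by (auto intro!: derivative_eq_intros has_vector_derivative_real_field)
      then show "((\<lambda>t. cis (of_int j * t) / (\<i> * of_int j)) has_vector_derivative cis (of_int j * x)) (at x within {0..2*pi})"
        by (simp add: cis_conv_exp mult.assoc)
    qed auto
    moreover have "cis (of_int j * (2*pi)) = 1"
      using cis_multiple_2pi[of "of_int j"] by (simp add: mult_ac)
    ultimately show ?thesis using False by (simp add: integral_unique)
  qed (auto simp: scaleR_conv_of_real)
  have "integral {0..2*pi} g = (\<Sum>k\<le>degree p. coeff p k * integral {0..2*pi} (\<lambda>x. cis (of_int (int k - int N) * x)))"
    unfolding g(1)[abs_def]
    by (subst integral_sum) (auto intro!: integrable_continuous_real continuous_intros)
  also have "\<dots> = (\<Sum>k\<le>degree p. if k = N then coeff p N * (2 * pi) else 0)"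
    unfolding * by (intro sum.cong) auto
  also have "\<dots> = coeff p N * (2 * pi)"
    by (auto simp: sum.delta coeff_eq_0)
  finally show ?thesis by (simp add: circle_mean_def g(2))
qed

lemma prod_cis: "finite F \<Longrightarrow> (\<Prod>i\<in>F. cis (x i)) = cis (\<Sum>i\<in>F. x i)"
  by (induction F rule: finite_induct) (auto simp: cis_mult)

text \<open>Integer coefficients are what expanding products of trigonometric polynomials produces;
  only the values of \<open>n\<close> on \<open>F\<close> matter.\<close>

definition rat_indep :: "'i set \<Rightarrow> ('i \<Rightarrow> real) \<Rightarrow> bool" where
  "rat_indep F \<omega> \<longleftrightarrow> (\<forall>n :: 'i \<Rightarrow> int. (\<Sum>i\<in>F. of_int (n i) * \<omega> i) = 0 \<longrightarrow> (\<forall>i\<in>F. n i = 0))"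

text \<open>Expanding the product gives exponentials with frequencies
  \<open>\<Sum>i\<in>F. n i * \<omega> i\<close>. A nonzero frequency has mean 0, and by
  independence the frequency vanishes only when every \<open>n i\<close> does, which leaves the
  product of the constant terms. The phases \<open>\<theta>\<close> multiply the other terms
  only.\<close>

lemma has_mean_prod_trig_poly:
  fixes \<omega> \<theta> :: "'i \<Rightarrow> real"
  assumes F: "finite F" and ind: "rat_indep F \<omega>"
    and tp: "\<And>i. i \<in> F \<Longrightarrow> trig_poly (g i) (m i)"
  shows "has_mean (\<lambda>t. \<Prod>i\<in>F. g i (\<omega> i * t - \<theta> i)) (\<Prod>i\<in>F. m i)"
proof -
  have "\<forall>i\<in>F. \<exists>N p. (\<forall>x. g i x = (\<Sum>k\<le>degree p. coeff p k * cis (of_int (int k - int N) * x))) \<and> m i = coeff p N"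
  proof
    fix i assume "i \<in> F"
    from tp[OF this] show "\<exists>N p. (\<forall>x. g i x = (\<Sum>k\<le>degree p. coeff p k * cis (of_int (int k - int N) * x))) \<and> m i = coeff p N"
      by (rule trig_polyE) blast
  qed
  from bchoice[OF this] obtain N where "\<forall>i\<in>F. \<exists>p. (\<forall>x. g i x = (\<Sum>k\<le>degree p. coeff p k * cis (of_int (int k - int (N i)) * x))) \<and> m i = coeff p (N i)"
    by blast
  from bchoice[OF this] obtain p where Np: "\<And>i x. i \<in> F \<Longrightarrow> g i x = (\<Sum>k\<le>degree (p i). coeff (p i) k * cis (of_int (int k - int (N i)) * x))"
    "\<And>i. i \<in> F \<Longrightarrow> m i = coeff (p i) (N i)" by blast
  \<comment> \<open>A tuple \<open>\<kappa>\<close> picks one monomial from each factor;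
    \<open>n \<kappa>\<close> are its true exponents after undoing the shifts,
    \<open>c \<kappa>\<close> its coefficient with phases, \<open>l \<kappa>\<close> its
    frequency.\<close>
  let ?K = "PiE F (\<lambda>i. {..degree (p i)})"
  define n where "n \<kappa> i = int (\<kappa> i) - int (N i)" for \<kappa> :: "'i \<Rightarrow> nat" and i
  define c where "c \<kappa> = (\<Prod>i\<in>F. coeff (p i) (\<kappa> i) * cis (- (of_int (n \<kappa> i) * \<theta> i)))" for \<kappa> :: "'i \<Rightarrow> nat"
  define l where "l \<kappa> = (\<Sum>i\<in>F. of_int (n \<kappa> i) * \<omega> i)" for \<kappa> :: "'i \<Rightarrow> nat"
  have "(\<Prod>i\<in>F. g i (\<omega> i * t - \<theta> i)) = (\<Sum>\<kappa>\<in>?K. c \<kappa> * cis (l \<kappa> * t))" for t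
  proof -
    have "(\<Prod>i\<in>F. g i (\<omega> i * t - \<theta> i)) = (\<Prod>i\<in>F. \<Sum>k\<in>{..degree (p i)}. coeff (p i) k * cis (of_int (int k - int (N i)) * (\<omega> i * t - \<theta> i)))"
      by (intro prod.cong) (auto simp: Np)
    also have "\<dots> = (\<Sum>\<kappa>\<in>?K. \<Prod>i\<in>F. coeff (p i) (\<kappa> i) * cis (of_int (int (\<kappa> i) - int (N i)) * (\<omega> i * t - \<theta> i)))"
      by (intro prod_sum_PiE F) auto
    also have "\<dots> = (\<Sum>\<kappa>\<in>?K. c \<kappa> * cis (l \<kappa> * t))"
    proof (intro sum.cong refl)
      fix \<kappa>
      have "(\<Prod>i\<in>F. coeff (p i) (\<kappa> i) * cis (of_int (int (\<kappa> i) - int (N i)) * (\<omega> i * t - \<theta> i))) =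
        (\<Prod>i\<in>F. (coeff (p i) (\<kappa> i) * cis (- (of_int (n \<kappa> i) * \<theta> i))) * cis (of_int (n \<kappa> i) * \<omega> i * t))"
        by (intro prod.cong) (auto simp: n_def mult.assoc cis_mult right_diff_distrib)
      also have "\<dots> = c \<kappa> * cis (l \<kappa> * t)"
        by (simp add: prod.distrib c_def l_def prod_cis F sum_distrib_right)
      finally show "(\<Prod>i\<in>F. coeff (p i) (\<kappa> i) * cis (of_int (int (\<kappa> i) - int (N i)) * (\<omega> i * t - \<theta> i))) = c \<kappa> * cis (l \<kappa> * t)" .
    qed
    finally show ?thesis .
  qed
  moreover have "has_mean (\<lambda>t. \<Sum>\<kappa>\<in>?K. c \<kappa> * cis (l \<kappa> * t)) (\<Sum>\<kappa>\<in>?K. c \<kappa> * (if l \<kappa> = 0 then 1 else 0))"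
    by (intro has_mean_sum has_mean_cmult has_mean_cis continuous_intros)
  moreover have "(\<Sum>\<kappa>\<in>?K. c \<kappa> * (if l \<kappa> = 0 then 1 else 0)) = (\<Prod>i\<in>F. m i)"
  proof -
    have "(\<Sum>\<kappa>\<in>?K. c \<kappa> * (if l \<kappa> = 0 then 1 else 0)) = (\<Sum>\<kappa>\<in>?K. \<Prod>i\<in>F. if \<kappa> i = N i then coeff (p i) (\<kappa> i) else 0)"
    proof (intro sum.cong refl)
      fix \<kappa>
      show "c \<kappa> * (if l \<kappa> = 0 then 1 else 0) = (\<Prod>i\<in>F. if \<kappa> i = N i then coeff (p i) (\<kappa> i) else 0)"
      proof (cases "\<forall>i\<in>F. n \<kappa> i = 0")
        case True
        then show ?thesis by (auto simp: c_def l_def n_def intro!: prod.cong)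
      next
        case False
        then have "l \<kappa> \<noteq> 0" using ind unfolding rat_indep_def l_def by blast
        moreover have "(\<Prod>i\<in>F. if \<kappa> i = N i then coeff (p i) (\<kappa> i) else 0) = 0"
          using False F by (intro prod_zero) (auto simp: n_def)
        ultimately show ?thesis by simp
      qed
    qed
    also have "\<dots> = (\<Prod>i\<in>F. \<Sum>k\<in>{..degree (p i)}. if k = N i then coeff (p i) k else 0)"
      by (intro prod_sum_PiE[symmetric] F) auto
    also have "\<dots> = (\<Prod>i\<in>F. m i)"
      by (intro prod.cong refl) (auto simp: Np(2) sum.delta coeff_eq_0)
    finally show ?thesis .
  qed
  ultimately show ?thesis by simp
qed

text \<open>Every factor has its own variable, so the estimate is uniform over the whole torus and
  can afterwards be restricted to the lines \<open>\<omega> i * t - \<theta> i\<close>. The bound by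
  1 supplies the boundedness that products of uniform limits require.\<close>

lemma uniform_limit_prod_components:
  fixes g :: "'i \<Rightarrow> real \<Rightarrow> complex"
  assumes "finite F" "\<And>i. i \<in> F \<Longrightarrow> uniform_limit UNIV (\<lambda>n. G n i) (g i) sequentially"
    and "\<And>i x. i \<in> F \<Longrightarrow> norm (g i x) \<le> 1"
  shows "uniform_limit UNIV (\<lambda>n x. \<Prod>i\<in>F. G n i (x i)) (\<lambda>x. \<Prod>i\<in>F. g i (x i)) sequentially"
  using assms
proof (induction F rule: finite_induct)
  case empty
  then show ?case by (simp add: uniform_limit_const)
next
  case (insert j F)
  have "uniform_limit UNIV (\<lambda>n x. G n j (x j)) (\<lambda>x. g j (x j)) sequentially"
  proof (rule uniform_limitI)
    fix e :: real assume "e > 0"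
    from uniform_limitD[OF insert.prems(1)[of j] this]
    show "\<forall>\<^sub>F n in sequentially. \<forall>x\<in>UNIV. dist (G n j (x j)) (g j (x j)) < e"
      by (auto elim: eventually_mono)
  qed
  moreover have "bounded ((\<lambda>x. g j (x j)) ` UNIV)" "bounded ((\<lambda>x. \<Prod>i\<in>F. g i (x i)) ` UNIV)"
    using insert.prems(2) by (auto simp: bounded_iff prod_norm[symmetric] intro!: exI[of _ 1] prod_le_1)
  ultimately have "uniform_limit UNIV (\<lambda>n x. G n j (x j) * (\<Prod>i\<in>F. G n i (x i))) (\<lambda>x. g j (x j) * (\<Prod>i\<in>F. g i (x i))) sequentially"
    using insert by (intro uniform_lim_mult) auto
  then show ?case using insert by simp
qed

text \<open>The partial sums of the exponential series of \<open>\<i> * s * cos x\<close> are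
  trigonometric polynomials, and \<open>\<bar>s\<bar> ^ k / fact k\<close> majorises them uniformly
  in \<open>x\<close>.\<close>

lemma cis_cos_trig_approx:
  "\<exists>G M. (\<forall>n. trig_poly (G n) (M n)) \<and> uniform_limit UNIV G (\<lambda>x. cis (s * cos x)) sequentially"
proof -
  define f where "f k x = (\<i> * of_real (s * cos x)) ^ k /\<^sub>R fact k" for k :: nat and x :: real
  have "uniform_limit UNIV (\<lambda>n x. \<Sum>k<n. f k x) (\<lambda>x. suminf (\<lambda>k. f k x)) sequentially"
  proof (rule Weierstrass_m_test)
    show "summable (\<lambda>k. \<bar>s\<bar> ^ k /\<^sub>R fact k)" by (rule summable_exp_generic)
    show "norm (f k x) \<le> \<bar>s\<bar> ^ k /\<^sub>R fact k" for k x
    proof -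
      have "\<bar>s * cos x\<bar> ^ k \<le> \<bar>s\<bar> ^ k" by (intro power_mono) (auto simp: abs_mult mult_left_le)
      then show ?thesis by (simp add: f_def norm_mult norm_power abs_mult field_simps)
    qed
  qed
  moreover have "suminf (\<lambda>k. f k x) = cis (s * cos x)" for x
    by (simp add: f_def cis_conv_exp exp_def)
  moreover have "\<exists>m. trig_poly (\<lambda>x. \<Sum>k<n. f k x) m" for n
  proof -
    \<comment> \<open>\<open>cos x\<close> is \<open>cis (- x) * (1 + cis x * cis x) / 2\<close>, so
      the term of index \<open>k\<close> carries the shift \<open>k\<close>; the factor
      \<open>monom 1 (n - k)\<close> raises all shifts to the common value \<open>n\<close>.\<close>
    define p :: "complex poly" where 
      "p = (\<Sum>k<n. smult ((\<i> * of_real s / 2) ^ k /\<^sub>R fact k) ([:1, 0, 1:] ^ k * monom 1 (n - k)))"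
    have "(\<Sum>k<n. f k x) = cis (- (real n * x)) * poly p (cis x)" for x
    proof -
      have "f k x = cis (- (real n * x)) * ((\<i> * of_real s / 2) ^ k /\<^sub>R fact k * ((1 + cis x * cis x) ^ k * cis x ^ (n - k)))" 
        if "k < n" for k
      proof -
        have c: "complex_of_real (cos x) = cis (- x) * (1 + cis x * cis x) / 2"
        proof -
          have "cis (- x) * (1 + cis x * cis x) = cis (- x) + cis x"
            by (simp add: distrib_left cis_mult)
          also have "\<dots> = 2 * complex_of_real (cos x)" by (simp add: complex_eq_iff)
          finally show ?thesis by simp
        qed
        have "cis (- x) ^ k = cis (- (real n * x)) * cis x ^ (n - k)"
          using that by (simp add: Complex.DeMoivre cis_mult of_nat_diff algebra_simps)
        moreover have "f k x = ((\<i> * of_real s / 2) ^ k /\<^sub>R fact k) * (cis (- x) ^ k * (1 + cis x * cis x) ^ k)"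
        proof -
          have "\<i> * (of_real s * (cis (- x) * (1 + cis x * cis x) / 2)) = (\<i> * of_real s / 2) * (cis (- x) * (1 + cis x * cis x))"
            by simp
          then show ?thesis unfolding f_def of_real_mult c by (simp only: power_mult_distrib mult_scaleR_left)
        qed
        ultimately show ?thesis by (simp add: mult_ac)
      qed
      then show ?thesis
        by (simp add: p_def poly_sum sum_distrib_left poly_monom algebra_simps)
    qed
    then show ?thesis unfolding trig_poly_def by blast
  qed
  then obtain M where "\<And>n. trig_poly (\<lambda>x. \<Sum>k<n. f k x) (M n)" by metis
  ultimately show ?thesis by (intro exI[of _ "\<lambda>n x. \<Sum>k<n. f k x"] exI[of _ M]) simp
qed

lemma circle_mean_tendsto:
  assumes "uniform_limit UNIV G g sequentially" "\<And>n. continuous_on UNIV (G n)"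
  shows "(\<lambda>n. circle_mean (G n)) \<longlonglongrightarrow> circle_mean g"
proof -
  have "uniform_limit {0..2*pi} G g sequentially" using assms(1) by (rule uniform_limit_on_subset) auto
  then obtain I J where "\<And>n. (G n has_integral I n) {0..2*pi}" "(g has_integral J) {0..2*pi}" "I \<longlonglongrightarrow> J"
    by (rule uniform_limit_integral) (auto intro: continuous_on_subset[OF assms(2) subset_UNIV])
  then show ?thesis
    unfolding circle_mean_def integral_unique[OF \<open>\<And>n. (G n has_integral I n) _\<close>] integral_unique[OF \<open>(g has_integral J) _\<close>]
    by (intro tendsto_intros) auto
qed

lemma has_mean_prod_cis_cos:
  fixes \<omega> \<theta> s :: "'i \<Rightarrow> real"
  assumes F: "finite F" and ind: "rat_indep F \<omega>"
  shows "has_mean (\<lambda>t. \<Prod>i\<in>F. cis (s i * cos (\<omega> i * t - \<theta> i))) (\<Prod>i\<in>F. circle_mean (\<lambda>x. cis (s i * cos x)))"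
proof -
  have "\<forall>i. \<exists>G M. (\<forall>n. trig_poly (G n) (M n)) \<and> uniform_limit UNIV G (\<lambda>x. cis (s i * cos x)) sequentially"
    using cis_cos_trig_approx by blast
  then obtain G M where GM: "\<And>i n. trig_poly (G i n) (M i n)" 
      "\<And>i. uniform_limit UNIV (G i) (\<lambda>x. cis (s i * cos x)) sequentially" by metis
  show ?thesis
  proof (rule has_mean_uniform_limit)
    have "uniform_limit UNIV (\<lambda>n x. \<Prod>i\<in>F. G i n (x i)) (\<lambda>x. \<Prod>i\<in>F. cis (s i * cos (x i))) sequentially"
      using uniform_limit_prod_components[OF F, of "\<lambda>n i. G i n" "\<lambda>i x. cis (s i * cos x)"] GM(2) by simp
    then show "uniform_limit UNIV (\<lambda>n t. \<Prod>i\<in>F. G i n (\<omega> i * t - \<theta> i)) (\<lambda>t. \<Prod>i\<in>F. cis (s i * cos (\<omega> i * t - \<theta> i))) sequentially"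
      unfolding uniform_limit_iff by (fastforce elim: eventually_mono)
    show "continuous_on UNIV (\<lambda>t. \<Prod>i\<in>F. G i n (\<omega> i * t - \<theta> i))" for n
      by (intro continuous_on_prod continuous_on_compose2[OF trig_poly_continuous[OF GM(1), of UNIV]] continuous_intros) auto
    show "has_mean (\<lambda>t. \<Prod>i\<in>F. G i n (\<omega> i * t - \<theta> i)) (\<Prod>i\<in>F. M i n)" for n
      by (rule has_mean_prod_trig_poly[OF F ind GM(1)])
    have "M i \<longlonglongrightarrow> circle_mean (\<lambda>x. cis (s i * cos x))" for i
      using circle_mean_tendsto[OF GM(2) trig_poly_continuous[OF GM(1)]] trig_poly_circle_mean[OF GM(1)] by simp
    then show "(\<lambda>n. \<Prod>i\<in>F. M i n) \<longlonglongrightarrow> (\<Prod>i\<in>F. circle_mean (\<lambda>x. cis (s i * cos x)))"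
      by (intro tendsto_prod)
  qed
qed

text \<open>\<open>(1 + cos x) / 2\<close> is \<open>cis (- x) * (1 + cis x)\<^sup>2 / 4\<close>, so
  the constant term of its power is a central binomial coefficient. The kernel peaks at multiples of
  \<open>2 * pi\<close>, yet its mean decays only polynomially in \<open>n\<close>.\<close>

lemma trig_poly_fejer:
  "trig_poly (\<lambda>x. of_real (((1 + cos x) / 2) ^ n)) (of_real (of_nat ((2 * n) choose n) / 4 ^ n))"
proof -
  have "complex_of_real (((1 + cos x) / 2) ^ n) = cis (- (real n * x)) * poly (smult (1 / 4 ^ n) ([:1, 1:] ^ (2 * n))) (cis x)" for x
  proof -
    have "cis (- x) * (1 + cis x) ^ 2 = cis (- x) + 2 * (cis (- x) * cis x) + (cis (- x) * cis x) * cis x"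
      by (simp add: power2_eq_square algebra_simps)
    also have "\<dots> = 2 + (cis x + cis (- x))" by (simp add: cis_mult)
    also have "\<dots> = complex_of_real (2 * (1 + cos x))" by (simp add: complex_eq_iff)
    finally have "cis (- x) * (1 + cis x) ^ 2 / 4 = complex_of_real ((1 + cos x) / 2)" by simp
    then have "complex_of_real (((1 + cos x) / 2) ^ n) = (cis (- x) * (1 + cis x) ^ 2 / 4) ^ n"
      by (simp only: of_real_power)
    also have "\<dots> = cis (- (real n * x)) * ((1 + cis x) ^ (2 * n) / 4 ^ n)"
      by (simp add: power_mult_distrib power_divide Complex.DeMoivre flip: power_mult)
    finally show ?thesis by simp
  qed
  moreover have "of_real (of_nat ((2 * n) choose n) / 4 ^ n) = coeff (smult (1 / 4 ^ n) ([:1, 1:] ^ (2 * n) :: complex poly)) n"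
    by (simp add: coeff_linear_poly_power)
  ultimately show ?thesis unfolding trig_poly_def by blast
qed

section \<open>Linkages\<close>

text \<open>Intermediate values: as \<open>u\<close> turns through half a circle from the direction
  of \<open>w\<close>, the distance runs from \<open>\<bar>norm w - r\<bar>\<close> to
  \<open>norm w + r\<close>.\<close>

lemma exists_unit_norm_diff:
  fixes w :: complex
  assumes r: "r \<ge> 0" and c: "\<bar>norm w - r\<bar> \<le> c" "c \<le> norm w + r"
  shows "\<exists>u. norm u = 1 \<and> norm (w - of_real r * u) = c"
proof -
  \<comment> \<open>For \<open>w = 0\<close> any direction serves; 1 is chosen.\<close>
  define v where "v = (if w = 0 then 1 else w / of_real (norm w))"
  have v: "norm v = 1" "w = of_real (norm w) * v"
    by (auto simp: v_def norm_divide)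
  let ?f = "\<lambda>t. norm (w - of_real r * (v * cis t))"
  have "?f 0 = \<bar>norm w - r\<bar>"
  proof -
    have "w - of_real r * (v * cis 0) = of_real (norm w - r) * v"
      by (subst (1) v(2)) (simp add: algebra_simps)
    then show ?thesis using v by (simp add: norm_mult del: of_real_diff)
  qed
  moreover have "?f pi = norm w + r"
  proof -
    have "w - of_real r * (v * cis pi) = of_real (norm w + r) * v"
      by (subst (1) v(2)) (simp add: algebra_simps)
    then show ?thesis using v r by (simp add: norm_mult del: of_real_add)
  qed
  moreover have "continuous_on {0..pi} ?f" by (intro continuous_intros)
  ultimately obtain t where "?f t = c"
    using IVT'[of ?f 0 c pi] c by auto
  then show ?thesis using v by (intro exI[of _ "v * cis t"]) (simp add: norm_mult)
qed

text \<open>This is a closed polygon with sides \<open>r i\<close> and \<open>norm w\<close>: the hypotheses say that no side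
  exceeds the sum of the others.\<close>

lemma exists_linkage:
  fixes r :: "'i \<Rightarrow> real" and w :: complex
  assumes "finite F" "\<And>i. i \<in> F \<Longrightarrow> r i \<ge> 0" "norm w \<le> sum r F" "\<And>i. i \<in> F \<Longrightarrow> 2 * r i - sum r F \<le> norm w"
  shows "\<exists>u. (\<forall>i\<in>F. norm (u i) = 1) \<and> w = (\<Sum>i\<in>F. of_real (r i) * u i)"
  using assms
proof (induction F arbitrary: w rule: finite_induct)
  case empty
  then show ?case by simp
next
  case (insert j F)
  let ?S = "sum r F"
  have S: "sum r (insert j F) = r j + ?S" using insert.hyps by simp
  have rj: "r j \<ge> 0" "\<And>i. i \<in> F \<Longrightarrow> r i \<ge> 0" using insert.prems by auto
  have rS: "r i \<le> ?S" if "i \<in> F" for i using member_le_sum[of i F r] that rj insert.hyps by auto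
  have S0: "?S \<ge> 0" using rj by (intro sum_nonneg)
  \<comment> \<open>The distance left for the arms in \<open>F\<close> once arm \<open>j\<close> is
    placed, taken as small as possible: the maximum of all lower bounds, from the triangle with
    sides \<open>norm w\<close> and \<open>r j\<close> and from the polygon condition for each
    remaining arm. \<open>M3\<close> and \<open>M4\<close> check it against the two upper
    bounds.\<close>
  define M where "M = Max (insert \<bar>norm w - r j\<bar> ((\<lambda>i. 2 * r i - ?S) ` F))"
  have fin: "finite (insert \<bar>norm w - r j\<bar> ((\<lambda>i. 2 * r i - ?S) ` F))" using insert.hyps by auto
  have M1: "\<bar>norm w - r j\<bar> \<le> M" unfolding M_def by (rule Max_ge[OF fin]) auto
  have M2: "2 * r i - ?S \<le> M" if "i \<in> F" for i unfolding M_def using that by (intro Max_ge[OF fin]) auto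
  have M3: "M \<le> norm w + r j"
  proof (subst M_def, subst Max_le_iff[OF fin])
    have "2 * r i - ?S \<le> norm w + r j" if "i \<in> F" for i
      using insert.prems(3)[of i] that S by simp
    then show "\<forall>a\<in>insert \<bar>norm w - r j\<bar> ((\<lambda>i. 2 * r i - ?S) ` F). a \<le> norm w + r j"
      using rj by (auto simp: abs_le_iff)
  qed auto
  have M4: "M \<le> ?S"
  proof (subst M_def, subst Max_le_iff[OF fin])
    have "2 * r i - ?S \<le> ?S" if "i \<in> F" for i using rS[OF that] by simp
    moreover have "\<bar>norm w - r j\<bar> \<le> ?S"
      using insert.prems(2) insert.prems(3)[of j] S by (auto simp: abs_le_iff)
    ultimately show "\<forall>a\<in>insert \<bar>norm w - r j\<bar> ((\<lambda>i. 2 * r i - ?S) ` F). a \<le> ?S"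
      by auto
  qed auto
  from exists_unit_norm_diff[OF rj(1) M1 M3] obtain v where v: "norm v = 1" "norm (w - of_real (r j) * v) = M" by blast
  from insert.IH[of "w - of_real (r j) * v"] obtain u where
    u: "\<forall>i\<in>F. norm (u i) = 1" "w - of_real (r j) * v = (\<Sum>i\<in>F. of_real (r i) * u i)"
    using rj M4 M2 v by auto
  have "w = of_real (r j) * v + (\<Sum>i\<in>F. of_real (r i) * u i)" using u(2) by (simp add: algebra_simps)
  also have "\<dots> = (\<Sum>i\<in>insert j F. of_real (r i) * (u(j := v)) i)"
    using insert.hyps by (auto intro!: sum.cong)
  finally show ?case using u v by (intro exI[of _ "u(j := v)"]) auto
qed

section \<open>Riemann integrable functions\<close>

text \<open>Used for real and imaginary parts, and for negation.\<close>

lemma riemann_integrable_on_linear: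
  assumes f: "f riemann_integrable_on S" and h: "bounded_linear h"
  shows "(\<lambda>x. h (f x)) riemann_integrable_on S"
proof -
  interpret h: bounded_linear h by (rule h)
  obtain K where K: "K > 0" "\<And>x. norm (h x) \<le> norm x * K" using h.pos_bounded by auto
  obtain I where I: "\<And>\<epsilon>. \<epsilon> > 0 \<Longrightarrow> \<exists>\<delta>>0. \<forall>p. p tagged_division_of S \<and> (\<lambda>x. ball x \<delta>) fine p \<longrightarrow>
        norm ((\<Sum>(x, K)\<in>p. measure lborel K *\<^sub>R f x) - I) < \<epsilon>"
    using f unfolding riemann_integrable_on_def by blast
  show ?thesis unfolding riemann_integrable_on_def
  proof (intro exI[of _ "h I"] allI impI)
    fix \<epsilon> :: real assume "\<epsilon> > 0"
    then obtain \<delta> where \<delta>: "\<delta> > 0" "\<And>p. p tagged_division_of S \<and> (\<lambda>x. ball x \<delta>) fine p \<Longrightarrow>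
        norm ((\<Sum>(x, K)\<in>p. measure lborel K *\<^sub>R f x) - I) < \<epsilon> / K"
      using I[of "\<epsilon> / K"] K by auto
    show "\<exists>\<delta>>0. \<forall>p. p tagged_division_of S \<and> (\<lambda>x. ball x \<delta>) fine p \<longrightarrow>
        norm ((\<Sum>(x, K)\<in>p. measure lborel K *\<^sub>R h (f x)) - h I) < \<epsilon>"
    proof (intro exI[of _ \<delta>] conjI allI impI)
      fix p assume p: "p tagged_division_of S \<and> (\<lambda>x. ball x \<delta>) fine p"
      have "(\<Sum>(x, K)\<in>p. measure lborel K *\<^sub>R h (f x)) - h I = h ((\<Sum>(x, K)\<in>p. measure lborel K *\<^sub>R f x) - I)"
        by (simp add: h.diff h.sum h.scaleR case_prod_beta)
      also have "norm \<dots> < \<epsilon>"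
        using K(2)[of "(\<Sum>(x, K)\<in>p. measure lborel K *\<^sub>R f x) - I"] \<delta>(2)[OF p] K(1)
        by (simp add: pos_less_divide_eq)
      finally show "norm ((\<Sum>(x, K)\<in>p. measure lborel K *\<^sub>R h (f x)) - h I) < \<epsilon>" .
    qed (rule \<delta>)
  qed
qed

text \<open>Balls of constant radius form a gauge, so the Riemann limit is also the gauge integral,
  and uniqueness identifies the value.\<close>

lemma riemann_integrable_integral:
  assumes "f riemann_integrable_on cbox a b"
  shows "f integrable_on cbox a b"
    and "\<epsilon> > 0 \<Longrightarrow> \<exists>\<delta>>0. \<forall>p. p tagged_division_of cbox a b \<and> (\<lambda>x. ball x \<delta>) fine p \<longrightarrow>
        norm ((\<Sum>(x, K)\<in>p. measure lborel K *\<^sub>R f x) - integral (cbox a b) f) < \<epsilon>"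
proof -
  obtain I where I: "\<And>\<epsilon>. \<epsilon> > 0 \<Longrightarrow> \<exists>\<delta>>0. \<forall>p. p tagged_division_of cbox a b \<and> (\<lambda>x. ball x \<delta>) fine p \<longrightarrow>
        norm ((\<Sum>(x, K)\<in>p. measure lborel K *\<^sub>R f x) - I) < \<epsilon>"
    using assms unfolding riemann_integrable_on_def by blast
  have hi: "(f has_integral I) (cbox a b)" unfolding has_integral
  proof (intro allI impI)
    fix e :: real assume "e > 0"
    from I[OF this] obtain \<delta> where "\<delta> > 0" "\<forall>p. p tagged_division_of cbox a b \<and> (\<lambda>x. ball x \<delta>) fine p \<longrightarrow>
        norm ((\<Sum>(x, K)\<in>p. measure lborel K *\<^sub>R f x) - I) < e" by blast
    then show "\<exists>\<gamma>. gauge \<gamma> \<and> (\<forall>\<D>. \<D> tagged_division_of cbox a b \<and> \<gamma> fine \<D> \<longrightarrow>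
         norm ((\<Sum>(x, k)\<in>\<D>. measure lborel k *\<^sub>R f x) - I) < e)"
      by (intro exI[of _ "\<lambda>x. ball x \<delta>"] conjI gauge_ball) auto
  qed
  then show "f integrable_on cbox a b" by blast
  from hi have "integral (cbox a b) f = I" by (rule integral_unique)
  then show "\<epsilon> > 0 \<Longrightarrow> \<exists>\<delta>>0. \<forall>p. p tagged_division_of cbox a b \<and> (\<lambda>x. ball x \<delta>) fine p \<longrightarrow>
        norm ((\<Sum>(x, K)\<in>p. measure lborel K *\<^sub>R f x) - integral (cbox a b) f) < \<epsilon>"
    using I by simp
qed

text \<open>The tags of a sufficiently fine division are free, which controls the upper Darboux sum.\<close>

lemma riemann_integrable_fine_division:
  fixes h :: "'a::euclidean_space \<Rightarrow> real"
  assumes h: "h riemann_integrable_on cbox a b" and nz: "measure lborel (cbox a b) \<noteq> 0" and e: "e > 0"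
  obtains D where "D division_of cbox a b" "\<And>K. K \<in> D \<Longrightarrow> measure lborel K > 0"
    "\<And>\<tau>. (\<And>K. K \<in> D \<Longrightarrow> \<tau> K \<in> K) \<Longrightarrow> \<bar>(\<Sum>K\<in>D. measure lborel K * h (\<tau> K)) - integral (cbox a b) h\<bar> < e"
proof -
  obtain \<delta> where \<delta>: "\<delta> > 0" "\<And>p. p tagged_division_of cbox a b \<Longrightarrow> (\<lambda>x. ball x \<delta>) fine p \<Longrightarrow>
        norm ((\<Sum>(x, K)\<in>p. measure lborel K *\<^sub>R h x) - integral (cbox a b) h) < e"
    using riemann_integrable_integral(2)[OF h e] by blast
  obtain p where p: "p tagged_division_of cbox a b" "(\<lambda>x. ball x (\<delta> / 2)) fine p"
    using fine_division_exists[OF gauge_ball] \<delta>(1) by (metis half_gt_zero)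
  \<comment> \<open>Degenerate pieces are discarded so that one may divide by the measure of any
    piece of \<open>D\<close>; they still cover, because the box itself is nondegenerate.\<close>
  define D where "D = {K \<in> snd ` p. measure lborel K \<noteq> 0}"
  have D: "D division_of cbox a b"
    unfolding D_def by (rule division_of_nontrivial[OF division_of_tagged_division[OF p(1)] nz])
  \<comment> \<open>The division is fine for \<open>\<delta> / 2\<close>, so pieces have diameter
    below \<open>\<delta>\<close> and stay \<open>\<delta>\<close>-fine after any change of
    tags.\<close>
  have small: "dist x y < \<delta>" if "K \<in> D" "x \<in> K" "y \<in> K" for K x y
  proof -
    from that(1) have "K \<in> snd ` p" by (simp add: D_def)
    then obtain z where "(z, K) \<in> p" by auto
    then have "K \<subseteq> ball z (\<delta> / 2)" using p(2) by (auto simp: fine_def)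
    then have "dist z x < \<delta> / 2" "dist z y < \<delta> / 2" using that by auto
    then show ?thesis by (metis dist_triangle_half_r)
  qed
  show thesis
  proof (rule that[OF D])
    show "measure lborel K > 0" if "K \<in> D" for K using that by (auto simp: D_def zero_less_measure_iff)
    fix \<tau> assume \<tau>: "\<And>K. K \<in> D \<Longrightarrow> \<tau> K \<in> K"
    let ?q = "(\<lambda>K. (\<tau> K, K)) ` D"
    have "?q tagged_division_of cbox a b"
    proof (rule tagged_division_ofI)
      show "finite ?q" using division_ofD(1)[OF D] by simp
      show "\<Union> {K. \<exists>x. (x, K) \<in> ?q} = cbox a b"
      proof -
        have "{K. \<exists>x. (x, K) \<in> ?q} = D" by auto
        then show ?thesis using division_ofD(6)[OF D] by simp
      qed
      show "interior K1 \<inter> interior K2 = {}"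
        if "(x1, K1) \<in> ?q" "(x2, K2) \<in> ?q" "(x1, K1) \<noteq> (x2, K2)" for x1 K1 x2 K2
        using that division_ofD(5)[OF D, of K1 K2] by fastforce
      fix x K assume "(x, K) \<in> ?q"
      then have "x = \<tau> K" "K \<in> D" by auto
      then show "x \<in> K" "K \<subseteq> cbox a b" "\<exists>a b. K = cbox a b"
        using \<tau> division_ofD(2)[OF D] division_ofD(4)[OF D] by blast+
    qed
    moreover have "(\<lambda>x. ball x \<delta>) fine ?q"
      using small \<tau> by (auto simp: fine_def)
    ultimately have "norm ((\<Sum>(x, K)\<in>?q. measure lborel K *\<^sub>R h x) - integral (cbox a b) h) < e" by (rule \<delta>(2))
    moreover have "(\<Sum>(x, K)\<in>?q. measure lborel K *\<^sub>R h x) = (\<Sum>K\<in>D. measure lborel K * h (\<tau> K))"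
      by (subst sum.reindex) (auto simp: inj_on_def)
    ultimately show "\<bar>(\<Sum>K\<in>D. measure lborel K * h (\<tau> K)) - integral (cbox a b) h\<bar> < e" by simp
  qed
qed

text \<open>Moving a single tag inside \<open>K\<close> changes the Riemann sum by
  \<open>measure lborel K * (h x - h (\<sigma> K))\<close>. Both sums are within 1 of the integral,
  so the change is at most 2, and \<open>K\<close> has positive measure.\<close>

lemma riemann_integrable_bounded:
  fixes h :: "'a::euclidean_space \<Rightarrow> real"
  assumes h: "h riemann_integrable_on cbox a b" and nz: "measure lborel (cbox a b) \<noteq> 0"
  shows "bounded (h ` cbox a b)"
proof -
  obtain D where D: "D division_of cbox a b" "\<And>K. K \<in> D \<Longrightarrow> measure lborel K > 0"
    "\<And>\<tau>. (\<And>K. K \<in> D \<Longrightarrow> \<tau> K \<in> K) \<Longrightarrow> \<bar>(\<Sum>K\<in>D. measure lborel K * h (\<tau> K)) - integral (cbox a b) h\<bar> < 1"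
    using riemann_integrable_fine_division[OF h nz, of 1] by auto
  have fin: "finite D" using D(1) by auto
  define \<sigma> where "\<sigma> K = (SOME x. x \<in> K)" for K :: "'a set"
  have \<sigma>: "\<sigma> K \<in> K" if "K \<in> D" for K
    unfolding \<sigma>_def using D(2)[OF that] by (metis some_in_eq less_irrefl measure_empty)
  have "bounded (h ` K)" if K: "K \<in> D" for K
  proof -
    have "\<bar>h x\<bar> \<le> \<bar>h (\<sigma> K)\<bar> + 2 / measure lborel K" if x: "x \<in> K" for x
    proof -
      let ?\<tau> = "\<sigma>(K := x)"
      have "\<bar>(\<Sum>L\<in>D. measure lborel L * h (?\<tau> L)) - integral (cbox a b) h\<bar> < 1"
        using \<sigma> x by (intro D(3)) auto
      moreover have "\<bar>(\<Sum>L\<in>D. measure lborel L * h (\<sigma> L)) - integral (cbox a b) h\<bar> < 1"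
        using \<sigma> by (intro D(3)) auto
      moreover have "(\<Sum>L\<in>D. measure lborel L * h (?\<tau> L)) - (\<Sum>L\<in>D. measure lborel L * h (\<sigma> L)) = measure lborel K * (h x - h (\<sigma> K))"
      proof -
        have "(\<Sum>L\<in>D - {K}. measure lborel L * h (?\<tau> L)) = (\<Sum>L\<in>D - {K}. measure lborel L * h (\<sigma> L))"
          by (intro sum.cong) auto
        then show ?thesis using fin K by (simp add: sum.remove[of D K] right_diff_distrib)
      qed
      ultimately have "\<bar>measure lborel K * (h x - h (\<sigma> K))\<bar> \<le> 2" by linarith
      then have "\<bar>h x - h (\<sigma> K)\<bar> \<le> 2 / measure lborel K"
        using D(2)[OF K] by (simp add: abs_mult pos_le_divide_eq mult.commute)
      then show ?thesis by linarith
    qed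
    then show ?thesis unfolding bounded_iff by auto
  qed
  then have "bounded (\<Union>K\<in>D. h ` K)" using fin by auto
  moreover have "(\<Union>K\<in>D. h ` K) = h ` cbox a b" using D(1) by (metis division_ofD(6) image_Union)
  ultimately show ?thesis by simp
qed

text \<open>A Lipschitz stand-in for the indicator: 1 on \<open>K\<close>, 0 from distance
  \<open>1 / n\<close> on. As \<open>infdist\<close> to the empty set is 0, the tent over
  \<open>{}\<close> is constantly 1, so lemmas about it assume \<open>K\<close> nonempty.\<close>

definition tent :: "nat \<Rightarrow> 'a::metric_space set \<Rightarrow> 'a \<Rightarrow> real" where
  "tent n K x = max 0 (1 - real n * infdist x K)"

lemma tent_bounds: "0 \<le> tent n K x" "tent n K x \<le> 1"
  by (auto simp: tent_def infdist_nonneg)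

lemma tent_lipschitz:
  "(real n)-lipschitz_on UNIV (tent n K)"
proof (rule lipschitz_onI)
  fix x y :: 'a
  have "\<bar>infdist x K - infdist y K\<bar> \<le> dist x y"
    by (rule infdist_triangle_abs)
  then have "real n * \<bar>infdist x K - infdist y K\<bar> \<le> real n * dist x y" by (intro mult_left_mono) auto
  moreover have "\<bar>real n * infdist x K - real n * infdist y K\<bar> = real n * \<bar>infdist x K - infdist y K\<bar>"
    by (simp add: abs_mult flip: right_diff_distrib)
  ultimately show "dist (tent n K x) (tent n K y) \<le> real n * dist x y"
    unfolding dist_real_def tent_def by linarith
qed auto

lemma tent_tendsto_indicator:
  assumes "closed K" "K \<noteq> {}"
  shows "(\<lambda>n. tent n K x) \<longlonglongrightarrow> indicator K x"
proof (cases "x \<in> K")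
  case True
  then show ?thesis by (simp add: tent_def)
next
  case False
  then have d: "infdist x K > 0" using assms in_closed_iff_infdist_zero[of K x] infdist_nonneg[of x K] by auto
  have "\<forall>\<^sub>F n in sequentially. tent n K x = 0"
    using eventually_ge_at_top[of "nat \<lceil>1 / infdist x K\<rceil>"]
  proof eventually_elim
    case (elim n)
    then have "1 / infdist x K \<le> real n" by linarith
    then have "1 \<le> real n * infdist x K" using d by (simp add: pos_divide_le_eq)
    then show ?case by (simp add: tent_def)
  qed
  then show ?thesis using False by (simp add: tendsto_eventually)
qed

lemma tent_eq_0:
  fixes K :: "'a::real_normed_vector set"
  assumes K: "\<And>y. y \<in> K \<Longrightarrow> norm y \<le> R" "K \<noteq> {}" and n: "n \<ge> 1" and x: "norm x > R + 1"
  shows "tent n K x = 0"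
proof -
  have "1 \<le> dist x y" if "y \<in> K" for y
    using K(1)[OF that] x norm_triangle_ineq2[of x y] by (simp add: dist_norm)
  then have "1 \<le> infdist x K"
    using K(2) by (auto simp: infdist_def intro!: cINF_greatest)
  then have "1 * 1 \<le> real n * infdist x K" using n by (intro mult_mono) auto
  then show ?thesis by (simp add: tent_def)
qed

text \<open>The step function of an upper Darboux sum majorises \<open>h\<close>. Replacing
  indicators of the pieces by tents makes it Lipschitz and keeps it a majorant, and for steep tents
  the integral returns to the Darboux sum.\<close>

lemma riemann_integrable_upper_approx:
  fixes h :: "'a::euclidean_space \<Rightarrow> real"
  assumes h: "h riemann_integrable_on cbox a b" and nz: "measure lborel (cbox a b) \<noteq> 0" and e: "e > 0"
  obtains \<phi> L R where "L-lipschitz_on UNIV \<phi>" "\<And>x. norm x > R \<Longrightarrow> \<phi> x = 0"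
    "\<And>x. x \<in> cbox a b \<Longrightarrow> h x \<le> \<phi> x" "integral (cbox a b) \<phi> \<le> integral (cbox a b) h + e"
proof -
  let ?B = "cbox a b"
  have Bne: "?B \<noteq> {}" using nz by auto
  have Bpos: "measure lborel ?B > 0" using nz by (simp add: zero_less_measure_iff)
  obtain D where D: "D division_of ?B" "\<And>K. K \<in> D \<Longrightarrow> measure lborel K > 0"
    "\<And>\<tau>. (\<And>K. K \<in> D \<Longrightarrow> \<tau> K \<in> K) \<Longrightarrow> \<bar>(\<Sum>K\<in>D. measure lborel K * h (\<tau> K)) - integral ?B h\<bar> < e / 3"
    using riemann_integrable_fine_division[OF h nz, of "e / 3"] e by auto
  have fin: "finite D" using D(1) by auto
  obtain c where c: "\<And>x. x \<in> ?B \<Longrightarrow> \<bar>h x\<bar> \<le> c"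
    using riemann_integrable_bounded[OF h nz] by (auto simp: bounded_iff)
  have c0: "c \<ge> 0" using c Bne by (metis abs_ge_zero all_not_in_conv order_trans)
  have DB: "K \<subseteq> ?B" "K \<noteq> {}" "closed K" if "K \<in> D" for K
    using division_ofD[OF D(1)] that by (auto, metis closed_cbox)
  define U where "U K = Sup (h ` K)" for K
  have bdd: "bdd_above (h ` K)" if "K \<in> D" for K
    using c DB(1)[OF that] by (intro bdd_aboveI[of _ c]) (auto simp: abs_le_iff)
  have U: "h x \<le> U K" if "K \<in> D" "x \<in> K" for K x
    unfolding U_def using that bdd by (intro cSup_upper) auto
  have Uc: "U K + c \<ge> 0" if K: "K \<in> D" for K
  proof -
    obtain x where "x \<in> K" using DB(2)[OF K] by auto
    then show ?thesis using U[OF K, of x] c[of x] DB(1)[OF K] by force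
  qed
  \<comment> \<open>Tags that nearly attain the suprema turn the upper Darboux sum into a tagged
    sum; over the whole box the loss is \<open>e / 3\<close>.\<close>
  have "\<exists>x\<in>K. U K - e / (3 * measure lborel ?B) < h x" if "K \<in> D" for K
    using less_cSup_iff[of "h ` K" "U K - e / (3 * measure lborel ?B)"] bdd[OF that] DB(2)[OF that] e Bpos
    by (auto simp: U_def)
  then obtain \<tau> where \<tau>: "\<And>K. K \<in> D \<Longrightarrow> \<tau> K \<in> K" "\<And>K. K \<in> D \<Longrightarrow> U K - e / (3 * measure lborel ?B) < h (\<tau> K)"
    by metis
  have sumD: "(\<Sum>K\<in>D. measure lborel K) = measure lborel ?B" using additive_content_division[OF D(1)] .
  have "(\<Sum>K\<in>D. measure lborel K * U K) \<le> (\<Sum>K\<in>D. measure lborel K * (h (\<tau> K) + e / (3 * measure lborel ?B)))"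
    using D(2) \<tau>(2) by (intro sum_mono mult_left_mono) (auto simp: less_imp_le diff_le_eq[symmetric])
  also have "\<dots> = (\<Sum>K\<in>D. measure lborel K * h (\<tau> K)) + measure lborel ?B * (e / (3 * measure lborel ?B))"
    by (simp only: distrib_left sum.distrib sum_distrib_right[symmetric] sumD)
  also have "\<dots> \<le> integral ?B h + e / 3 + e / 3"
  proof -
    have "measure lborel ?B * (e / (3 * measure lborel ?B)) = e / 3" using Bpos by simp
    moreover have "(\<Sum>K\<in>D. measure lborel K * h (\<tau> K)) < integral ?B h + e / 3"
      using D(3)[OF \<tau>(1)] by linarith
    ultimately show ?thesis by linarith
  qed
  finally have upper: "(\<Sum>K\<in>D. measure lborel K * U K) \<le> integral ?B h + e / 3 + e / 3" .
  \<comment> \<open>The values are shifted by \<open>c\<close> to be nonnegative, so overlapping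
    tents can only increase the sum; the shift is removed by a tent over the box, equal to 1 on
    it.\<close>
  define \<phi> where "\<phi> n x = (\<Sum>K\<in>D. (U K + c) * tent n K x) - c * tent n ?B x" for n x
  have lip: "((\<Sum>K\<in>D. \<bar>U K + c\<bar> * real n) + \<bar>c\<bar> * real n)-lipschitz_on UNIV (\<phi> n)" for n
  proof -
    have "(\<Sum>K\<in>D. \<bar>U K + c\<bar> * real n)-lipschitz_on UNIV (\<lambda>x. \<Sum>K\<in>D. (U K + c) * tent n K x)"
      using fin
    proof (induction D rule: finite_induct)
      case empty
      then show ?case by (simp add: lipschitz_on_def)
    next
      case (insert K E)
      then show ?case
        using lipschitz_on_add[OF lipschitz_on_cmult_real[OF tent_lipschitz] insert.IH] by simp
    qed
    then show ?thesis unfolding \<phi>_def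
      by (intro lipschitz_on_diff lipschitz_on_cmult_real tent_lipschitz)
  qed
  have cont: "continuous_on A (\<phi> n)" for A n
    using lipschitz_on_continuous_on[OF lip] continuous_on_subset by blast
  have ub: "h x \<le> \<phi> n x" if x: "x \<in> ?B" for n x
  proof -
    obtain K where K: "K \<in> D" "x \<in> K" using division_ofD(6)[OF D(1)] x by auto
    have "h x + c \<le> (U K + c) * tent n K x" using U[OF K] K by (simp add: tent_def)
    also have "\<dots> \<le> (\<Sum>K\<in>D. (U K + c) * tent n K x)"
      using Uc tent_bounds by (intro member_le_sum[of K D] K fin mult_nonneg_nonneg) auto
    finally show ?thesis using x by (simp add: \<phi>_def tent_def)
  qed
  have "(\<lambda>n. integral ?B (\<phi> n)) \<longlonglongrightarrow> integral ?B (\<lambda>x. (\<Sum>K\<in>D. (U K + c) * indicator K x) - c * indicator ?B x)"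
  proof (rule dominated_convergence(2))
    show "\<phi> n integrable_on ?B" for n by (intro integrable_continuous cont)
    show "(\<lambda>x. (\<Sum>K\<in>D. (U K + c)) + c) integrable_on ?B" by (rule integrable_const)
    show "norm (\<phi> n x) \<le> (\<Sum>K\<in>D. (U K + c)) + c" for n x
    proof -
      have "0 \<le> (\<Sum>K\<in>D. (U K + c) * tent n K x)" "(\<Sum>K\<in>D. (U K + c) * tent n K x) \<le> (\<Sum>K\<in>D. (U K + c))"
        using Uc tent_bounds by (auto intro!: sum_nonneg sum_mono mult_left_le mult_nonneg_nonneg)
      moreover have "0 \<le> c * tent n ?B x" "c * tent n ?B x \<le> c"
        using c0 tent_bounds by (auto intro!: mult_left_le mult_nonneg_nonneg)
      ultimately show ?thesis by (simp add: \<phi>_def)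
    qed
    show "(\<lambda>n. \<phi> n x) \<longlonglongrightarrow> (\<Sum>K\<in>D. (U K + c) * indicator K x) - c * indicator ?B x" for x
      unfolding \<phi>_def using DB Bne by (intro tendsto_intros tent_tendsto_indicator) auto
  qed
  also have "integral ?B (\<lambda>x. (\<Sum>K\<in>D. (U K + c) * indicator K x) - c * indicator ?B x) = (\<Sum>K\<in>D. measure lborel K * U K)"
  proof -
    \<comment> \<open>Linearity is applied piece by piece, so faces shared by closed pieces cause no
      double counting issue; the terms in \<open>c\<close> cancel through
      \<open>sumD\<close>.\<close>
    have i: "(indicator K has_integral measure lborel K) ?B" if "K \<in> D" for K
    proof -
      from division_ofD(4)[OF D(1) that] obtain l u where K: "K = cbox l u" by auto
      have "((\<lambda>x. 1::real) has_integral measure lborel K) K" using has_integral_const[of "1::real" l u] K by simp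
      then have "((\<lambda>x. if x \<in> K then 1 else 0 :: real) has_integral measure lborel K) ?B"
        by (simp only: has_integral_restrict[OF DB(1)[OF that]])
      moreover have "(\<lambda>x. if x \<in> K then 1 else 0 :: real) = indicator K"
        by (auto simp: fun_eq_iff)
      ultimately show ?thesis by simp
    qed
    have "((\<lambda>x. 1::real) has_integral measure lborel ?B) ?B"
      using has_integral_const[of "1::real" a b] by simp
    then have iB: "((indicator ?B :: 'a \<Rightarrow> real) has_integral measure lborel ?B) ?B"
      by (rule has_integral_eq[rotated]) auto
    have "((\<lambda>x. (\<Sum>K\<in>D. (U K + c) * indicator K x) - c * indicator ?B x) has_integral
       (\<Sum>K\<in>D. (U K + c) * measure lborel K) - c * measure lborel ?B) ?B"
      by (intro has_integral_diff[OF _ has_integral_mult_right[OF iB]] has_integral_sum fin has_integral_mult_right i)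
    moreover have "(\<Sum>K\<in>D. (U K + c) * measure lborel K) - c * measure lborel ?B = (\<Sum>K\<in>D. measure lborel K * U K)"
      unfolding sumD[symmetric] by (simp add: algebra_simps sum.distrib sum_distrib_left)
    ultimately show ?thesis by (simp add: integral_unique)
  qed
  finally have "\<forall>\<^sub>F n in sequentially. integral ?B (\<phi> n) < integral ?B h + e"
    using upper e by (intro order_tendstoD(2)) auto
  then have "\<forall>\<^sub>F n in sequentially. integral ?B (\<phi> n) < integral ?B h + e \<and> n \<ge> 1"
    using eventually_ge_at_top[of 1] by (rule eventually_conj)
  then obtain n where n: "integral ?B (\<phi> n) < integral ?B h + e" "n \<ge> 1" by (auto simp: eventually_sequentially)
  obtain R where R: "\<And>x. x \<in> ?B \<Longrightarrow> norm x \<le> R" using bounded_cbox[of a b] by (auto simp: bounded_iff)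
  have tent0: "tent n K x = 0" if "K \<subseteq> ?B" "K \<noteq> {}" "norm x > R + 1" for K x
    using that R n by (intro tent_eq_0[of K R n x]) auto
  show thesis
  proof (rule that[OF lip[of n]])
    show "\<phi> n x = 0" if "norm x > R + 1" for x
      using that tent0 DB Bne by (simp add: \<phi>_def)
  qed (use n ub in auto)
qed

section \<open>The limit distribution\<close>

lemma lin_indep_over_rat_imp_rat_indep:
  assumes li: "lin_indep_over_rat S" and SR: "S \<subseteq> \<real>" and F: "finite F" "F \<subseteq> S"
  shows "rat_indep F Re"
  unfolding rat_indep_def
proof (intro allI impI ballI)
  fix n :: "complex \<Rightarrow> int" and v
  assume sum: "(\<Sum>i\<in>F. of_int (n i) * Re i) = 0" and v: "v \<in> F"
  interpret module "\<lambda>(q::rat) z :: complex. of_rat q * z"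
    by unfold_locales (simp_all add: algebra_simps of_rat_add of_rat_mult)
  have "(\<Sum>i\<in>F. of_rat (of_int (n i)) * i) = complex_of_real (\<Sum>i\<in>F. of_int (n i) * Re i)"
    unfolding of_real_sum
  proof (intro sum.cong refl)
    fix i assume "i \<in> F"
    then have "i = of_real (Re i)" using F SR by (auto simp: complex_is_Real_iff complex_eq_iff)
    then show "of_rat (of_int (n i)) * i = complex_of_real (of_int (n i) * Re i)" by simp
  qed
  then have "(of_rat (of_int (n v)) :: complex) = 0 \<or> of_int (n v) = (0::rat)"
    using independentD[of S F "\<lambda>i. of_int (n i)" v] li F v sum by (simp add: lin_indep_over_rat_def)
  then show "n v = 0" by simp
qed

lemma norm_cis_diff_le: "norm (cis x - cis y) \<le> \<bar>x - y\<bar>"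
proof -
  have "norm (cis x - cis y) = norm (cis y * (cis (x - y) - 1))"
    by (simp add: right_diff_distrib cis_mult)
  also have "\<dots> = norm (cis (x - y) - 1)" by (simp add: norm_mult)
  also have "\<dots> \<le> \<bar>x - y\<bar>"
    using iexp_approx1[of "x - y" 0] by (simp add: cis_conv_exp)
  finally show ?thesis .
qed

text \<open>The inner product is \<open>Re (cnj z * a * cis (- x))\<close>, and the polar form of
  \<open>cnj z * a\<close> separates modulus and phase. The phase disappears in the mean, leaving
  only \<open>norm z * norm a\<close>.\<close>

lemma inner_mult_cis: "z \<bullet> (a * cis (- x)) = norm z * norm a * cos (x - Arg (cnj z * a))"
proof -
  have "z \<bullet> (a * cis (- x)) = Re (cnj z * a * cis (- x))"
    by (simp add: inner_complex_def algebra_simps)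
  also have "cnj z * a = of_real (norm z * norm a) * cis (Arg (cnj z * a))"
    using rcis_cmod_Arg[of "cnj z * a"] by (simp add: rcis_def norm_mult)
  also have "Re (of_real (norm z * norm a) * cis (Arg (cnj z * a)) * cis (- x)) = 
    norm z * norm a * cos (Arg (cnj z * a) - x)"
    by (simp only: mult.assoc cis_mult) simp
  finally show ?thesis by (metis cos_minus minus_diff_eq)
qed

text \<open>For \<open>T > 0\<close>, the law of \<open>f\<close> at a uniformly distributed random
  time in \<open>[0, T]\<close>.\<close>

definition time_law :: "(real \<Rightarrow> complex) \<Rightarrow> real \<Rightarrow> complex measure" where
  "time_law f T = distr (density lborel (\<lambda>t. ennreal (indicator {0..T} t / T))) borel f"

lemma
  assumes f: "continuous_on UNIV f" and T: "T > 0"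
  shows prob_space_time_law: "prob_space (time_law f T)"
    and AE_time_law: "(\<And>t. P (f t)) \<Longrightarrow> Measurable.pred borel P \<Longrightarrow> AE w in time_law f T. P w"
    and integral_time_law: "\<And>g :: complex \<Rightarrow> 'b::euclidean_space. continuous_on UNIV g \<Longrightarrow>
      (LINT w|time_law f T. g w) = integral {0..T} (\<lambda>t. g (f t)) /\<^sub>R T"
proof -
  have [measurable]: "f \<in> borel_measurable borel" using f by (rule borel_measurable_continuous_onI)
  have "(\<integral>\<^sup>+t. ennreal (indicator {0..T} t / T) \<partial>lborel) = (\<integral>\<^sup>+t. ennreal (1 / T) * indicator {0..T} t \<partial>lborel)"
    by (intro nn_integral_cong) (auto simp: indicator_def)
  also have "\<dots> = ennreal (1 / T) * ennreal T" using T by (simp add: nn_integral_cmult)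
  also have "\<dots> = 1" using T by (simp add: ennreal_mult'[symmetric])
  finally have "prob_space (density lborel (\<lambda>t. ennreal (indicator {0..T} t / T)))"
    by (intro prob_spaceI) (simp add: emeasure_density)
  then show "prob_space (time_law f T)" unfolding time_law_def
    by (rule prob_space.prob_space_distr) simp
  show "AE w in time_law f T. P w" if "\<And>t. P (f t)" "Measurable.pred borel P"
    unfolding time_law_def using that by (subst AE_distr_iff) (auto simp: pred_def)
  fix g :: "complex \<Rightarrow> 'b::euclidean_space" assume g: "continuous_on UNIV g"
  then have [measurable]: "g \<in> borel_measurable borel" by (rule borel_measurable_continuous_onI)
  have "continuous_on {0..T} (\<lambda>t. g (f t))"
    by (rule continuous_on_compose2[OF g]) (auto intro: continuous_on_subset[OF f])
  then have set: "set_integrable lborel {0..T} (\<lambda>t. g (f t))"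
    by (rule borel_integrable_atLeastAtMost')
  have "(LINT w|time_law f T. g w) = (LINT t|lborel. (indicator {0..T} t / T) *\<^sub>R g (f t))"
    unfolding time_law_def using T by (simp add: integral_distr integral_density)
  also have "\<dots> = (LINT t|lborel. (1 / T) *\<^sub>R (indicator {0..T} t *\<^sub>R g (f t)))"
    by (simp add: field_simps)
  also have "\<dots> = (1 / T) *\<^sub>R (LINT t:{0..T}|lborel. g (f t))"
    unfolding set_lebesgue_integral_def by (rule integral_scaleR_right)
  also have "(LINT t:{0..T}|lborel. g (f t)) = integral {0..T} (\<lambda>t. g (f t))"
    by (rule set_borel_integral_eq_integral(2)[OF set])
  finally show "(LINT w|time_law f T. g w) = integral {0..T} (\<lambda>t. g (f t)) /\<^sub>R T"
    by (simp add: divide_inverse)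
qed

section \<open>The almost periodic function and its finite truncations\<close>

locale indep_frequencies =
  fixes \<Omega> :: "complex set" and a :: "complex \<Rightarrow> complex"
  assumes card_ge_5: "infinite \<Omega> \<or> card \<Omega> \<ge> 5"
    and nz: "\<And>\<omega>. \<omega> \<in> \<Omega> \<Longrightarrow> a \<omega> \<noteq> 0"
    and summable: "(\<lambda>\<omega>. norm (a \<omega>)) summable_on \<Omega>"
    and real_freq: "\<Omega> \<subseteq> \<real>"
    and indep: "lin_indep_over_rat \<Omega>"
begin

definition S :: real where "S = (\<Sum>\<^sub>\<infinity>\<omega>\<in>\<Omega>. norm (a \<omega>))"

definition f :: "real \<Rightarrow> complex" where "f = f_Pi \<Omega> a"

definition fsum :: "complex set \<Rightarrow> real \<Rightarrow> complex" where
  "fsum F t = (\<Sum>\<omega>\<in>F. a \<omega> * cis (- (Re \<omega> * t)))"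

definition tail :: "complex set \<Rightarrow> real" where
  "tail F = S - (\<Sum>\<omega>\<in>F. norm (a \<omega>))"

lemma f_eq: "f t = (\<Sum>\<^sub>\<infinity>\<omega>\<in>\<Omega>. a \<omega> * cis (- (Re \<omega> * t)))"
  unfolding f_def f_Pi_def
proof (rule infsum_cong)
  fix \<omega> assume "\<omega> \<in> \<Omega>"
  then have "\<omega> = of_real (Re \<omega>)" using real_freq by (auto simp: complex_is_Real_iff complex_eq_iff)
  then have "- (\<i> * complex_of_real t * \<omega>) = \<i> * of_real (- (Re \<omega> * t))" by (metis mult.assoc mult.commute mult_minus_right of_real_minus of_real_mult)
  then show "a \<omega> * exp (- (\<i> * complex_of_real t * \<omega>)) = a \<omega> * cis (- (Re \<omega> * t))"
    unfolding cis_conv_exp by (rule arg_cong)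
qed

lemma norm_diff_fsum_le:
  assumes F: "finite F" "F \<subseteq> \<Omega>"
  shows "norm (f t - fsum F t) \<le> tail F"
proof -
  let ?g = "\<lambda>\<omega>. a \<omega> * cis (- (Re \<omega> * t))"
  have n: "norm (?g \<omega>) = norm (a \<omega>)" for \<omega> by (simp add: norm_mult)
  have abs: "(\<lambda>\<omega>. norm (?g \<omega>)) summable_on \<Omega>" using summable by (simp add: n)
  then have sg: "?g summable_on \<Omega>" by (rule abs_summable_summable)
  have "f t - fsum F t = infsum ?g (\<Omega> - F)"
    using F sg by (subst infsum_Diff) (auto simp: f_eq fsum_def)
  also have "norm \<dots> \<le> infsum (\<lambda>\<omega>. norm (?g \<omega>)) (\<Omega> - F)"
    by (rule norm_infsum_bound) (rule summable_on_subset_banach[OF abs], auto)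
  also have "\<dots> = infsum (\<lambda>\<omega>. norm (a \<omega>)) (\<Omega> - F)" by (simp add: n)
  also have "\<dots> = tail F"
    using F summable by (subst infsum_Diff) (auto simp: tail_def S_def)
  finally show ?thesis .
qed

lemma tail_nonneg: "finite F \<Longrightarrow> F \<subseteq> \<Omega> \<Longrightarrow> tail F \<ge> 0"
  unfolding tail_def S_def using finite_sum_le_infsum[OF summable, of F] by simp

lemma exists_small_tail:
  assumes E: "finite E" "E \<subseteq> \<Omega>" and e: "e > 0"
  obtains F where "finite F" "E \<subseteq> F" "F \<subseteq> \<Omega>" "tail F < e"
proof -
  have "((\<lambda>\<omega>. norm (a \<omega>)) has_sum S) \<Omega>" unfolding S_def by (rule has_sum_infsum[OF summable])
  then have "\<forall>\<^sub>F F in finite_subsets_at_top \<Omega>. dist (\<Sum>\<omega>\<in>F. norm (a \<omega>)) S < e"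
    unfolding has_sum_def using e by (rule tendstoD)
  then obtain X where X: "finite X" "X \<subseteq> \<Omega>" "\<forall>F. finite F \<and> X \<subseteq> F \<and> F \<subseteq> \<Omega> \<longrightarrow> dist (\<Sum>\<omega>\<in>F. norm (a \<omega>)) S < e"
    by (auto simp only: eventually_finite_subsets_at_top)
  have "dist (\<Sum>\<omega>\<in>X \<union> E. norm (a \<omega>)) S < e" using X E by auto
  then have "tail (X \<union> E) < e" by (simp add: tail_def dist_real_def)
  then show thesis using X E by (intro that[of "X \<union> E"]) auto
qed

lemma S_nonneg: "S \<ge> 0"
  unfolding S_def by (rule infsum_nonneg) auto

lemma norm_f_le: "norm (f t) \<le> S"
  using norm_diff_fsum_le[of "{}" t] by (simp add: fsum_def tail_def)



text \<open>Five frequencies fixed once and contained in every truncation \<open>F n\<close>, so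
  that the decay estimate is uniform in \<open>n\<close>.\<close>

definition E :: "complex set" where "E = (SOME E. finite E \<and> E \<subseteq> \<Omega> \<and> card E = 5)"

lemma E_spec: "finite E" "E \<subseteq> \<Omega>" "card E = 5"
proof -
  have "\<exists>E. finite E \<and> E \<subseteq> \<Omega> \<and> card E = 5"
  proof (cases "finite \<Omega>")
    case True
    with card_ge_5 have "5 \<le> card \<Omega>" by simp
    from obtain_subset_with_card_n[OF this] show ?thesis by blast
  next
    case False
    from infinite_arbitrarily_large[OF this] show ?thesis by blast
  qed
  from someI_ex[OF this] show "finite E" "E \<subseteq> \<Omega>" "card E = 5" unfolding E_def by auto
qed

definition F :: "nat \<Rightarrow> complex set" where
  "F n = (SOME F. finite F \<and> E \<subseteq> F \<and> F \<subseteq> \<Omega> \<and> tail F < inverse (real (Suc n)))"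

lemma F_spec: "finite (F n)" "E \<subseteq> F n" "F n \<subseteq> \<Omega>" "tail (F n) < inverse (real (Suc n))"
proof -
  have "\<exists>F. finite F \<and> E \<subseteq> F \<and> F \<subseteq> \<Omega> \<and> tail F < inverse (real (Suc n))"
    using exists_small_tail[OF E_spec(1,2), of "inverse (real (Suc n))"] by (metis inverse_positive_iff_positive of_nat_0_less_iff zero_less_Suc)
  from someI_ex[OF this] show "finite (F n)" "E \<subseteq> F n" "F n \<subseteq> \<Omega>" "tail (F n) < inverse (real (Suc n))"
    unfolding F_def by auto
qed

lemma rat_indep_frequencies: "finite G \<Longrightarrow> G \<subseteq> \<Omega> \<Longrightarrow> rat_indep G Re"
  using lin_indep_over_rat_imp_rat_indep[OF indep real_freq] .

lemma uniform_limit_fsum: "uniform_limit UNIV (\<lambda>n. fsum (F n)) f sequentially"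
proof (rule uniform_limitI)
  fix e :: real assume "e > 0"
  then have "\<forall>\<^sub>F n in sequentially. inverse (real (Suc n)) < e"
    using LIMSEQ_inverse_real_of_nat by (rule order_tendstoD(2)[rotated])
  then show "\<forall>\<^sub>F n in sequentially. \<forall>t\<in>UNIV. dist (fsum (F n) t) (f t) < e"
  proof eventually_elim
    case (elim n)
    show ?case
    proof
      fix t :: real
      have "dist (fsum (F n) t) (f t) \<le> tail (F n)"
        using norm_diff_fsum_le[OF F_spec(1,3)] by (simp add: dist_norm norm_minus_commute)
      then show "dist (fsum (F n) t) (f t) < e" using F_spec(4)[of n] elim by linarith
    qed
  qed
qed

lemma continuous_fsum: "continuous_on UNIV (fsum G)"
  unfolding fsum_def by (intro continuous_intros)

lemma continuous_f: "continuous_on UNIV f"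
  using uniform_limit_theorem[OF _ uniform_limit_fsum] continuous_fsum by simp

section \<open>Characteristic function of the limit law, a product of Bessel functions of order
  0\<close>

definition J :: "real \<Rightarrow> complex" where "J s = circle_mean (\<lambda>x. cis (s * cos x))"

lemma has_mean_cis_fsum:
  assumes "finite G" "G \<subseteq> \<Omega>"
  shows "has_mean (\<lambda>t. cis (z \<bullet> fsum G t)) (\<Prod>\<omega>\<in>G. J (norm z * norm (a \<omega>)))"
proof -
  have "cis (z \<bullet> fsum G t) = (\<Prod>\<omega>\<in>G. cis (norm z * norm (a \<omega>) * cos (Re \<omega> * t - Arg (cnj z * a \<omega>))))" for t
    by (simp add: fsum_def inner_sum_right inner_mult_cis prod_cis assms)
  then show ?thesis unfolding J_def
    using has_mean_prod_cis_cos[OF assms(1) rat_indep_frequencies[OF assms]] by simp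
qed

lemma char_limit_exists:
  "\<exists>m. (\<lambda>n. \<Prod>\<omega>\<in>F n. J (norm z * norm (a \<omega>))) \<longlonglongrightarrow> m \<and> has_mean (\<lambda>t. cis (z \<bullet> f t)) m"
proof (rule has_mean_uniform_limit_exists)
  show "has_mean (\<lambda>t. cis (z \<bullet> fsum (F n) t)) (\<Prod>\<omega>\<in>F n. J (norm z * norm (a \<omega>)))" for n
    by (intro has_mean_cis_fsum F_spec)
  show "continuous_on UNIV (\<lambda>t. cis (z \<bullet> fsum (F n) t))" for n
    by (intro continuous_intros continuous_fsum)
  show "uniform_limit UNIV (\<lambda>n t. cis (z \<bullet> fsum (F n) t)) (\<lambda>t. cis (z \<bullet> f t)) sequentially"
  proof (rule uniform_limitI)
    fix e :: real assume "e > 0"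
    then have "e / (norm z + 1) > 0" by (intro divide_pos_pos) (auto intro: add_nonneg_pos)
    from uniform_limitD[OF uniform_limit_fsum this]
    show "\<forall>\<^sub>F n in sequentially. \<forall>t\<in>UNIV. dist (cis (z \<bullet> fsum (F n) t)) (cis (z \<bullet> f t)) < e"
    proof eventually_elim
      case (elim n)
      show ?case
      proof
        fix t :: real
        have "dist (cis (z \<bullet> fsum (F n) t)) (cis (z \<bullet> f t)) \<le> \<bar>z \<bullet> (fsum (F n) t - f t)\<bar>"
          unfolding dist_norm inner_diff_right by (rule norm_cis_diff_le)
        also have "\<dots> \<le> norm z * norm (fsum (F n) t - f t)" by (rule Cauchy_Schwarz_ineq2)
        also have "\<dots> \<le> (norm z + 1) * norm (fsum (F n) t - f t)" by (intro mult_right_mono) auto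
        also have "norm (fsum (F n) t - f t) < e / (norm z + 1)" using elim by (simp add: dist_norm)
        then have "(norm z + 1) * norm (fsum (F n) t - f t) < e"
          by (subst (asm) pos_less_divide_eq) (auto intro: add_nonneg_pos simp: mult.commute)
        finally show "dist (cis (z \<bullet> fsum (F n) t)) (cis (z \<bullet> f t)) < e" .
      qed
    qed
  qed
qed

text \<open>The infinite product, taken along the exhausting sets \<open>F n\<close>;
  \<open>char_limit_exists\<close> shows that the limit exists and equals the mean of
  \<open>cis (z \<bullet> f t)\<close>.\<close>

definition \<psi> :: "complex \<Rightarrow> complex" where
  "\<psi> z = lim (\<lambda>n. \<Prod>\<omega>\<in>F n. J (norm z * norm (a \<omega>)))"

lemma \<psi>_tendsto: "(\<lambda>n. \<Prod>\<omega>\<in>F n. J (norm z * norm (a \<omega>))) \<longlonglongrightarrow> \<psi> z"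
  and has_mean_\<psi>: "has_mean (\<lambda>t. cis (z \<bullet> f t)) (\<psi> z)"
  using char_limit_exists[of z] by (auto simp: \<psi>_def limI)

text \<open>The five factors over \<open>E\<close> each decay like the power -1/2 and all others are
  at most 1 in modulus, so the bound holds for every finite product and passes to the limit.\<close>

lemma \<psi>_decay: "\<exists>C. \<forall>z. norm (\<psi> z) \<le> C * (1 + norm z) powr (- (5 / 2))"
proof -
  \<comment> \<open>Including 1 in the minimum gives
    \<open>c * (1 + norm z) \<le> 1 + norm z * norm (a \<omega>)\<close>, which brings all five
    factors to the common base \<open>1 + norm z\<close>.\<close>
  define c where "c = Min (insert 1 ((\<lambda>\<omega>. norm (a \<omega>)) ` E))"
  have c: "c > 0" "c \<le> 1" "\<And>\<omega>. \<omega> \<in> E \<Longrightarrow> c \<le> norm (a \<omega>)"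
    unfolding c_def using E_spec nz by (auto simp: subset_iff)
  have J_le: "norm (J (norm z * norm (a \<omega>))) \<le> 9 / sqrt c * (1 + norm z) powr (- (1 / 2))" if "\<omega> \<in> E" for \<omega> and z :: complex
  proof -
    have "c * (1 + norm z) \<le> 1 + norm z * norm (a \<omega>)"
      using c(2) mult_left_mono[OF c(3)[OF that], of "norm z"] by (simp add: algebra_simps)
    then have "sqrt c * sqrt (1 + norm z) \<le> sqrt (1 + norm z * norm (a \<omega>))"
      by (simp flip: real_sqrt_mult)
    moreover have "0 < sqrt c * sqrt (1 + norm z)" using c by (auto intro!: mult_pos_pos add_pos_nonneg)
    ultimately have "9 / sqrt (1 + norm z * norm (a \<omega>)) \<le> 9 / (sqrt c * sqrt (1 + norm z))"
      by (intro divide_left_mono mult_pos_pos) (use c in \<open>auto intro: add_pos_nonneg\<close>)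
    also have "\<dots> = 9 / sqrt c * (1 + norm z) powr (- (1 / 2))"
    proof -
      have "(1 + norm z) powr (- (1 / 2)) = 1 / sqrt (1 + norm z)"
        by (simp add: powr_minus_divide powr_half_sqrt)
      then show ?thesis by simp
    qed
    finally show ?thesis
      using circle_mean_cis_cos_decay[of "norm z * norm (a \<omega>)"] by (simp add: J_def)
  qed
  have "norm (\<Prod>\<omega>\<in>F n. J (norm z * norm (a \<omega>))) \<le> (9 / sqrt c) ^ 5 * (1 + norm z) powr (- (5 / 2))" for n and z :: complex
  proof -
    have "norm (\<Prod>\<omega>\<in>F n. J (norm z * norm (a \<omega>))) = 
      (\<Prod>\<omega>\<in>F n - E. norm (J (norm z * norm (a \<omega>)))) * (\<Prod>\<omega>\<in>E. norm (J (norm z * norm (a \<omega>))))"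
      using prod.subset_diff[OF F_spec(2) F_spec(1)] by (simp flip: prod_norm)
    also have "\<dots> \<le> 1 * (\<Prod>\<omega>\<in>E. 9 / sqrt c * (1 + norm z) powr (- (1 / 2)))"
      using J_le by (intro mult_mono prod_le_1 prod_mono) 
        (auto simp: J_def circle_mean_cis_cos_le_1 intro!: prod_nonneg)
    also have "\<dots> = (9 / sqrt c) ^ 5 * ((1 + norm z) powr (- (1 / 2))) ^ 5"
      by (simp only: prod_constant E_spec power_mult_distrib mult_1)
    also have "((1 + norm z) powr (- (1 / 2))) ^ 5 = (1 + norm z) powr (- (5 / 2))"
      by (simp add: powr_power add_nonneg_eq_0_iff)
    finally show ?thesis .
  qed
  then have "norm (\<psi> z) \<le> (9 / sqrt c) ^ 5 * (1 + norm z) powr (- (5 / 2))" for z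
    by (intro LIMSEQ_le_const2[OF tendsto_norm[OF \<psi>_tendsto]]) auto
  then show ?thesis by blast
qed

text \<open>Replacing \<open>T\<close> by \<open>max T 1\<close> gives a probability measure for every real \<open>T\<close>.\<close>

definition N :: "real \<Rightarrow> complex measure" where "N T = time_law f (max T 1)"

lemma prob_space_N: "prob_space (N T)"
  unfolding N_def by (rule prob_space_time_law[OF continuous_f]) auto

lemma sets_N: "sets (N T) = sets borel"
  by (simp add: N_def time_law_def)

lemma integral_N:
  fixes g :: "complex \<Rightarrow> 'b::euclidean_space"
  assumes "continuous_on UNIV g"
  shows "(LINT w|N T. g w) = integral {0..max T 1} (\<lambda>t. g (f t)) /\<^sub>R max T 1"
  unfolding N_def by (rule integral_time_law[OF continuous_f _ assms]) auto

lemma integral_N_tendsto_iff: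
  fixes g :: "complex \<Rightarrow> 'b::euclidean_space"
  assumes "continuous_on UNIV g"
  shows "((\<lambda>T. LINT w|N T. g w) \<longlongrightarrow> l) at_top \<longleftrightarrow> ((\<lambda>T. integral {0..T} (\<lambda>t. g (f t)) /\<^sub>R T) \<longlongrightarrow> l) at_top"
proof (rule tendsto_cong)
  show "\<forall>\<^sub>F T in at_top. (LINT w|N T. g w) = integral {0..T} (\<lambda>t. g (f t)) /\<^sub>R T"
    using eventually_ge_at_top[of 1] by eventually_elim (simp add: integral_N[OF assms])
qed

lemma char_N_tendsto: "((\<lambda>T. LINT w|N T. cis (z \<bullet> w)) \<longlongrightarrow> \<psi> z) at_top"
  using has_mean_\<psi>[of z] unfolding has_mean_def
  by (subst integral_N_tendsto_iff) (auto intro!: continuous_intros)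

lemma integrable_\<psi>: "integrable lborel \<psi>"
proof -
  obtain C where C: "\<And>z. norm (\<psi> z) \<le> C * (1 + norm z) powr (- (5 / 2))" using \<psi>_decay by blast
  have "integrable lborel (\<lambda>z::complex. C * (1 + norm z) powr (- (5 / 2)))"
    by (intro integrable_mult_right integrable_powr_norm_complex) auto
  then show ?thesis
  proof (rule Bochner_Integration.integrable_bound)
    \<comment> \<open>Measurability comes from the pointwise limit of the characteristic functions
      of \<open>N n\<close>, each measurable as a parameter integral.\<close>
    have "\<psi> \<in> borel_measurable borel"
    proof (rule borel_measurable_LIMSEQ_metric)
      show "(\<lambda>n. LINT w|N (real n). cis (z \<bullet> w)) \<longlonglongrightarrow> \<psi> z" for z
        by (rule filterlim_compose[OF char_N_tendsto filterlim_real_sequentially])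
      fix n
      interpret prob_space "N (real n)" by (rule prob_space_N)
      note [measurable_cong] = sets_N
      have [measurable]: "cis \<in> borel_measurable borel"
        by (intro borel_measurable_continuous_onI continuous_intros)
      show "(\<lambda>z. LINT w|N (real n). cis (z \<bullet> w)) \<in> borel_measurable borel" by measurable
    qed
    then show "\<psi> \<in> borel_measurable lborel" by simp
  qed (auto intro!: order_trans[OF C abs_ge_self])
qed

sublocale planar_char_limit N \<psi>
  by (rule planar_char_limit.intro) (rule prob_space_N sets_N char_N_tendsto integrable_\<psi>)+

text \<open>The density with respect to \<open>du dv\<close>; the function of the theorem is
  \<open>2 * pi\<close> times this.\<close>

definition \<rho> :: "complex \<Rightarrow> real" where "\<rho> = fourier_density \<psi>"

lemma \<rho>_nonneg: "\<rho> w \<ge> 0"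
  unfolding \<rho>_def by (rule density_nonneg)

lemma continuous_\<rho>: "continuous_on UNIV \<rho>"
  unfolding \<rho>_def by (rule continuous_on_fourier_density[OF integrable_\<psi>])

lemma \<rho>_measurable [measurable]: "\<rho> \<in> borel_measurable borel"
  by (rule borel_measurable_continuous_onI[OF continuous_\<rho>])

lemma \<rho>_bound: "\<exists>C>0. \<forall>w. \<rho> w \<le> C"
proof -
  let ?K = "(LINT z|lborel. norm (\<psi> z)) / (4 * pi\<^sup>2)"
  \<comment> \<open>The maximum with 1 keeps the bound positive, as it later serves as a
    divisor.\<close>
  have "\<rho> w \<le> max ?K 1" for w
    using order_trans[OF abs_ge_self fourier_density_le[OF integrable_\<psi>]] by (simp add: \<rho>_def le_max_iff_disj)
  then show ?thesis by (intro exI[of _ "max ?K 1"]) auto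
qed

lemma \<rho>_outside: "norm w > S \<Longrightarrow> \<rho> w = 0"
  unfolding \<rho>_def
proof (rule density_outside_support)
  show "AE w in N T. norm w \<le> S" for T
    unfolding N_def by (rule AE_time_law[OF continuous_f]) (auto simp: norm_f_le)
qed

section \<open>Time averages of Lipschitz and of Riemann integrable test functions\<close>

lemma time_average_tendsto_lipschitz:
  fixes \<phi> :: "complex \<Rightarrow> real"
  assumes lip: "L-lipschitz_on UNIV \<phi>" and supp: "\<And>w. norm w > R \<Longrightarrow> \<phi> w = 0"
  shows "((\<lambda>T. integral {0..T} (\<lambda>t. \<phi> (f t)) /\<^sub>R T) \<longlongrightarrow> (LINT w|lborel. \<phi> w * \<rho> w)) at_top"
  using integral_tendsto_density[OF assms] 
  by (subst integral_N_tendsto_iff[OF lipschitz_on_continuous_on[OF lip], symmetric]) (simp add: \<rho>_def)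

text \<open>A tent over the disc of radius \<open>S\<close> is 1 along the whole curve
  \<open>f\<close>, so its averages are 1 for \<open>T > 0\<close>; in the limit integral it may be
  dropped because \<open>\<rho>\<close> vanishes off the disc.\<close>

lemma integral_\<rho>: "(LINT w|lborel. \<rho> w) = 1"
proof -
  have "((\<lambda>T. integral {0..T} (\<lambda>t. tent 1 (cball 0 S) (f t)) /\<^sub>R T) \<longlongrightarrow> (LINT w|lborel. tent 1 (cball 0 S) w * \<rho> w)) at_top"
    using S_nonneg by (intro time_average_tendsto_lipschitz[OF tent_lipschitz, of "S + 1"] tent_eq_0) auto
  moreover have "tent 1 (cball 0 S) (f t) = 1" for t
    using norm_f_le[of t] by (simp add: tent_def)
  moreover have "\<forall>\<^sub>F T in at_top. integral {0..T} (\<lambda>t. 1) /\<^sub>R T = (1 :: real)"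
    using eventually_gt_at_top[of 0] by eventually_elim simp
  then have "((\<lambda>T. integral {0..T} (\<lambda>t. 1 :: real) /\<^sub>R T) \<longlongrightarrow> 1) at_top"
    by (rule tendsto_eventually)
  ultimately have "(LINT w|lborel. tent 1 (cball 0 S) w * \<rho> w) = 1"
    by (auto intro: tendsto_unique[rotated])
  moreover have "tent 1 (cball 0 S) w * \<rho> w = \<rho> w" for w
    using \<rho>_outside[of w] by (cases "norm w \<le> S") (auto simp: tent_def)
  ultimately show ?thesis by (simp only:)
qed

text \<open>Only the upper half of the squeeze: a Lipschitz majorant of \<open>h\<close> on the box
  has convergent averages, and the curve never leaves the box.\<close>

lemma time_average_upper:
  assumes h: "h riemann_integrable_on cbox u v" and B: "cball 0 S \<subseteq> cbox u v" and nzB: "measure lborel (cbox u v) \<noteq> 0"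
  shows "integrable lebesgue (\<lambda>w. \<rho> w * h w)"
    and "(\<And>T. T > 0 \<Longrightarrow> (\<lambda>t. h (f t)) integrable_on {0..T}) \<Longrightarrow> e > 0 \<Longrightarrow>
      \<forall>\<^sub>F T in at_top. integral {0..T} (\<lambda>t. h (f t)) /\<^sub>R T < (LINT w|lebesgue. \<rho> w * h w) + e"
proof -
  let ?B = "cbox u v"
  obtain c where c: "\<And>x. x \<in> ?B \<Longrightarrow> \<bar>h x\<bar> \<le> c"
    using riemann_integrable_bounded[OF h nzB] by (auto simp: bounded_iff)
  have abs_h: "h absolutely_integrable_on ?B"
    by (rule absolutely_integrable_integrable_bound[where g = "\<lambda>_. c"])
       (use c riemann_integrable_integral(1)[OF h] in auto)
  obtain C where C: "C > 0" "\<And>w. \<rho> w \<le> C" using \<rho>_bound by blast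
  \<comment> \<open>A Riemann integrable \<open>h\<close> is Lebesgue but perhaps not Borel
    measurable, hence the passage to the completion.\<close>
  have [measurable]: "\<rho> \<in> borel_measurable lebesgue"
    using measurable_completion[of \<rho> lborel borel] by simp
  have \<rho>B: "\<rho> w * g w = \<rho> w * (indicator ?B w * g w)" for w and g :: "complex \<Rightarrow> real"
    using \<rho>_outside[of w] B by (cases "w \<in> ?B") (auto simp: subset_iff not_le[symmetric])
  have int: "integrable lebesgue (\<lambda>w. \<rho> w * g w)" if g: "g absolutely_integrable_on ?B" for g
  proof (subst \<rho>B, rule Bochner_Integration.integrable_bound)
    have gi: "integrable lebesgue (\<lambda>w. indicator ?B w * g w)" using g by (simp add: set_integrable_def)
    then show "integrable lebesgue (\<lambda>w. C * (indicator ?B w * g w))" by simp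
    from gi have [measurable]: "(\<lambda>w. indicator ?B w * g w) \<in> borel_measurable lebesgue" by (rule borel_measurable_integrable)
    show "(\<lambda>w. \<rho> w * (indicator ?B w * g w)) \<in> borel_measurable lebesgue" by measurable
    have "\<bar>\<rho> w\<bar> \<le> \<bar>C\<bar>" for w using C \<rho>_nonneg[of w] by simp
    then show "AE w in lebesgue. norm (\<rho> w * (indicator ?B w * g w)) \<le> norm (C * (indicator ?B w * g w))"
      by (auto simp: abs_mult intro!: mult_right_mono)
  qed
  show "integrable lebesgue (\<lambda>w. \<rho> w * h w)" by (rule int[OF abs_h])
  show "\<forall>\<^sub>F T in at_top. integral {0..T} (\<lambda>t. h (f t)) /\<^sub>R T < (LINT w|lebesgue. \<rho> w * h w) + e"
    if hT: "\<And>T. T > 0 \<Longrightarrow> (\<lambda>t. h (f t)) integrable_on {0..T}" and e: "e > 0"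
  proof -
    \<comment> \<open>\<open>\<rho>\<close> is at most \<open>C\<close> and
      \<open>\<phi> - h\<close> is nonnegative on the box, so an excess of
      \<open>e / (2 * C)\<close> in area becomes at most \<open>e / 2\<close> after weighting; this
      leaves a strict inequality.\<close>
    have e': "e / (2 * C) > 0" using e C by simp
    obtain \<phi> L R where
      \<phi>: "L-lipschitz_on UNIV \<phi>" "\<And>x. norm x > R \<Longrightarrow> \<phi> x = 0" "\<And>x. x \<in> ?B \<Longrightarrow> h x \<le> \<phi> x"
        "integral ?B \<phi> \<le> integral ?B h + e / (2 * C)"
      by (rule riemann_integrable_upper_approx[OF h nzB e']) (rule that)
    have cont: "continuous_on A \<phi>" for A
      using lipschitz_on_continuous_on[OF \<phi>(1)] continuous_on_subset by blast
    have [measurable]: "\<phi> \<in> borel_measurable borel" by (rule borel_measurable_continuous_onI[OF cont])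
    have abs_\<phi>: "\<phi> absolutely_integrable_on ?B"
      by (rule absolutely_integrable_continuous[OF cont])
    have abs_d: "(\<lambda>w. \<phi> w - h w) absolutely_integrable_on ?B" by (rule set_integral_diff(1)[OF abs_\<phi> abs_h])
    have "(LINT w|lborel. \<phi> w * \<rho> w) = (LINT w|lebesgue. \<rho> w * \<phi> w)"
      by (subst integral_completion) (simp_all add: mult.commute)
    also have "\<dots> = (LINT w|lebesgue. \<rho> w * h w) + (LINT w|lebesgue. \<rho> w * (\<phi> w - h w))"
      using int[OF abs_\<phi>] int[OF abs_h] by (simp add: right_diff_distrib)
    also have "(LINT w|lebesgue. \<rho> w * (\<phi> w - h w)) \<le> (LINT w|lebesgue. C * (indicator ?B w * (\<phi> w - h w)))"
    proof (rule integral_mono)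
      show "integrable lebesgue (\<lambda>w. C * (indicator ?B w * (\<phi> w - h w)))"
        using abs_d by (simp add: set_integrable_def)
      show "\<rho> w * (\<phi> w - h w) \<le> C * (indicator ?B w * (\<phi> w - h w))" for w
        by (subst \<rho>B, intro mult_right_mono C) (auto simp: indicator_def \<phi>(3))
    qed (rule int[OF abs_d])
    also have "\<dots> = C * integral ?B (\<lambda>w. \<phi> w - h w)"
      using set_lebesgue_integral_eq_integral(2)[OF abs_d] by (simp add: set_lebesgue_integral_def)
    also have "integral ?B (\<lambda>w. \<phi> w - h w) = integral ?B \<phi> - integral ?B h"
      using abs_\<phi> abs_h by (intro Henstock_Kurzweil_Integration.integral_diff) (auto dest: set_lebesgue_integral_eq_integral(1))
    also have "C * \<dots> \<le> C * (e / (2 * C))" using \<phi>(4) C by (intro mult_left_mono) auto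
    also have "\<dots> = e / 2" using C by simp
    finally have "(LINT w|lborel. \<phi> w * \<rho> w) < (LINT w|lebesgue. \<rho> w * h w) + e" using e by simp
    with time_average_tendsto_lipschitz[OF \<phi>(1,2)]
    have "\<forall>\<^sub>F T in at_top. integral {0..T} (\<lambda>t. \<phi> (f t)) /\<^sub>R T < (LINT w|lebesgue. \<rho> w * h w) + e"
      by (rule order_tendstoD(2)) auto
    then show ?thesis using eventually_gt_at_top[of 0]
    proof eventually_elim
      case (elim T)
      have "f t \<in> ?B" for t using B norm_f_le[of t] by auto
      then have "integral {0..T} (\<lambda>t. h (f t)) \<le> integral {0..T} (\<lambda>t. \<phi> (f t))"
        by (intro integral_le hT elim integrable_continuous_real continuous_on_compose2[OF cont[of UNIV]]
          continuous_on_subset[OF continuous_f] \<phi>) auto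
      then have "integral {0..T} (\<lambda>t. h (f t)) /\<^sub>R T \<le> integral {0..T} (\<lambda>t. \<phi> (f t)) /\<^sub>R T"
        using elim by (simp add: mult_left_mono)
      then show ?case using elim by linarith
    qed
  qed
qed

text \<open>The upper estimate applied to \<open>h\<close> and to \<open>- h\<close>.\<close>

lemma time_average_tendsto_real:
  assumes h: "h riemann_integrable_on cbox u v" and B: "cball 0 S \<subseteq> cbox u v" and nzB: "measure lborel (cbox u v) \<noteq> 0"
    and hT: "\<And>T. T > 0 \<Longrightarrow> (\<lambda>t. h (f t)) integrable_on {0..T}"
  shows "((\<lambda>T. integral {0..T} (\<lambda>t. h (f t)) /\<^sub>R T) \<longlongrightarrow> (LINT w|lebesgue. \<rho> w * h w)) at_top"
proof (rule order_tendstoI)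
  fix y assume "y > (LINT w|lebesgue. \<rho> w * h w)"
  with time_average_upper(2)[OF h B nzB hT, of "y - (LINT w|lebesgue. \<rho> w * h w)"]
  show "\<forall>\<^sub>F T in at_top. integral {0..T} (\<lambda>t. h (f t)) /\<^sub>R T < y" by simp
next
  fix y assume y: "y < (LINT w|lebesgue. \<rho> w * h w)"
  have "(\<lambda>x. - h x) riemann_integrable_on cbox u v"
    by (rule riemann_integrable_on_linear[OF h]) (rule bounded_linear_minus[OF bounded_linear_ident])
  from time_average_upper(2)[OF this B nzB, of "(LINT w|lebesgue. \<rho> w * h w) - y"] y hT
  show "\<forall>\<^sub>F T in at_top. y < integral {0..T} (\<lambda>t. h (f t)) /\<^sub>R T"
    by (simp add: integrable_neg)
qed

lemma time_average_tendsto: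
  assumes \<Phi>: "locally_riemann_integrable \<Phi>"
  shows "integrable lebesgue (\<lambda>w. complex_of_real (\<rho> w) * \<Phi> w)"
    and "(\<And>T. T > 0 \<Longrightarrow> (\<lambda>t. \<Phi> (f t)) integrable_on {0..T}) \<Longrightarrow>
      ((\<lambda>T. integral {0..T} (\<lambda>t. \<Phi> (f t)) /\<^sub>R T) \<longlongrightarrow> (LINT w|lebesgue. complex_of_real (\<rho> w) * \<Phi> w)) at_top"
proof -
  define v where "v = Complex (S + 1) (S + 1)"
  have B: "cball 0 S \<subseteq> cbox (- v) v"
  proof
    fix w :: complex assume "w \<in> cball 0 S"
    then show "w \<in> cbox (- v) v"
      using abs_Re_le_cmod[of w] abs_Im_le_cmod[of w] by (auto simp: in_cbox_complex_iff v_def)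
  qed
  have nzB: "measure lborel (cbox (- v) v) \<noteq> 0"
    using S_nonneg by (auto simp: content_eq_0 v_def Basis_complex_def inner_complex_def)
  have R: "\<Phi> riemann_integrable_on cbox (- v) v" using \<Phi> by (simp add: locally_riemann_integrable_def)
  have Re: "(\<lambda>w. Re (\<Phi> w)) riemann_integrable_on cbox (- v) v" 
    and Im: "(\<lambda>w. Im (\<Phi> w)) riemann_integrable_on cbox (- v) v"
    using riemann_integrable_on_linear[OF R bounded_linear_Re] riemann_integrable_on_linear[OF R bounded_linear_Im] by auto
  have eq: "complex_of_real (\<rho> w) * \<Phi> w = of_real (\<rho> w * Re (\<Phi> w)) + \<i> * of_real (\<rho> w * Im (\<Phi> w))" for w
    by (simp add: complex_eq_iff)
  note iRe = time_average_upper(1)[OF Re B nzB] and iIm = time_average_upper(1)[OF Im B nzB]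
  show "integrable lebesgue (\<lambda>w. complex_of_real (\<rho> w) * \<Phi> w)"
    unfolding eq using iRe iIm by (intro Bochner_Integration.integrable_add integrable_of_real integrable_mult_right)
  have LINT: "(LINT w|lebesgue. complex_of_real (\<rho> w) * \<Phi> w) = 
    of_real (LINT w|lebesgue. \<rho> w * Re (\<Phi> w)) + \<i> * of_real (LINT w|lebesgue. \<rho> w * Im (\<Phi> w))"
    unfolding eq using iRe iIm
    by (simp only: Bochner_Integration.integral_add integrable_of_real integrable_mult_right
        integral_mult_right_zero integral_complex_of_real)
  assume T: "\<And>T. T > 0 \<Longrightarrow> (\<lambda>t. \<Phi> (f t)) integrable_on {0..T}"
  have ReT: "(\<lambda>t. Re (\<Phi> (f t))) integrable_on {0..T}" "integral {0..T} (\<lambda>t. Re (\<Phi> (f t))) = Re (integral {0..T} (\<lambda>t. \<Phi> (f t)))"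
    and ImT: "(\<lambda>t. Im (\<Phi> (f t))) integrable_on {0..T}" "integral {0..T} (\<lambda>t. Im (\<Phi> (f t))) = Im (integral {0..T} (\<lambda>t. \<Phi> (f t)))"
    if "T > 0" for T
    using integrable_linear[OF T[OF that] bounded_linear_Re] integral_linear[OF T[OF that] bounded_linear_Re]
      integrable_linear[OF T[OF that] bounded_linear_Im] integral_linear[OF T[OF that] bounded_linear_Im]
    by (simp_all add: o_def)
  have ev: "\<forall>\<^sub>F T in at_top. integral {0..T} (\<lambda>t. \<Phi> (f t)) /\<^sub>R T = 
    of_real (integral {0..T} (\<lambda>t. Re (\<Phi> (f t))) /\<^sub>R T) + \<i> * of_real (integral {0..T} (\<lambda>t. Im (\<Phi> (f t))) /\<^sub>R T)"
    using eventually_gt_at_top[of 0] by eventually_elim (simp add: ReT ImT complex_eq_iff field_simps power2_eq_square)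
  show "((\<lambda>T. integral {0..T} (\<lambda>t. \<Phi> (f t)) /\<^sub>R T) \<longlongrightarrow> (LINT w|lebesgue. complex_of_real (\<rho> w) * \<Phi> w)) at_top"
    unfolding LINT tendsto_cong[OF ev]
    by (intro tendsto_intros time_average_tendsto_real[OF Re B nzB] time_average_tendsto_real[OF Im B nzB] ReT ImT)
qed

text \<open>The product of the Fejer-type kernels \<open>((1 + cos x) / 2) ^ n\<close> has mean at least \<open>(1 / (2 n)) ^ k\<close>,
  but it is exponentially small away from the resonant times; so these have positive density.\<close>

lemma \<rho>_positive_near:
  assumes G: "finite G" "G \<noteq> {}" "G \<subseteq> \<Omega>" and u: "\<And>\<omega>. \<omega> \<in> G \<Longrightarrow> norm (u \<omega>) = 1"
    and w: "w = (\<Sum>\<omega>\<in>G. of_real (norm (a \<omega>)) * u \<omega>)" and e: "e > 0" and tail: "tail G < e / 4"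
  shows "\<exists>y. dist y w < e \<and> \<rho> y \<noteq> 0"
proof (rule ccontr)
  assume "\<not> ?thesis"
  then have zero: "\<And>y. dist y w < e \<Longrightarrow> \<rho> y = 0" by blast
  \<comment> \<open>A Lipschitz bump supported where \<open>\<rho>\<close> is assumed to vanish, so
    its time average tends to 0; the kernels will contradict this.\<close>
  define \<phi> :: "complex \<Rightarrow> real" where "\<phi> y = max 0 (1 - dist y w / e)" for y
  have lip: "(1 / e)-lipschitz_on UNIV \<phi>"
  proof (rule lipschitz_onI)
    fix x y :: complex
    have "\<bar>dist x w - dist y w\<bar> \<le> dist x y"       using dist_triangle[of x w y] dist_triangle[of y w x] by (simp add: dist_commute abs_le_iff)
    then have "\<bar>dist x w - dist y w\<bar> / e \<le> dist x y / e" using e by (intro divide_right_mono) auto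
    moreover have "\<bar>dist x w / e - dist y w / e\<bar> = \<bar>dist x w - dist y w\<bar> / e" using e by (simp flip: diff_divide_distrib)
    ultimately show "dist (\<phi> x) (\<phi> y) \<le> 1 / e * dist x y"
      unfolding \<phi>_def dist_real_def by (auto simp: max_def)
  qed (use e in auto)
  have \<phi>0: "\<phi> y = 0" if "dist y w \<ge> e" for y using that e by (simp add: \<phi>_def field_simps)
  have "\<phi> y = 0" if "norm y > norm w + e" for y
    using that norm_triangle_ineq2[of y w] by (intro \<phi>0) (simp add: dist_norm)
  from time_average_tendsto_lipschitz[OF lip this]
  have "((\<lambda>T. integral {0..T} (\<lambda>t. \<phi> (f t)) /\<^sub>R T) \<longlongrightarrow> (LINT y|lborel. \<phi> y * \<rho> y)) at_top" by blast
  moreover have "\<phi> y * \<rho> y = 0" for y using \<phi>0[of y] zero[of y] by (cases "dist y w < e") auto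
  ultimately have avg0: "((\<lambda>T. integral {0..T} (\<lambda>t. \<phi> (f t)) /\<^sub>R T) \<longlongrightarrow> 0) at_top" by simp
  \<comment> \<open>The phase at which the rotating arm
    \<open>a \<omega> * cis (- (Re \<omega> * t))\<close> points along \<open>u \<omega>\<close>;
    \<open>c \<omega> t\<close> equals 1 exactly at such times, and
    \<open>sqrt (1 - c \<omega> t)\<close> measures the misalignment.\<close>
  define \<theta> where "\<theta> \<omega> = Arg (a \<omega>) - Arg (u \<omega>)" for \<omega>
  define c where "c \<omega> t = (1 + cos (Re \<omega> * t - \<theta> \<omega>)) / 2" for \<omega> t
  have c01: "0 \<le> c \<omega> t" "c \<omega> t \<le> 1" for \<omega> t
    using cos_ge_minus_one[of "Re \<omega> * t - \<theta> \<omega>"] cos_le_one[of "Re \<omega> * t - \<theta> \<omega>"] by (auto simp: c_def simp del: cos_ge_minus_one cos_le_one)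
  have dist_term: "norm (a \<omega> * cis (- (Re \<omega> * t)) - of_real (norm (a \<omega>)) * u \<omega>) = norm (a \<omega>) * (2 * sqrt (1 - c \<omega> t))"
    if "\<omega> \<in> G" for \<omega> t
  proof -
    let ?x = "Re \<omega> * t - \<theta> \<omega>"
    have "a \<omega> = of_real (norm (a \<omega>)) * cis (Arg (a \<omega>))"
      using rcis_cmod_Arg[of "a \<omega>"] by (simp add: rcis_def)
    moreover have "u \<omega> = cis (Arg (u \<omega>))"
      using rcis_cmod_Arg[of "u \<omega>"] u[OF that] by (simp add: rcis_def)
    ultimately have "a \<omega> * cis (- (Re \<omega> * t)) - of_real (norm (a \<omega>)) * u \<omega> = 
      of_real (norm (a \<omega>)) * cis (Arg (u \<omega>)) * (cis (- ?x) - 1)"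
    proof -
      assume *: "a \<omega> = of_real (norm (a \<omega>)) * cis (Arg (a \<omega>))" "u \<omega> = cis (Arg (u \<omega>))"
      have "cis (Arg (a \<omega>)) * cis (- (Re \<omega> * t)) = cis (Arg (u \<omega>)) * cis (- ?x)"
        by (simp add: cis_mult \<theta>_def)
      then have "a \<omega> * cis (- (Re \<omega> * t)) = of_real (norm (a \<omega>)) * (cis (Arg (u \<omega>)) * cis (- ?x))"
        by (subst *(1)) (simp only: mult.assoc)
      then show ?thesis
        by (subst *(2)) (simp add: right_diff_distrib mult.assoc)
    qed
    then have "norm (a \<omega> * cis (- (Re \<omega> * t)) - of_real (norm (a \<omega>)) * u \<omega>) = norm (a \<omega>) * norm (cis (- ?x) - 1)"
      by (simp add: norm_mult)
    also have "norm (cis (- ?x) - 1) = 2 * sqrt (1 - c \<omega> t)"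
    proof (rule power2_eq_imp_eq)
      have "(norm (cis (- x) - 1))\<^sup>2 = 2 - 2 * cos x" for x
        using sin_cos_squared_add[of x] by (simp add: cmod_power2 power2_diff)
      from this[of ?x] have "(norm (cis (- ?x) - 1))\<^sup>2 = 2 - 2 * cos ?x" .
      also have "\<dots> = 4 * (1 - c \<omega> t)" by (simp add: c_def field_simps)
      also have "\<dots> = (2 * sqrt (1 - c \<omega> t))\<^sup>2" using c01 by (simp add: power_mult_distrib)
      finally show "(norm (cis (- ?x) - 1))\<^sup>2 = (2 * sqrt (1 - c \<omega> t))\<^sup>2" .
    qed (use c01 in auto)
    finally show ?thesis .
  qed
  \<comment> \<open>Admissible misalignment: the arms together then miss \<open>w\<close> by at most
    \<open>2 * S * \<eta> \<le> e / 4\<close>. The minimum with 1 keeps \<open>q\<close>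
    nonnegative.\<close>
  define \<eta> where "\<eta> = min 1 (e / (8 * (S + 1)))"
  have \<eta>: "0 < \<eta>" "\<eta> \<le> 1" "2 * S * \<eta> \<le> e / 4"
  proof -
    show "0 < \<eta>" "\<eta> \<le> 1" using e S_nonneg by (auto simp: \<eta>_def)
    have "2 * S * \<eta> \<le> 2 * (S + 1) * (e / (8 * (S + 1)))"
      using e S_nonneg by (intro mult_mono) (auto simp: \<eta>_def)
    also have "\<dots> = e / 4" using S_nonneg by (simp add: field_simps)
    finally show "2 * S * \<eta> \<le> e / 4" .
  qed
  define q where "q = 1 - \<eta>\<^sup>2"
  have q: "0 \<le> q" "q < 1" using \<eta> by (auto simp: q_def power_le_one)
  \<comment> \<open>Arms and tail each contribute at most \<open>e / 4\<close>, so
    \<open>f t\<close> lies within half the radius of the bump.\<close>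
  have near: "\<phi> (f t) \<ge> 1 / 2" if cq: "\<And>\<omega>. \<omega> \<in> G \<Longrightarrow> c \<omega> t \<ge> q" for t
  proof -
    have "norm (fsum G t - w) = norm (\<Sum>\<omega>\<in>G. a \<omega> * cis (- (Re \<omega> * t)) - of_real (norm (a \<omega>)) * u \<omega>)"
      by (simp add: fsum_def w sum_subtractf)
    also have "\<dots> \<le> (\<Sum>\<omega>\<in>G. norm (a \<omega>) * (2 * sqrt (1 - c \<omega> t)))"
      by (rule sum_norm_le) (simp add: dist_term)
    also have "\<dots> \<le> (\<Sum>\<omega>\<in>G. norm (a \<omega>) * (2 * \<eta>))"
    proof (intro sum_mono mult_left_mono)
      fix \<omega> assume "\<omega> \<in> G"
      then have "1 - c \<omega> t \<le> \<eta>\<^sup>2" using cq[of \<omega>] by (simp add: q_def)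
      then show "sqrt (1 - c \<omega> t) \<le> \<eta>" using \<eta> by (intro real_le_lsqrt) auto
    qed auto
    also have "\<dots> = (\<Sum>\<omega>\<in>G. norm (a \<omega>)) * (2 * \<eta>)" by (simp add: sum_distrib_right)
    also have "\<dots> \<le> S * (2 * \<eta>)" using tail_nonneg[OF G(1,3)] \<eta> by (intro mult_right_mono) (auto simp: tail_def)
    also have "\<dots> \<le> e / 4" using \<eta> by simp
    finally have "norm (fsum G t - w) \<le> e / 4" .
    moreover have "norm (f t - fsum G t) \<le> e / 4" using norm_diff_fsum_le[OF G(1,3), of t] tail by linarith
    ultimately have "dist (f t) w \<le> e / 2"
      using norm_triangle_ineq[of "f t - fsum G t" "fsum G t - w"] by (simp add: dist_norm)
    then have "dist (f t) w / e \<le> 1 / 2" using e by (simp add: field_simps)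
    then show ?thesis unfolding \<phi>_def by linarith
  qed
  \<comment> \<open>Either all arms are aligned, and the product is at most
    \<open>1 \<le> 2 * \<phi> (f t)\<close>, or one factor is below \<open>q ^ n\<close> and the
    others are at most 1.\<close>
  have bound: "(\<Prod>\<omega>\<in>G. c \<omega> t ^ n) \<le> q ^ n + 2 * \<phi> (f t)" for n t
  proof (cases "\<forall>\<omega>\<in>G. c \<omega> t \<ge> q")
    case True
    have "(\<Prod>\<omega>\<in>G. c \<omega> t ^ n) \<le> 1" using c01 by (intro prod_le_1) (auto intro: power_le_one)
    also have "1 \<le> 2 * \<phi> (f t)" using near[of t] True by auto
    finally show ?thesis using q by (simp add: add_increasing)
  next
    case False
    then obtain \<omega> where \<omega>: "\<omega> \<in> G" "c \<omega> t < q" by auto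
    have "(\<Prod>\<omega>\<in>G. c \<omega> t ^ n) = c \<omega> t ^ n * (\<Prod>\<omega>\<in>G - {\<omega>}. c \<omega> t ^ n)"
      using G(1) \<omega>(1) by (rule prod.remove)
    also have "\<dots> \<le> q ^ n * 1"
      using c01 \<omega> q by (intro mult_mono power_mono prod_le_1) (auto intro: power_le_one prod_nonneg)
    finally show ?thesis by (simp add: \<phi>_def add_increasing2)
  qed
  define m where "m n = real ((2 * n) choose n) / 4 ^ n" for n :: nat
  \<comment> \<open>The time average of \<open>bound\<close>: by independence the product has mean
    \<open>m n ^ card G\<close> whatever the phases, while the bump averages to 0.\<close>
  have key: "m n ^ card G \<le> q ^ n" for n
  proof -
    let ?X = "\<lambda>t. \<Prod>\<omega>\<in>G. c \<omega> t ^ n"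
    have contX: "continuous_on A ?X" for A unfolding c_def by (intro continuous_intros) auto
    have "has_mean (\<lambda>t. \<Prod>\<omega>\<in>G. complex_of_real (c \<omega> t ^ n)) (\<Prod>\<omega>\<in>G. of_real (m n))"
      unfolding c_def m_def
      by (rule has_mean_prod_trig_poly[OF G(1) rat_indep_frequencies[OF G(1,3)], 
          where g = "\<lambda>_ x. complex_of_real (((1 + cos x) / 2) ^ n)"]) (rule trig_poly_fejer)
    then have "((\<lambda>T. integral {0..T} (\<lambda>t. complex_of_real (?X t)) /\<^sub>R T) \<longlongrightarrow> of_real (m n ^ card G)) at_top"
      by (simp add: has_mean_def)
    moreover have "integral {0..T} (\<lambda>t. complex_of_real (?X t)) = of_real (integral {0..T} ?X)" for T
      using integral_linear[OF integrable_continuous_real[OF contX] bounded_linear_of_real] by (simp only: o_def)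
    moreover have "complex_of_real x /\<^sub>R T = complex_of_real (x /\<^sub>R T)" for x T
      by (simp add: scaleR_conv_of_real)
    ultimately have "((\<lambda>T. complex_of_real (integral {0..T} ?X /\<^sub>R T)) \<longlongrightarrow> of_real (m n ^ card G)) at_top"
      by (simp only:)
    then have lim1: "((\<lambda>T. integral {0..T} ?X /\<^sub>R T) \<longlongrightarrow> m n ^ card G) at_top"
      by (subst (asm) tendsto_of_real_iff)
    have lim2: "((\<lambda>T. q ^ n + 2 * (integral {0..T} (\<lambda>t. \<phi> (f t)) /\<^sub>R T)) \<longlongrightarrow> q ^ n + 2 * 0) at_top"
      by (intro tendsto_intros avg0)
    have "\<forall>\<^sub>F T in at_top. integral {0..T} ?X /\<^sub>R T \<le> q ^ n + 2 * (integral {0..T} (\<lambda>t. \<phi> (f t)) /\<^sub>R T)"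
      using eventually_gt_at_top[of 0]
    proof eventually_elim
      case (elim T)
      have cont\<phi>: "continuous_on {0..T} (\<lambda>t. \<phi> (f t))"
        by (rule continuous_on_compose2[OF lipschitz_on_continuous_on[OF lip] continuous_on_subset[OF continuous_f]]) auto
      have "integral {0..T} ?X \<le> integral {0..T} (\<lambda>t. q ^ n + 2 * \<phi> (f t))"
        by (intro integral_le integrable_continuous_real contX continuous_intros cont\<phi> bound)
      also have "\<dots> = T * q ^ n + 2 * integral {0..T} (\<lambda>t. \<phi> (f t))"
        using elim by (subst Henstock_Kurzweil_Integration.integral_add) (auto intro!: integrable_continuous_real continuous_intros cont\<phi>)
      finally show ?case using elim by (simp add: field_simps)
    qed
    from tendsto_le[OF _ lim2 lim1 this] show ?thesis by simp
  qed
  have k: "card G > 0" using G by (simp add: card_gt_0_iff)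
  \<comment> \<open>Extracting the root of order \<open>card G\<close> reduces \<open>key\<close> to
    \<open>1 / (2 * n) \<le> p ^ n\<close> with a fixed \<open>p < 1\<close>, impossible for large
    \<open>n\<close>.\<close>
  define p where "p = root (card G) q"
  have p: "0 \<le> p" "p < 1" "p ^ card G = q" using q k by (auto simp: p_def)
  have le: "1 \<le> 2 * (real n * p ^ n)" if n: "n > 0" for n
  proof -
    have "1 / (2 * real n) \<le> m n"
      using central_binomial_lower_bound[OF n] n by (simp add: m_def field_simps)
    then have "(1 / (2 * real n)) ^ card G \<le> m n ^ card G" by (intro power_mono) auto
    also have "\<dots> \<le> q ^ n" by (rule key)
    also have "\<dots> = (p ^ n) ^ card G" unfolding p(3)[symmetric] by (simp flip: power_mult add: mult.commute)
    finally have "1 / (2 * real n) \<le> p ^ n" using p k by (subst (asm) power_mono_iff) auto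
    then show ?thesis using n by (simp add: field_simps)
  qed
  have "(\<lambda>n. real n * p ^ n) \<longlonglongrightarrow> 0" using p by (intro powser_times_n_limit_0) auto
  then have "\<forall>\<^sub>F n in sequentially. real n * p ^ n < 1 / 2" by (rule order_tendstoD) auto
  then have "\<forall>\<^sub>F n in sequentially. real n * p ^ n < 1 / 2 \<and> n > 0"
    using eventually_gt_at_top[of 0] by (rule eventually_conj)
  then obtain n where "real n * p ^ n < 1 / 2" "n > 0" by (auto simp: eventually_sequentially)
  with le[of n] show False by simp
qed

text \<open>The strict inequalities leave room to discard a small tail and still realise
  \<open>w\<close> exactly as a linkage with finitely many arms.\<close>

lemma \<rho>_nonzero_near:
  assumes max: "(SUP \<omega>\<in>\<Omega>. norm (a \<omega>)) < 1 / 2 * S" and w: "norm w < S" and e: "e > 0"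
  shows "\<exists>y. dist y w < e \<and> \<rho> y \<noteq> 0"
proof -
  \<comment> \<open>The three margins: the tail must stay below \<open>e / 4\<close>, the kept arms
    must still reach \<open>w\<close>, and no kept arm may be longer than the others
    together.\<close>
  define d where "d = min (e / 4) (min (S - norm w) (S - 2 * (SUP \<omega>\<in>\<Omega>. norm (a \<omega>))))"
  have d: "d > 0" using assms by (auto simp: d_def)
  obtain G where G: "finite G" "E \<subseteq> G" "G \<subseteq> \<Omega>" "tail G < d"
    using exists_small_tail[OF E_spec(1,2) d] by blast
  have bdd: "bdd_above ((\<lambda>\<omega>. norm (a \<omega>)) ` \<Omega>)"
  proof (rule bdd_aboveI2)
    fix \<omega> assume "\<omega> \<in> \<Omega>"
    then show "norm (a \<omega>) \<le> S" using finite_sum_le_infsum[OF summable, of "{\<omega>}"] by (simp add: S_def)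
  qed
  have "\<exists>u. (\<forall>\<omega>\<in>G. norm (u \<omega>) = 1) \<and> w = (\<Sum>\<omega>\<in>G. of_real (norm (a \<omega>)) * u \<omega>)"
  proof (rule exists_linkage[OF G(1)])
    show "norm w \<le> (\<Sum>\<omega>\<in>G. norm (a \<omega>))" using G(4) by (auto simp: d_def tail_def)
    fix \<omega> assume "\<omega> \<in> G"
    then have "norm (a \<omega>) \<le> (SUP \<omega>\<in>\<Omega>. norm (a \<omega>))" using G(3) by (intro cSUP_upper bdd) auto
    moreover have "S - (\<Sum>\<omega>\<in>G. norm (a \<omega>)) < S - 2 * (SUP \<omega>\<in>\<Omega>. norm (a \<omega>))"
      using G(4) by (auto simp: d_def tail_def)
    ultimately show "2 * norm (a \<omega>) - (\<Sum>\<omega>\<in>G. norm (a \<omega>)) \<le> norm w" using norm_ge_zero[of w] by linarith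
  qed auto
  then obtain u where "\<forall>\<omega>\<in>G. norm (u \<omega>) = 1" "w = (\<Sum>\<omega>\<in>G. of_real (norm (a \<omega>)) * u \<omega>)" by blast
  moreover have "tail G < e / 4" using G(4) by (auto simp: d_def)
  moreover have "G \<noteq> {}" using G(2) E_spec by auto
  ultimately show ?thesis using \<rho>_positive_near[OF G(1) _ G(3) _ _ e] by blast
qed

lemma S_pos: "S > 0"
proof -
  obtain \<omega> where "\<omega> \<in> \<Omega>" using E_spec by fastforce
  then have "norm (a \<omega>) \<le> S" using finite_sum_le_infsum[OF summable, of "{\<omega>}"] by (simp add: S_def)
  moreover have "norm (a \<omega>) > 0" using nz[OF \<open>\<omega> \<in> \<Omega>\<close>] by simp
  ultimately show ?thesis by linarith
qed

end

theorem theorem2p1: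
  fixes \<Omega> :: "complex set" and a :: "complex \<Rightarrow> complex"
  assumes "countable \<Omega>"
    and "0 \<notin> \<Omega>"
    and "infinite \<Omega> \<or> card \<Omega> \<ge> 5"
    and "\<And>\<omega>. \<omega> \<in> \<Omega> \<Longrightarrow> a \<omega> \<noteq> 0"
    and "(\<lambda>\<omega>. norm (a \<omega>)) summable_on \<Omega>"
    and "\<Omega> \<subseteq> \<real>"
    and "lin_indep_over_rat \<Omega>"
  shows "\<exists>M :: complex \<Rightarrow> real.
     (\<forall>\<Phi> :: complex \<Rightarrow> complex.
        locally_riemann_integrable \<Phi> \<longrightarrow>
          integrable lebesgue (\<lambda>w. complex_of_real (M w) * \<Phi> w) \<and>
          ((\<forall>T>0. (\<lambda>t. \<Phi> (f_Pi \<Omega> a t)) integrable_on {0..T}) \<longrightarrow>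
            ((\<lambda>T. integral {0..T} (\<lambda>t. \<Phi> (f_Pi \<Omega> a t)) /\<^sub>R T) \<longlongrightarrow>
               plane_integral (\<lambda>w. complex_of_real (M w) * \<Phi> w)) at_top)) \<and>
     continuous_on UNIV M \<and>
     (\<forall>w. M w \<ge> 0) \<and>
     compact (supp M) \<and>
     plane_integral M = 1 \<and>
     supp M \<subseteq> {w. norm w \<le> (\<Sum>\<^sub>\<infinity>\<omega>\<in>\<Omega>. norm (a \<omega>))} \<and>
     ((SUP \<omega>\<in>\<Omega>. norm (a \<omega>)) < 1 / 2 * (\<Sum>\<^sub>\<infinity>\<omega>\<in>\<Omega>. norm (a \<omega>)) \<longrightarrow>
        supp M = {w. norm w \<le> (\<Sum>\<^sub>\<infinity>\<omega>\<in>\<Omega>. norm (a \<omega>))})"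
proof -
  interpret indep_frequencies \<Omega> a by unfold_locales (use assms in auto)
  \<comment> \<open>The factor compensates the normalisation of \<open>plane_integral\<close>, which
    divides by \<open>2 * pi\<close>.\<close>
  define M where "M w = 2 * pi * \<rho> w" for w
  have disc: "{w. norm w \<le> (\<Sum>\<^sub>\<infinity>\<omega>\<in>\<Omega>. norm (a \<omega>))} = cball 0 S" by (auto simp: S_def)
  have M_\<rho>: "complex_of_real (M w) * z = (2 * pi) *\<^sub>R (complex_of_real (\<rho> w) * z)" for w z
    by (simp add: M_def scaleR_conv_of_real)
  have sub: "supp M \<subseteq> cball 0 S"
    unfolding supp_def using \<rho>_outside by (intro closure_minimal) (force simp: M_def)+
  have "integrable lebesgue (\<lambda>w. complex_of_real (M w) * \<Phi> w)"
    if "locally_riemann_integrable \<Phi>" for \<Phi>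
    unfolding M_\<rho> using time_average_tendsto(1)[OF that] by (rule integrable_scaleR_right)
  moreover have "((\<lambda>T. integral {0..T} (\<lambda>t. \<Phi> (f_Pi \<Omega> a t)) /\<^sub>R T) \<longlongrightarrow>
               plane_integral (\<lambda>w. complex_of_real (M w) * \<Phi> w)) at_top"
    if "locally_riemann_integrable \<Phi>" "\<forall>T>0. (\<lambda>t. \<Phi> (f_Pi \<Omega> a t)) integrable_on {0..T}" for \<Phi>
  proof -
    have "plane_integral (\<lambda>w. complex_of_real (M w) * \<Phi> w) = (LINT w|lebesgue. complex_of_real (\<rho> w) * \<Phi> w)"
      unfolding plane_integral_def M_\<rho> by simp
    then show ?thesis using time_average_tendsto(2)[OF that(1)] that(2) by (simp add: f_def)
  qed
  moreover have "continuous_on UNIV M" unfolding M_def by (intro continuous_intros continuous_\<rho>)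
  moreover have "M w \<ge> 0" for w using \<rho>_nonneg[of w] by (simp add: M_def)
  moreover have "compact (supp M)"
    using compact_Int_closed[OF compact_cball[of 0 S], of "supp M"] sub by (simp add: supp_def Int_absorb1)
  moreover have "plane_integral M = 1"
    unfolding plane_integral_def M_def by (subst integral_completion) (simp_all add: integral_\<rho>)
  moreover have "supp M = cball 0 S" if "(SUP \<omega>\<in>\<Omega>. norm (a \<omega>)) < 1 / 2 * S"
  proof (rule antisym[OF sub])
    have "ball 0 S \<subseteq> supp M"
      unfolding supp_def using \<rho>_nonzero_near[OF that] by (auto simp: closure_approachable M_def conj_commute)
    \<comment> \<open>The support is closed, and the closure of the open disc is the closed one
      because \<open>S > 0\<close>.\<close>
    then have "closure (ball 0 S) \<subseteq> supp M" unfolding supp_def by (rule closure_minimal) auto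
    then show "cball 0 S \<subseteq> supp M" using S_pos by simp
  qed
  ultimately show ?thesis unfolding disc using sub by (intro exI[of _ M]) (simp add: S_def)
qed

end
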